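(* Let $\Phi$ be a root system of type $D_l$ with $l\ge 5$ or $E_l$ with $l\in\{6,7,8\}$, let $R$ be a commutative ring with $1$, and let $V$ be the adjoint module over $R$ of the simply connected Chevalley group $G(\Phi,R)$. The set of vectors $v=(v_\lambda)\in V$ satisfying, for all $\alpha,\beta\in\Phi$ with $\alpha\perp\beta$, all three of the following equations: $$v_\alpha v_\beta=\sum_{\{\gamma,\delta\}\in S_{\pi/2}(\alpha,\beta)}N_{\alpha,-\gamma}N_{\beta,-\delta}v_\gamma v_\delta,$$ $$v_\alpha\cdot\sum_{s=1}^l\langle\beta,\alpha_s\rangle \hat v_{s}=-\sum_{\{\gamma,\delta\}\in S_{2\pi/3}(\alpha,\beta),\ \angle(\gamma,\beta)=\pi/3}N_{\gamma,\delta}v_\gamma v_\delta,$$ $$\Bigl(\sum_{s=1}^l\langle\alpha,\alpha_s\rangle \hat v_{s}\Bigr)\Bigl(\sum_{s=1}^l\langle\beta,\alpha_s\rangle \hat{v}_{s}\Bigr) =\sum_{(\gamma,\delta)\in S'_{\pi}(\alpha,\beta)}v_\gamma v_\delta-\sum_{(\gamma,\delta)\in S_{\pi}(\alpha,\beta)}v_\gamma v_\delta,$$ is invariant under the action of the elementary group $E(\Phi,R)$.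
   Context: $\Phi$ lies in a Euclidean space with scalar product $(\cdot,\cdot)$ normalized so that all roots have length $1$; $\langle\alpha,\beta\rangle=2(\alpha,\beta)/(\beta,\beta)$; $\angle(\alpha,\beta)$ is the angle between $\alpha$ and $\beta$. $\Pi=\{\alpha_1,\dots,\alpha_l\}$ is a fundamental system (Bourbaki numbering), and $\alpha=\sum_s m_s(\alpha)\alpha_s$ for $\alpha\in\Phi$. $N_{\alpha,\beta}\in\{0,\pm1\}$ are the structure constants of the simple complex Lie algebra of type $\Phi$ in a fixed Chevalley basis: $[e_\alpha,e_\beta]=N_{\alpha,\beta}e_{\alpha+\beta}$ if $\alpha+\beta\in\Phi$, $N_{\alpha,\beta}=0$ if $\alpha+\beta\notin\Phi\cup\{0\}$, and $[e_\alpha,e_{-\alpha}]=h_\alpha$. $V$ is the free $R$-module with basis $e^\alpha$ ($\alpha\in\Phi$) and $\hat e^s$ ($s=1,\dots,l$, the zero weight vectors); write $v=\sum_{\alpha\in\Phi}v_\alpha e^\alpha+\sum_{s=1}^l\hat v_s\hat e^s$. The elementary root unipotents $x_\rho(\xi)$, $\rho\in\Phi$, $\xi\in R$, act by: $x_\rho(\xi)e^\lambda=e^\lambda$ if $\lambda\in\Phi$, $\lambda+\rho\notin\Phi\cup\{0\}$; $x_\rho(\xi)e^\lambda=e^\lambda+N_{\rho,\lambda}\xi e^{\lambda+\rho}$ if $\lambda,\lambda+\rho\in\Phi$; $x_\rho(\xi)\hat e^s=\hat e^s-\langle\rho,\alpha_s\rangle\xi e^\rho$; $x_\rho(\xi)e^{-\rho}=e^{-\rho}+\sum_{s=1}^l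 m_s(\rho)\xi\hat e^s-\xi^2e^\rho$. $E(\Phi,R)$ is the subgroup of $G(\Phi,R)$ generated by all $x_\rho(\xi)$. For $\alpha,\beta\in\Phi$ with $\alpha\perp\beta$ (all $\gamma,\delta$ below are roots): $S_{\pi/2}(\alpha,\beta)=\{\{\gamma,\delta\}\mid\gamma+\delta=\alpha+\beta,\ \{\gamma,\delta\}\ne\{\alpha,\beta\}\}$ (unordered pairs; the coefficient $N_{\alpha,-\gamma}N_{\beta,-\delta}$ does not change when $\gamma,\delta$ are swapped); $S_{2\pi/3}(\alpha,\beta)=\{\{\gamma,\delta\}\mid\gamma+\delta=\alpha,\ (\gamma,\beta)\neq0\}$ (unordered pairs; in each of them exactly one member makes angle $\pi/3$ with $\beta$ and the other makes angle $2\pi/3$; in the second equation $\gamma$ denotes the member with $\angle(\gamma,\beta)=\pi/3$); $S_\pi(\alpha,\beta)=\{(\gamma,\delta)\mid\gamma+\delta=0,\ \angle(\gamma,\alpha)=\angle(\gamma,\beta)=2\pi/3\}$ (ordered pairs); $S'_\pi(\alpha,\beta)=\{(\gamma,\delta)\mid\gamma+\delta=0,\ \angle(\gamma,\alpha)=\angle(\delta,\beta)=2\pi/3\}$ (ordered pairs). *)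

theory Defs
  imports "HOL-Analysis.Analysis" "HOL-Algebra.Group_Action" "HOL-Algebra.Generated_Groups"
begin

section \<open>Root systems\<close>

text \<open>The integer \<open>\<langle>\<alpha>,\<beta>\<rangle>\<close>. The rounding is harmless: on the roots of a root system the
  argument is an integer.\<close>

definition cartan_int :: "'a::real_inner \<Rightarrow> 'a \<Rightarrow> int" where
  "cartan_int \<alpha> \<beta> = \<lfloor>2 * (\<alpha> \<bullet> \<beta>) / (\<beta> \<bullet> \<beta>)\<rfloor>"

definition angle :: "'a::real_inner \<Rightarrow> 'a \<Rightarrow> real" where
  "angle u v = arccos ((u \<bullet> v) / (norm u * norm v))"

text \<open>Reduced crystallographic root systems. The roots are not required to span the ambient
  Euclidean space; \<open>\<Phi>\<close> is a root system in its linear span (so that, e.g., \<open>E\<^sub>6\<close> and \<open>E\<^sub>7\<close>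
  inside \<open>\<real>\<^sup>8\<close> are covered).\<close>

definition root_system :: "'a::euclidean_space set \<Rightarrow> bool" where
  "root_system \<Phi> \<longleftrightarrow>
     finite \<Phi> \<and> 0 \<notin> \<Phi> \<and>
     (\<forall>\<alpha>\<in>\<Phi>. \<forall>\<beta>\<in>\<Phi>. \<beta> - (2 * (\<beta> \<bullet> \<alpha>) / (\<alpha> \<bullet> \<alpha>)) *\<^sub>R \<alpha> \<in> \<Phi>) \<and>
     (\<forall>\<alpha>\<in>\<Phi>. \<forall>\<beta>\<in>\<Phi>. 2 * (\<alpha> \<bullet> \<beta>) / (\<beta> \<bullet> \<beta>) \<in> \<int>) \<and>
     (\<forall>\<alpha>\<in>\<Phi>. \<forall>c::real. c *\<^sub>R \<alpha> \<in> \<Phi> \<longrightarrow> c = 1 \<or> c = -1)"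

definition fundamental_system :: "'a::euclidean_space set \<Rightarrow> (nat \<Rightarrow> 'a) \<Rightarrow> nat \<Rightarrow> bool" where
  "fundamental_system \<Phi> a l \<longleftrightarrow>
     inj_on a {1..l} \<and> a ` {1..l} \<subseteq> \<Phi> \<and> independent (a ` {1..l}) \<and>
     (\<forall>\<alpha>\<in>\<Phi>. \<exists>c::nat \<Rightarrow> nat.
        \<alpha> = (\<Sum>s=1..l. real (c s) *\<^sub>R a s) \<or> \<alpha> = - (\<Sum>s=1..l. real (c s) *\<^sub>R a s))"

text \<open>The integer coefficient \<open>m\<^sub>s(\<alpha>)\<close> of the \<open>s\<close>-th fundamental root in \<open>\<alpha>\<close>.\<close>

definition root_coeff :: "(nat \<Rightarrow> 'a::euclidean_space) \<Rightarrow> nat \<Rightarrow> nat \<Rightarrow> 'a \<Rightarrow> int" where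
  "root_coeff a l s \<alpha> = \<lfloor>representation (a ` {1..l}) \<alpha> (a s)\<rfloor>"

text \<open>The edges of the Dynkin diagrams in the Bourbaki numbering: for \<open>D\<^sub>l\<close> the chain
  \<open>1, 2, \<dots>, l-1\<close> with \<open>l\<close> attached to \<open>l-2\<close>; for \<open>E\<^sub>l\<close> the chain \<open>1, 3, 4, \<dots>, l\<close> with \<open>2\<close>
  attached to \<open>4\<close>.\<close>

definition D_edges :: "nat \<Rightarrow> nat set set" where
  "D_edges l = {{i, i + 1} | i. 1 \<le> i \<and> i + 1 < l} \<union> {{l - 2, l}}"

definition E_edges :: "nat \<Rightarrow> nat set set" where
  "E_edges l = {{1, 3}, {2, 4}} \<union> {{i, i + 1} | i. 3 \<le> i \<and> i + 1 \<le> l}"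

definition simply_laced_diagram ::
  "(nat \<Rightarrow> 'a::euclidean_space) \<Rightarrow> nat \<Rightarrow> nat set set \<Rightarrow> bool" where
  "simply_laced_diagram a l E \<longleftrightarrow>
     (\<forall>i\<in>{1..l}. \<forall>j\<in>{1..l}.
        cartan_int (a i) (a j) = (if i = j then 2 else if {i, j} \<in> E then -1 else 0))"


section \<open>Simple complex Lie algebras and Chevalley bases\<close>

locale simple_complex_lie_algebra = vector_space scale
  for scale :: "complex \<Rightarrow> 'g::ab_group_add \<Rightarrow> 'g" +
  fixes bracket :: "'g \<Rightarrow> 'g \<Rightarrow> 'g"
  assumes bracket_linear_right: "Vector_Spaces.linear scale scale (\<lambda>y. bracket x y)"
    and bracket_linear_left: "Vector_Spaces.linear scale scale (\<lambda>x. bracket x y)"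
    and bracket_self: "bracket x x = 0"
    and jacobi: "bracket x (bracket y z) + bracket y (bracket z x) + bracket z (bracket x y) = 0"
    and non_abelian: "\<exists>x y. bracket x y \<noteq> 0"
    and simple: "subspace I \<Longrightarrow> (\<And>x y. y \<in> I \<Longrightarrow> bracket x y \<in> I) \<Longrightarrow> I = {0} \<or> I = UNIV"

text \<open>A Chevalley basis \<open>e\<^sub>\<alpha>\<close> (\<open>\<alpha> \<in> \<Phi>\<close>), \<open>h\<^bsub>\<alpha>\<^sub>s\<^esub>\<close> (\<open>1 \<le> s \<le> l\<close>) of the simple Lie algebra whose root
  system with respect to the Cartan subalgebra spanned by the \<open>h\<^bsub>\<alpha>\<^sub>s\<^esub>\<close> is \<open>\<Phi>\<close>. The vectors
  \<open>h\<^sub>\<alpha>\<close> are the coroots: \<open>ad h\<^sub>\<alpha>\<close> has eigenvalue \<open>\<langle>\<beta>,\<alpha>\<rangle>\<close> on \<open>e\<^sub>\<beta>\<close>. The value \<open>N \<alpha> (-\<alpha>)\<close> is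
  left unspecified.\<close>

locale chevalley_basis = simple_complex_lie_algebra scale bracket
  for scale :: "complex \<Rightarrow> 'g::ab_group_add \<Rightarrow> 'g" and bracket +
  fixes \<Phi> :: "'a::euclidean_space set" and a :: "nat \<Rightarrow> 'a" and l :: nat
    and e :: "'a \<Rightarrow> 'g" and h :: "'a \<Rightarrow> 'g" and N :: "'a \<Rightarrow> 'a \<Rightarrow> int"
  assumes inj_e: "inj_on e \<Phi>"
    and inj_h: "inj_on (\<lambda>s. h (a s)) {1..l}"
    and disjoint: "e ` \<Phi> \<inter> h ` a ` {1..l} = {}"
    and basis_independent: "independent (e ` \<Phi> \<union> h ` a ` {1..l})"
    and basis_span: "span (e ` \<Phi> \<union> h ` a ` {1..l}) = UNIV"
    and bracket_hh: "\<alpha> \<in> \<Phi> \<Longrightarrow> \<beta> \<in> \<Phi> \<Longrightarrow> bracket (h \<alpha>) (h \<beta>) = 0"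
    and bracket_he: "\<alpha> \<in> \<Phi> \<Longrightarrow> \<beta> \<in> \<Phi> \<Longrightarrow>
      bracket (h \<alpha>) (e \<beta>) = scale (of_int (cartan_int \<beta> \<alpha>)) (e \<beta>)"
    and bracket_ee_opp: "\<alpha> \<in> \<Phi> \<Longrightarrow> bracket (e \<alpha>) (e (- \<alpha>)) = h \<alpha>"
    and bracket_ee: "\<alpha> \<in> \<Phi> \<Longrightarrow> \<beta> \<in> \<Phi> \<Longrightarrow> \<alpha> + \<beta> \<in> \<Phi> \<Longrightarrow>
      bracket (e \<alpha>) (e \<beta>) = scale (of_int (N \<alpha> \<beta>)) (e (\<alpha> + \<beta>))"
    and bracket_ee_zero: "\<alpha> \<in> \<Phi> \<Longrightarrow> \<beta> \<in> \<Phi> \<Longrightarrow> \<alpha> + \<beta> \<notin> \<Phi> \<union> {0} \<Longrightarrow>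
      bracket (e \<alpha>) (e \<beta>) = 0"
    and N_zero: "\<alpha> \<in> \<Phi> \<Longrightarrow> \<beta> \<in> \<Phi> \<Longrightarrow> \<alpha> + \<beta> \<notin> \<Phi> \<union> {0} \<Longrightarrow> N \<alpha> \<beta> = 0"
    and N_range: "\<alpha> \<in> \<Phi> \<Longrightarrow> \<beta> \<in> \<Phi> \<Longrightarrow> \<alpha> + \<beta> \<in> \<Phi> \<Longrightarrow> N \<alpha> \<beta> \<in> {-1, 0, 1}"
    and N_opp: "\<alpha> \<in> \<Phi> \<Longrightarrow> \<beta> \<in> \<Phi> \<Longrightarrow> \<alpha> + \<beta> \<in> \<Phi> \<Longrightarrow> N (- \<alpha>) (- \<beta>) = - N \<alpha> \<beta>"


section \<open>The adjoint module\<close>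

datatype 'a weight_index = Root 'a | Zero nat

text \<open>The free module \<open>V\<close>: a vector is its family of coordinates, \<open>v\<^sub>\<alpha> = v (Root \<alpha>)\<close> for
  \<open>\<alpha> \<in> \<Phi>\<close> and the \<open>s\<close>-th zero weight coordinate \<open>v (Zero s)\<close> for \<open>1 \<le> s \<le> l\<close>, extended
  by \<open>0\<close> to all indices.\<close>

definition adjoint_space ::
  "'a set \<Rightarrow> nat \<Rightarrow> ('a weight_index \<Rightarrow> 'r::comm_ring_1) set" where
  "adjoint_space \<Phi> l = {v. \<forall>i. i \<notin> Root ` \<Phi> \<union> Zero ` {1..l} \<longrightarrow> v i = 0}"

definition basis_vec :: "'a weight_index \<Rightarrow> 'a weight_index \<Rightarrow> 'r::comm_ring_1" where
  "basis_vec i = (\<lambda>j. if j = i then 1 else 0)"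

text \<open>A group \<open>G\<close> acting linearly on \<open>V\<close>, with elements \<open>x \<rho> \<xi>\<close> that act as the elementary root
  unipotents of the adjoint representation. The simply connected Chevalley group \<open>G(\<Phi>,R)\<close> with
  its elementary root unipotents is such a group.\<close>

locale adjoint_module = group_action G "adjoint_space \<Phi> l" \<phi>
  for G (structure)
    and \<Phi> :: "'a::euclidean_space set" and l :: nat
    and \<phi> :: "'G \<Rightarrow> ('a weight_index \<Rightarrow> 'r::comm_ring_1) \<Rightarrow> ('a weight_index \<Rightarrow> 'r)" +
  fixes a :: "nat \<Rightarrow> 'a" and N :: "'a \<Rightarrow> 'a \<Rightarrow> int" and x :: "'a \<Rightarrow> 'r \<Rightarrow> 'G"
  assumes action_add: "g \<in> carrier G \<Longrightarrow> u \<in> adjoint_space \<Phi> l \<Longrightarrow> v \<in> adjoint_space \<Phi> l \<Longrightarrow>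
      \<phi> g (\<lambda>i. u i + v i) = (\<lambda>i. \<phi> g u i + \<phi> g v i)"
    and action_scale: "g \<in> carrier G \<Longrightarrow> v \<in> adjoint_space \<Phi> l \<Longrightarrow>
      \<phi> g (\<lambda>i. c * v i) = (\<lambda>i. c * \<phi> g v i)"
    and x_closed: "\<rho> \<in> \<Phi> \<Longrightarrow> x \<rho> \<xi> \<in> carrier G"
    and x_fixed: "\<rho> \<in> \<Phi> \<Longrightarrow> \<mu> \<in> \<Phi> \<Longrightarrow> \<mu> + \<rho> \<notin> \<Phi> \<union> {0} \<Longrightarrow>
      \<phi> (x \<rho> \<xi>) (basis_vec (Root \<mu>)) = basis_vec (Root \<mu>)"
    and x_shift: "\<rho> \<in> \<Phi> \<Longrightarrow> \<mu> \<in> \<Phi> \<Longrightarrow> \<mu> + \<rho> \<in> \<Phi> \<Longrightarrow>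
      \<phi> (x \<rho> \<xi>) (basis_vec (Root \<mu>)) =
        (\<lambda>i. basis_vec (Root \<mu>) i + of_int (N \<rho> \<mu>) * \<xi> * basis_vec (Root (\<mu> + \<rho>)) i)"
    and x_zero: "\<rho> \<in> \<Phi> \<Longrightarrow> s \<in> {1..l} \<Longrightarrow>
      \<phi> (x \<rho> \<xi>) (basis_vec (Zero s)) =
        (\<lambda>i. basis_vec (Zero s) i - of_int (cartan_int \<rho> (a s)) * \<xi> * basis_vec (Root \<rho>) i)"
    and x_opposite: "\<rho> \<in> \<Phi> \<Longrightarrow>
      \<phi> (x \<rho> \<xi>) (basis_vec (Root (- \<rho>))) =
        (\<lambda>i. basis_vec (Root (- \<rho>)) i
             + (\<Sum>s=1..l. of_int (root_coeff a l s \<rho>) * \<xi> * basis_vec (Zero s) i)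
             - \<xi>\<^sup>2 * basis_vec (Root \<rho>) i)"

definition elementary_subgroup ::
  "('G, 'm) monoid_scheme \<Rightarrow> 'a set \<Rightarrow> ('a \<Rightarrow> 'r \<Rightarrow> 'G) \<Rightarrow> 'G set" where
  "elementary_subgroup G \<Phi> x = generate G {x \<rho> \<xi> | \<rho> \<xi>. \<rho> \<in> \<Phi>}"


section \<open>The quadratic equations\<close>

definition S_half_pi :: "'a::real_inner set \<Rightarrow> 'a \<Rightarrow> 'a \<Rightarrow> 'a set set" where
  "S_half_pi \<Phi> \<alpha> \<beta> =
     {{\<gamma>, \<delta>} | \<gamma> \<delta>. \<gamma> \<in> \<Phi> \<and> \<delta> \<in> \<Phi> \<and> \<gamma> + \<delta> = \<alpha> + \<beta> \<and> {\<gamma>, \<delta>} \<noteq> {\<alpha>, \<beta>}}"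

definition S_two_thirds_pi :: "'a::real_inner set \<Rightarrow> 'a \<Rightarrow> 'a \<Rightarrow> 'a set set" where
  "S_two_thirds_pi \<Phi> \<alpha> \<beta> =
     {{\<gamma>, \<delta>} | \<gamma> \<delta>. \<gamma> \<in> \<Phi> \<and> \<delta> \<in> \<Phi> \<and> \<gamma> + \<delta> = \<alpha> \<and> \<gamma> \<bullet> \<beta> \<noteq> 0}"

definition S_pi :: "'a::real_inner set \<Rightarrow> 'a \<Rightarrow> 'a \<Rightarrow> ('a \<times> 'a) set" where
  "S_pi \<Phi> \<alpha> \<beta> =
     {(\<gamma>, \<delta>). \<gamma> \<in> \<Phi> \<and> \<delta> \<in> \<Phi> \<and> \<gamma> + \<delta> = 0 \<and> angle \<gamma> \<alpha> = 2 * pi / 3 \<and> angle \<gamma> \<beta> = 2 * pi / 3}"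

definition S_pi' :: "'a::real_inner set \<Rightarrow> 'a \<Rightarrow> 'a \<Rightarrow> ('a \<times> 'a) set" where
  "S_pi' \<Phi> \<alpha> \<beta> =
     {(\<gamma>, \<delta>). \<gamma> \<in> \<Phi> \<and> \<delta> \<in> \<Phi> \<and> \<gamma> + \<delta> = 0 \<and> angle \<gamma> \<alpha> = 2 * pi / 3 \<and> angle \<delta> \<beta> = 2 * pi / 3}"

text \<open>The sum of \<open>f \<gamma> \<delta>\<close> over a set of unordered pairs \<open>{\<gamma>, \<delta>}\<close>, each pair contributing one term.
  It is meant for summands that do not change when \<open>\<gamma>\<close> and \<open>\<delta>\<close> are swapped, for which the
  ordering chosen by \<open>SOME\<close> is immaterial.\<close>

definition sum_unordered :: "('a \<Rightarrow> 'a \<Rightarrow> 'r::comm_monoid_add) \<Rightarrow> 'a set set \<Rightarrow> 'r" where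
  "sum_unordered f S = (\<Sum>P\<in>S. case (SOME p. P = {fst p, snd p}) of (\<gamma>, \<delta>) \<Rightarrow> f \<gamma> \<delta>)"

definition equation_half_pi ::
  "'a::real_inner set \<Rightarrow> ('a \<Rightarrow> 'a \<Rightarrow> int) \<Rightarrow> ('a weight_index \<Rightarrow> 'r::comm_ring_1) \<Rightarrow> 'a \<Rightarrow> 'a \<Rightarrow> bool"
where
  "equation_half_pi \<Phi> N v \<alpha> \<beta> \<longleftrightarrow>
     v (Root \<alpha>) * v (Root \<beta>) =
       sum_unordered
         (\<lambda>\<gamma> \<delta>. of_int (N \<alpha> (- \<gamma>) * N \<beta> (- \<delta>)) * v (Root \<gamma>) * v (Root \<delta>))
         (S_half_pi \<Phi> \<alpha> \<beta>)"

text \<open>In the second equation each unordered pair enters through its ordering with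
  \<open>\<angle>(\<gamma>,\<beta>) = \<pi>/3\<close>.\<close>

definition equation_two_thirds_pi ::
  "'a::real_inner set \<Rightarrow> (nat \<Rightarrow> 'a) \<Rightarrow> nat \<Rightarrow> ('a \<Rightarrow> 'a \<Rightarrow> int) \<Rightarrow>
   ('a weight_index \<Rightarrow> 'r::comm_ring_1) \<Rightarrow> 'a \<Rightarrow> 'a \<Rightarrow> bool"
where
  "equation_two_thirds_pi \<Phi> a l N v \<alpha> \<beta> \<longleftrightarrow>
     v (Root \<alpha>) * (\<Sum>s=1..l. of_int (cartan_int \<beta> (a s)) * v (Zero s)) =
       - (\<Sum>(\<gamma>, \<delta>)\<in>{(\<gamma>, \<delta>). {\<gamma>, \<delta>} \<in> S_two_thirds_pi \<Phi> \<alpha> \<beta> \<and> angle \<gamma> \<beta> = pi / 3}.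
            of_int (N \<gamma> \<delta>) * v (Root \<gamma>) * v (Root \<delta>))"

definition equation_pi ::
  "'a::real_inner set \<Rightarrow> (nat \<Rightarrow> 'a) \<Rightarrow> nat \<Rightarrow>
   ('a weight_index \<Rightarrow> 'r::comm_ring_1) \<Rightarrow> 'a \<Rightarrow> 'a \<Rightarrow> bool"
where
  "equation_pi \<Phi> a l v \<alpha> \<beta> \<longleftrightarrow>
     (\<Sum>s=1..l. of_int (cartan_int \<alpha> (a s)) * v (Zero s)) *
     (\<Sum>s=1..l. of_int (cartan_int \<beta> (a s)) * v (Zero s)) =
       (\<Sum>(\<gamma>, \<delta>)\<in>S_pi' \<Phi> \<alpha> \<beta>. v (Root \<gamma>) * v (Root \<delta>)) -
       (\<Sum>(\<gamma>, \<delta>)\<in>S_pi \<Phi> \<alpha> \<beta>. v (Root \<gamma>) * v (Root \<delta>))"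

definition solution_set ::
  "'a::real_inner set \<Rightarrow> (nat \<Rightarrow> 'a) \<Rightarrow> nat \<Rightarrow> ('a \<Rightarrow> 'a \<Rightarrow> int) \<Rightarrow>
   ('a weight_index \<Rightarrow> 'r::comm_ring_1) set"
where
  "solution_set \<Phi> a l N =
     {v \<in> adjoint_space \<Phi> l. \<forall>\<alpha>\<in>\<Phi>. \<forall>\<beta>\<in>\<Phi>. orthogonal \<alpha> \<beta> \<longrightarrow>
        equation_half_pi \<Phi> N v \<alpha> \<beta> \<and>
        equation_two_thirds_pi \<Phi> a l N v \<alpha> \<beta> \<and>
        equation_pi \<Phi> a l v \<alpha> \<beta>}"

end

theory Submission
  imports Defs
begin

text \<open>
The equations say that three families of quadratic forms vanish. Write \<open>u \<gamma>\<close> for the root coordinates of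
a vector and \<open>h \<beta>\<close> for \<open>\<Sum>\<^sub>s \<langle>\<beta>,\<alpha>\<^sub>s\<rangle> v\<^sub>s\<close>, where the \<open>v\<^sub>s\<close> are the zero weight coordinates. For orthogonal
roots \<open>\<alpha>\<close>, \<open>\<beta>\<close> the forms are

  \<open>f(\<alpha>,\<beta>) = u \<alpha> u \<beta> - \<Sum> N\<^bsub>\<alpha>,-\<gamma>\<^esub> N\<^bsub>\<beta>,-\<delta>\<^esub> u \<gamma> u \<delta>\<close>,  over the pairs \<open>\<gamma> + \<delta> = \<alpha> + \<beta>\<close> other than \<open>{\<alpha>,\<beta>}\<close>,

  \<open>g(\<alpha>,\<beta>) = u \<alpha> h \<beta> + \<Sum> \<langle>\<gamma>,\<beta>\<rangle> N\<^bsub>\<gamma>,\<delta>\<^esub> u \<gamma> u \<delta>\<close>,  over the pairs \<open>\<gamma> + \<delta> = \<alpha>\<close>,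

  \<open>k(\<alpha>,\<beta>) = h \<alpha> h \<beta> + \<Sum> \<langle>\<gamma>,\<alpha>\<rangle> \<langle>\<gamma>,\<beta>\<rangle> u \<gamma> u (-\<gamma>)\<close>,  over the pairs \<open>{\<gamma>,-\<gamma>}\<close>.

All sums run over unordered pairs. The coefficients \<open>\<langle>\<gamma>,\<beta>\<rangle>\<close> replace the conditions on angles in the
equations; they make \<open>g\<close> linear in \<open>\<beta>\<close> and \<open>k\<close> bilinear, and this linearity absorbs most of the case
distinctions.

The value of a form of weight \<open>\<lambda>\<close> at \<open>x\<^sub>\<rho>(\<xi>) v\<close> is a combination of values at \<open>v\<close> of forms of weights \<open>\<lambda>\<close>,
\<open>\<lambda> - \<rho>\<close>, \<open>\<lambda> - 2\<rho>\<close>, with coefficients in \<open>\<int>[\<xi>]\<close>. Let \<open>m = \<langle>\<alpha>,\<rho>\<rangle>\<close>, \<open>n = \<langle>\<beta>,\<rho>\<rangle>\<close>, and let \<open>s\<^sub>\<rho>\<close> be the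
reflection. Up to exchanging \<open>\<alpha>\<close> and \<open>\<beta>\<close> in \<open>f\<close>, the passage from \<open>v\<close> to \<open>x\<^sub>\<rho>(\<xi>) v\<close> has this effect:

  \<^item> \<open>f(\<alpha>,\<beta>)\<close> is unchanged for \<open>m + n \<le> 0\<close>. For \<open>m = 1\<close>, \<open>n = 0\<close> it gains \<open>\<xi> N\<^bsub>\<rho>,\<alpha>-\<rho>\<^esub> f(\<alpha>-\<rho>,\<beta>)\<close>. For \<open>\<alpha> = \<rho>\<close>
    it gains \<open>- \<xi> g(\<beta>,\<rho>) - \<xi>\<^sup>2 f(-\<rho>,\<beta>)\<close>.

  \<^item> \<open>g(\<alpha>,\<beta>)\<close> is unchanged for \<open>m < 0\<close>. It gains \<open>\<xi> n f(\<alpha>,-\<rho>)\<close> for \<open>m = 0\<close>, \<open>\<xi> N\<^bsub>\<rho>,\<alpha>-\<rho>\<^esub> g(\<alpha>-\<rho>, s\<^sub>\<rho> \<beta>)\<close> for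
    \<open>m = 1\<close>, and \<open>- \<xi> k(\<rho>,\<beta>) - \<xi>\<^sup>2 g(-\<rho>,\<beta>)\<close> for \<open>\<alpha> = \<rho>\<close>.

  \<^item> \<open>k(\<alpha>,\<beta>)\<close> gains \<open>\<xi> g(-\<rho>, m\<beta> + n\<alpha> - mn\<rho>)\<close>.

The remaining case \<open>m = n = 1\<close> of the first family reduces to \<open>\<alpha> = \<rho>\<close>, because up to sign \<open>f(\<alpha>,\<beta>)\<close> depends
only on \<open>\<alpha> + \<beta>\<close> (\<open>half_pi_form_base_change\<close>). Hence the common zeros of the forms are carried to common
zeros (\<open>solves_unipotent\<close>), and \<open>x\<^sub>\<rho>(-\<xi>)\<close> inverts \<open>x\<^sub>\<rho>(\<xi>)\<close>.

The identities must hold with integral coefficients, since 2 may be a zero divisor in the ring, so a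
sum over unordered pairs cannot be replaced by half the sum over ordered ones. It is computed instead
on a set containing one member of each pair, and the freedom in the choice of this set is used to
adapt it to \<open>\<rho>\<close>. The signs all follow from one consequence of the Jacobi identity,
\<open>N\<^bsub>\<alpha>,\<beta>\<^esub> N\<^bsub>\<alpha>+\<beta>,\<gamma>\<^esub> = N\<^bsub>\<beta>,\<gamma>\<^esub> N\<^bsub>\<alpha>,\<beta>+\<gamma>\<^esub>\<close> for \<open>\<alpha>\<close> orthogonal to \<open>\<gamma>\<close>, together with the cyclic symmetry of \<open>N\<close>.
\<close>

section \<open>Simply laced root systems of unit roots\<close>

text \<open>On unit roots this is \<open>\<langle>\<alpha>,\<beta>\<rangle>\<close>. Unlike the rounded \<open>cartan_int\<close> it is bilinear on the whole space, so
  values at sums of roots simplify before it is known that the sums are roots.\<close>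
definition pairing :: "'a::real_inner \<Rightarrow> 'a \<Rightarrow> real"  (infixl "\<star>" 70) where
  "\<alpha> \<star> \<beta> = 2 * (\<alpha> \<bullet> \<beta>)"

lemma pairing_comm: "\<alpha> \<star> \<beta> = \<beta> \<star> \<alpha>"
  by (simp add: pairing_def inner_commute)

lemma pairing_simps [simp]:
  "(\<alpha> + \<beta>) \<star> \<gamma> = \<alpha> \<star> \<gamma> + \<beta> \<star> \<gamma>" "\<gamma> \<star> (\<alpha> + \<beta>) = \<gamma> \<star> \<alpha> + \<gamma> \<star> \<beta>"
  "(\<alpha> - \<beta>) \<star> \<gamma> = \<alpha> \<star> \<gamma> - \<beta> \<star> \<gamma>" "\<gamma> \<star> (\<alpha> - \<beta>) = \<gamma> \<star> \<alpha> - \<gamma> \<star> \<beta>"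
  "(- \<alpha>) \<star> \<gamma> = - (\<alpha> \<star> \<gamma>)" "\<gamma> \<star> (- \<alpha>) = - (\<gamma> \<star> \<alpha>)"
  "0 \<star> \<gamma> = 0" "\<gamma> \<star> 0 = 0"
  by (simp_all add: pairing_def inner_add_left inner_add_right inner_diff_left inner_diff_right)

lemma pairing_scaleR [simp]:
  "(c *\<^sub>R \<alpha>) \<star> \<beta> = c * (\<alpha> \<star> \<beta>)" "\<beta> \<star> (c *\<^sub>R \<alpha>) = c * (\<beta> \<star> \<alpha>)"
  by (simp_all add: pairing_def)

locale unit_root_system =
  fixes \<Phi> :: "'a::euclidean_space set"
  assumes finite_roots: "finite \<Phi>"
    and self_pairing [simp]: "\<alpha> \<in> \<Phi> \<Longrightarrow> \<alpha> \<star> \<alpha> = 2"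
    and reflection: "\<alpha> \<in> \<Phi> \<Longrightarrow> \<beta> \<in> \<Phi> \<Longrightarrow> \<beta> - (\<beta> \<star> \<alpha>) *\<^sub>R \<alpha> \<in> \<Phi>"
    and integral: "\<alpha> \<in> \<Phi> \<Longrightarrow> \<beta> \<in> \<Phi> \<Longrightarrow> \<alpha> \<star> \<beta> \<in> \<int>"
begin

lemma minus_root_iff [simp]: "- \<alpha> \<in> \<Phi> \<longleftrightarrow> \<alpha> \<in> \<Phi>"
proof -
  have "- \<alpha> \<in> \<Phi>" if "\<alpha> \<in> \<Phi>" for \<alpha>
    using reflection[of \<alpha> \<alpha>] that by (simp add: scaleR_2)
  from this[of \<alpha>] this[of "- \<alpha>"] show ?thesis by auto
qed

lemma cartan_int_root:
  assumes "\<alpha> \<in> \<Phi>" "\<beta> \<in> \<Phi>"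
  shows "real_of_int (cartan_int \<alpha> \<beta>) = \<alpha> \<star> \<beta>"
  using integral[OF assms] self_pairing[OF assms(2)]
  by (auto simp: cartan_int_def pairing_def elim!: Ints_cases)

lemma pairing_cases:
  assumes "\<alpha> \<in> \<Phi>" "\<beta> \<in> \<Phi>"
  shows "\<alpha> \<star> \<beta> = -2 \<or> \<alpha> \<star> \<beta> = -1 \<or> \<alpha> \<star> \<beta> = 0 \<or> \<alpha> \<star> \<beta> = 1 \<or> \<alpha> \<star> \<beta> = 2"
proof -
  obtain z where z: "\<alpha> \<star> \<beta> = of_int z"
    using integral[OF assms] by (auto elim: Ints_cases)
  have "\<bar>\<alpha> \<bullet> \<beta>\<bar> \<le> 1"
    using Cauchy_Schwarz_ineq2[of \<alpha> \<beta>] self_pairing[OF assms(1)] self_pairing[OF assms(2)]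
    by (simp add: norm_eq_sqrt_inner pairing_def)
  then have "\<bar>real_of_int z\<bar> \<le> 2" using z by (simp add: pairing_def)
  then have "z \<in> {-2,-1,0,1,2}" by auto
  then show ?thesis using z by auto
qed

text \<open>Equality in the Cauchy--Schwarz inequality: the value 2 forces equal roots. Most impossible cases
  below are excluded in this way.\<close>
lemma pairing_2_imp_eq:
  assumes "\<alpha> \<star> \<beta> = 2" "\<alpha> \<in> \<Phi>" "\<beta> \<in> \<Phi>" shows "\<alpha> = \<beta>"
proof -
  have "(\<alpha> - \<beta>) \<star> (\<alpha> - \<beta>) = 0"
    using assms by (simp add: pairing_comm)
  then show ?thesis by (simp add: pairing_def del: pairing_simps)
qed

lemma pairing_minus_2_imp_eq:
  assumes "\<alpha> \<star> \<beta> = -2" "\<alpha> \<in> \<Phi>" "\<beta> \<in> \<Phi>" shows "\<alpha> = - \<beta>"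
  using pairing_2_imp_eq[of \<alpha> "- \<beta>"] assms by simp

lemma add_root: "\<alpha> \<in> \<Phi> \<Longrightarrow> \<beta> \<in> \<Phi> \<Longrightarrow> \<alpha> \<star> \<beta> = -1 \<Longrightarrow> \<alpha> + \<beta> \<in> \<Phi>"
  using reflection[of \<beta> \<alpha>] by simp

lemma diff_root: "\<alpha> \<in> \<Phi> \<Longrightarrow> \<beta> \<in> \<Phi> \<Longrightarrow> \<alpha> \<star> \<beta> = 1 \<Longrightarrow> \<alpha> - \<beta> \<in> \<Phi>"
  using reflection[of \<beta> \<alpha>] by simp

lemma pairing_of_root_sum:
  assumes "\<alpha> \<in> \<Phi>" "\<beta> \<in> \<Phi>" "\<alpha> + \<beta> \<in> \<Phi>"
  shows "\<alpha> \<star> \<beta> = -1"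
  using self_pairing[OF assms(1)] self_pairing[OF assms(2)] self_pairing[OF assms(3)]
  by (simp add: pairing_comm)

lemma pairing_of_root_diff:
  assumes "\<alpha> \<in> \<Phi>" "\<beta> \<in> \<Phi>" "\<alpha> - \<beta> \<in> \<Phi>"
  shows "\<alpha> \<star> \<beta> = 1"
  using pairing_of_root_sum[of \<alpha> "- \<beta>"] assms by simp

lemma root_nonzero: "\<alpha> \<in> \<Phi> \<Longrightarrow> \<alpha> \<noteq> 0"
  using self_pairing[of 0] by auto

end

section \<open>Sign rules for the structure constants\<close>

text \<open>For four roots with sum 0, no two of them opposite, the Jacobi identity has three terms. If two of
  the roots are orthogonal, one term vanishes and \<open>N_cocycle\<close> remains.\<close>
locale structure_constants = unit_root_system \<Phi> for \<Phi> :: "'a::euclidean_space set" +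
  fixes N :: "'a \<Rightarrow> 'a \<Rightarrow> int"
  assumes N_anti: "\<alpha> \<in> \<Phi> \<Longrightarrow> \<beta> \<in> \<Phi> \<Longrightarrow> \<alpha> \<star> \<beta> = -1 \<Longrightarrow> N \<beta> \<alpha> = - N \<alpha> \<beta>"
    and N_square: "\<alpha> \<in> \<Phi> \<Longrightarrow> \<beta> \<in> \<Phi> \<Longrightarrow> \<alpha> \<star> \<beta> = -1 \<Longrightarrow> N \<alpha> \<beta> * N \<alpha> \<beta> = 1"
    and N_minus: "\<alpha> \<in> \<Phi> \<Longrightarrow> \<beta> \<in> \<Phi> \<Longrightarrow> \<alpha> \<star> \<beta> = -1 \<Longrightarrow> N (- \<alpha>) (- \<beta>) = - N \<alpha> \<beta>"
    and N_rotate: "\<alpha> \<in> \<Phi> \<Longrightarrow> \<beta> \<in> \<Phi> \<Longrightarrow> \<gamma> \<in> \<Phi> \<Longrightarrow> \<alpha> + \<beta> + \<gamma> = 0 \<Longrightarrow> N \<beta> \<gamma> = N \<alpha> \<beta>"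
    and N_cocycle: "\<alpha> \<in> \<Phi> \<Longrightarrow> \<beta> \<in> \<Phi> \<Longrightarrow> \<gamma> \<in> \<Phi> \<Longrightarrow>
      \<alpha> \<star> \<beta> = -1 \<Longrightarrow> \<beta> \<star> \<gamma> = -1 \<Longrightarrow> \<alpha> \<star> \<gamma> = 0 \<Longrightarrow>
      N \<alpha> \<beta> * N (\<alpha> + \<beta>) \<gamma> = N \<beta> \<gamma> * N \<alpha> (\<beta> + \<gamma>)"

context chevalley_basis
begin

text \<open>Each rule is the Jacobi identity on three suitable root vectors. For \<open>\<alpha>\<close>, \<open>\<beta>\<close>, \<open>-(\<alpha>+\<beta>)\<close> it is a linear
  relation between coroots; evaluating it on two roots shows that its three coefficients agree, which
  is the cyclic symmetry. For \<open>-\<alpha>\<close>, \<open>\<alpha>\<close>, \<open>\<beta>\<close> it gives \<open>N\<^bsub>\<alpha>,\<beta>\<^esub> N\<^bsub>-\<alpha>,\<alpha>+\<beta>\<^esub> = 1\<close>, so that \<open>N\<^bsub>\<alpha>,\<beta>\<^esub> = \<plusminus>1\<close>.\<close>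
lemma unit_structure_constants:
  assumes rs: "root_system \<Phi>" and unit: "\<forall>\<alpha>\<in>\<Phi>. norm \<alpha> = 1"
  shows "structure_constants \<Phi> N"
proof -
  have n1: "\<alpha> \<bullet> \<alpha> = 1" if "\<alpha> \<in> \<Phi>" for \<alpha>
    using unit that by (metis norm_eq_1)
  interpret unit_root_system \<Phi>
  proof
    show "finite \<Phi>" using rs by (simp add: root_system_def)
    fix \<alpha> \<beta> assume ab: "\<alpha> \<in> \<Phi>" "\<beta> \<in> \<Phi>"
    show "\<beta> - (\<beta> \<star> \<alpha>) *\<^sub>R \<alpha> \<in> \<Phi>" "\<alpha> \<star> \<beta> \<in> \<int>"
      using rs ab n1[OF ab(1)] n1[OF ab(2)] unfolding root_system_def pairing_def
      by (metis div_by_1)+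
  qed (simp add: pairing_def n1)
  have e0: "e \<alpha> \<noteq> 0" if "\<alpha> \<in> \<Phi>" for \<alpha>
    using basis_independent that dependent_zero by (metis UnI1 imageI)
  have cancel: "z = w" if "scale (of_int z) (e \<alpha>) = scale (of_int w) (e \<alpha>)" "\<alpha> \<in> \<Phi>" for z w \<alpha>
    using that e0 by simp
  have scR: "bracket x (scale c y) = scale c (bracket x y)" for x c y
    using module_hom.scale[OF Vector_Spaces.linear.axioms(3)[OF bracket_linear_right]] .
  have zeroR: "bracket x 0 = 0" for x
    using scR[of x 0 0] by simp
  have addR: "bracket x (y + z) = bracket x y + bracket x z" for x y z
    using module_hom.add[OF Vector_Spaces.linear.axioms(3)[OF bracket_linear_right]] .
  have scL: "bracket (scale c x) y = scale c (bracket x y)" for x c y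
    using module_hom.scale[OF Vector_Spaces.linear.axioms(3)[OF bracket_linear_left]] .
  have addL: "bracket (x + z) y = bracket x y + bracket z y" for x y z
    using module_hom.add[OF Vector_Spaces.linear.axioms(3)[OF bracket_linear_left]] .
  have zeroL: "bracket 0 x = 0" for x
    using scL[of 0 0 x] by simp
  have anti: "bracket x y = - bracket y x" for x y
  proof -
    have "bracket (x + y) (x + y) = bracket x y + bracket y x"
      unfolding addL addR by (simp add: bracket_self)
    then show ?thesis by (simp only: bracket_self eq_neg_iff_add_eq_0)
  qed
  have not_root: "\<alpha> + \<beta> \<notin> \<Phi> \<union> {0}" if "\<alpha> \<in> \<Phi>" "\<beta> \<in> \<Phi>" "\<alpha> \<star> \<beta> = 0 \<or> \<alpha> \<star> \<beta> = 1" for \<alpha> \<beta>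
  proof -
    have "(\<alpha> + \<beta>) \<star> (\<alpha> + \<beta>) = 4 + 2 * (\<alpha> \<star> \<beta>)"
      using that by (simp add:  self_pairing pairing_comm)
    moreover have "(\<alpha> + \<beta>) \<star> (\<alpha> + \<beta>) \<in> {2, 0}" if "\<alpha> + \<beta> \<in> \<Phi> \<union> {0}"
      using that self_pairing pairing_simps(7) by (metis Un_iff insertCI singletonD)
    ultimately show ?thesis using that(3) by auto
  qed
  have comm: "bracket (e \<alpha>) (e \<beta>) = 0" if "\<alpha> \<in> \<Phi>" "\<beta> \<in> \<Phi>" "\<alpha> \<star> \<beta> = 0 \<or> \<alpha> \<star> \<beta> = 1" for \<alpha> \<beta>
    using bracket_ee_zero not_root that by blast
  have ee: "bracket (e \<alpha>) (e \<beta>) = scale (of_int (N \<alpha> \<beta>)) (e (\<alpha> + \<beta>))"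
    if "\<alpha> \<in> \<Phi>" "\<beta> \<in> \<Phi>" "\<alpha> \<star> \<beta> = -1" for \<alpha> \<beta>
    using bracket_ee add_root that by blast
  have N_antisym: "N \<beta> \<alpha> = - N \<alpha> \<beta>" if ab: "\<alpha> \<in> \<Phi>" "\<beta> \<in> \<Phi>" "\<alpha> \<star> \<beta> = -1" for \<alpha> \<beta>
  proof (rule cancel)
    show "scale (of_int (N \<beta> \<alpha>)) (e (\<alpha> + \<beta>)) = scale (of_int (- N \<alpha> \<beta>)) (e (\<alpha> + \<beta>))"
      using anti[of "e \<beta>" "e \<alpha>"] ee[of \<alpha> \<beta>] ee[of \<beta> \<alpha>] ab
      by (simp add: pairing_comm add.commute)
  qed (use ab add_root in auto)
  show ?thesis
  proof unfold_locales
    fix \<alpha> \<beta> assume ab: "\<alpha> \<in> \<Phi>" "\<beta> \<in> \<Phi>" "\<alpha> \<star> \<beta> = -1"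
    show "N \<beta> \<alpha> = - N \<alpha> \<beta>" by (rule N_antisym[OF ab])
    show "N (- \<alpha>) (- \<beta>) = - N \<alpha> \<beta>" using N_opp ab add_root by blast
    have sum: "\<alpha> + \<beta> \<in> \<Phi>" using ab add_root by blast
    have "bracket (e (- \<alpha>)) (bracket (e \<alpha>) (e \<beta>)) + bracket (e \<alpha>) (bracket (e \<beta>) (e (- \<alpha>)))
        + bracket (e \<beta>) (bracket (e (- \<alpha>)) (e \<alpha>)) = 0" by (rule jacobi)
    moreover have "bracket (e \<beta>) (e (- \<alpha>)) = 0" using comm ab by (simp add: pairing_comm)
    moreover have "bracket (e (- \<alpha>)) (e \<alpha>) = h (- \<alpha>)"
      using bracket_ee_opp[of "- \<alpha>"] ab by simp
    moreover have "bracket (e \<beta>) (h (- \<alpha>)) = scale (of_int (-1)) (e \<beta>)"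
    proof -
      have "real_of_int (cartan_int \<beta> (- \<alpha>)) = 1"
        using cartan_int_root[of \<beta> "- \<alpha>"] ab by (simp add: pairing_comm)
      then show ?thesis using anti[of "e \<beta>"] bracket_he[of "- \<alpha>" \<beta>] ab by simp
    qed
    moreover have "bracket (e (- \<alpha>)) (e (\<alpha> + \<beta>)) = scale (of_int (N (- \<alpha>) (\<alpha> + \<beta>))) (e \<beta>)"
      using ee[of "- \<alpha>" "\<alpha> + \<beta>"] ab sum by (simp add: self_pairing)
    ultimately have "scale (of_int (N \<alpha> \<beta> * N (- \<alpha>) (\<alpha> + \<beta>))) (e \<beta>) = scale (of_int 1) (e \<beta>)"
      using ee[of \<alpha> \<beta>] ab by (simp add: scR zeroR)
    then have "N \<alpha> \<beta> * N (- \<alpha>) (\<alpha> + \<beta>) = 1" using cancel ab by blast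
    then show "N \<alpha> \<beta> * N \<alpha> \<beta> = 1" using N_range[of \<alpha> \<beta>] ab sum by auto
  next
    fix \<alpha> \<beta> \<gamma> assume abc: "\<alpha> \<in> \<Phi>" "\<beta> \<in> \<Phi>" "\<gamma> \<in> \<Phi>" "\<alpha> + \<beta> + \<gamma> = 0"
    have g: "\<alpha> + \<beta> = - \<gamma>" "\<beta> + \<gamma> = - \<alpha>" "\<gamma> + \<alpha> = - \<beta>" using abc(4) 
      by (simp_all add: eq_neg_iff_add_eq_0 add_ac)
    have ip: "\<alpha> \<star> \<beta> = -1" "\<beta> \<star> \<gamma> = -1" "\<gamma> \<star> \<alpha> = -1"
      using pairing_of_root_sum abc g by simp_all
    have "bracket (e \<alpha>) (bracket (e \<beta>) (e \<gamma>)) + bracket (e \<beta>) (bracket (e \<gamma>) (e \<alpha>))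
        + bracket (e \<gamma>) (bracket (e \<alpha>) (e \<beta>)) = 0" by (rule jacobi)
    then have rel: "scale (of_int (N \<beta> \<gamma>)) (h \<alpha>) + scale (of_int (N \<gamma> \<alpha>)) (h \<beta>)
        + scale (of_int (N \<alpha> \<beta>)) (h \<gamma>) = 0"
      using abc ip by (simp add: ee g scR bracket_ee_opp)
    have eq: "N \<beta> \<gamma> * cartan_int \<mu> \<alpha> + N \<gamma> \<alpha> * cartan_int \<mu> \<beta> + N \<alpha> \<beta> * cartan_int \<mu> \<gamma> = 0"
      if "\<mu> \<in> \<Phi>" for \<mu>
    proof (rule cancel)
      have "bracket (scale (of_int (N \<beta> \<gamma>)) (h \<alpha>) + scale (of_int (N \<gamma> \<alpha>)) (h \<beta>)
        + scale (of_int (N \<alpha> \<beta>)) (h \<gamma>)) (e \<mu>) = 0" using rel zeroL by simp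
      then show "scale (of_int (N \<beta> \<gamma> * cartan_int \<mu> \<alpha> + N \<gamma> \<alpha> * cartan_int \<mu> \<beta> + N \<alpha> \<beta> * cartan_int \<mu> \<gamma>)) (e \<mu>)
         = scale (of_int 0) (e \<mu>)"
        using abc that by (simp add: addL scL bracket_he scale_left_distrib)
    qed (rule that)
    have "real_of_int (cartan_int \<alpha> \<alpha>) = 2" "real_of_int (cartan_int \<beta> \<beta>) = 2" "real_of_int (cartan_int \<alpha> \<beta>) = -1"
       "real_of_int (cartan_int \<beta> \<alpha>) = -1" "real_of_int (cartan_int \<alpha> \<gamma>) = -1" "real_of_int (cartan_int \<beta> \<gamma>) = -1"
      using abc ip by (simp_all add: cartan_int_root self_pairing pairing_comm)
    then have c: "cartan_int \<alpha> \<alpha> = 2" "cartan_int \<beta> \<beta> = 2" "cartan_int \<alpha> \<beta> = -1"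
       "cartan_int \<beta> \<alpha> = -1" "cartan_int \<alpha> \<gamma> = -1" "cartan_int \<beta> \<gamma> = -1" by linarith+
    show "N \<beta> \<gamma> = N \<alpha> \<beta>" using eq[OF abc(1)] eq[OF abc(2)] c by simp
  next
    fix \<alpha> \<beta> \<gamma> assume abc: "\<alpha> \<in> \<Phi>" "\<beta> \<in> \<Phi>" "\<gamma> \<in> \<Phi>"
      and ip: "\<alpha> \<star> \<beta> = -1" "\<beta> \<star> \<gamma> = -1" "\<alpha> \<star> \<gamma> = 0"
    have "bracket (e \<alpha>) (bracket (e \<beta>) (e \<gamma>)) + bracket (e \<beta>) (bracket (e \<gamma>) (e \<alpha>))
        + bracket (e \<gamma>) (bracket (e \<alpha>) (e \<beta>)) = 0" by (rule jacobi)
    moreover have "bracket (e \<gamma>) (e \<alpha>) = 0" using comm abc ip by (simp add: pairing_comm)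
    moreover have r: "\<alpha> + \<beta> \<in> \<Phi>" "\<beta> + \<gamma> \<in> \<Phi>" using abc ip add_root by auto
    moreover have i2: "\<alpha> \<star> (\<beta> + \<gamma>) = -1" "(\<alpha> + \<beta>) \<star> \<gamma> = -1"
      using ip by simp_all
    moreover have r3: "\<alpha> + \<beta> + \<gamma> \<in> \<Phi>" using add_root r i2 abc by blast
    moreover have "bracket (e \<gamma>) (e (\<alpha> + \<beta>)) = - scale (of_int (N (\<alpha> + \<beta>) \<gamma>)) (e (\<alpha> + \<beta> + \<gamma>))"
      using anti[of "e \<gamma>" "e (\<alpha> + \<beta>)"] ee r abc i2 by simp
    ultimately have "scale (of_int (N \<beta> \<gamma> * N \<alpha> (\<beta> + \<gamma>))) (e (\<alpha> + \<beta> + \<gamma>))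
        = scale (of_int (N \<alpha> \<beta> * N (\<alpha> + \<beta>) \<gamma>)) (e (\<alpha> + \<beta> + \<gamma>))"
      using abc ip by (simp add: ee scR zeroR add.assoc)
    then show "N \<alpha> \<beta> * N (\<alpha> + \<beta>) \<gamma> = N \<beta> \<gamma> * N \<alpha> (\<beta> + \<gamma>)" using cancel r3 by metis
  qed
qed

end

section \<open>Sums over the orbits of an involution\<close>

definition involution_on :: "('a \<Rightarrow> 'a) \<Rightarrow> 'a set \<Rightarrow> bool" where
  "involution_on \<iota> A \<longleftrightarrow> (\<forall>\<gamma>\<in>A. \<iota> \<gamma> \<in> A \<and> \<iota> (\<iota> \<gamma>) = \<gamma>)"

text \<open>The second condition excludes fixed points of \<open>\<iota>\<close> in \<open>A\<close>: every orbit has two elements and \<open>B\<close>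
  contains one of them.\<close>
definition transversal :: "('a \<Rightarrow> 'a) \<Rightarrow> 'a set \<Rightarrow> 'a set \<Rightarrow> bool" where
  "transversal \<iota> A B \<longleftrightarrow> B \<subseteq> A \<and> (\<forall>\<gamma>\<in>A. \<gamma> \<in> B \<longleftrightarrow> \<iota> \<gamma> \<notin> B)"

text \<open>For an \<open>\<iota>\<close>-invariant \<open>F\<close> the transversal does not matter (\<open>orbit_sum_eq\<close>). This is how a sum over
  unordered pairs \<open>{\<gamma>, \<iota> \<gamma>}\<close> is expressed without dividing by 2.\<close>
definition orbit_sum :: "('a \<Rightarrow> 'a) \<Rightarrow> 'a set \<Rightarrow> ('a \<Rightarrow> 'r::comm_monoid_add) \<Rightarrow> 'r" where
  "orbit_sum \<iota> A F = sum F (SOME B. transversal \<iota> A B)"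

lemma transversal_finite: "transversal \<iota> A B \<Longrightarrow> finite A \<Longrightarrow> finite B"
  by (auto simp: transversal_def intro: finite_subset)

text \<open>The transversal can be made to contain, in each orbit, the element with the larger value of a given
  function \<open>p\<close>. With \<open>p \<gamma> = \<gamma> \<star> \<rho>\<close> a pair of which \<open>x\<^sub>\<rho>(\<xi>)\<close> moves one member is represented by that member. Ties are
  broken by an injective numbering of \<open>A\<close>.\<close>
lemma transversal_exists:
  fixes p :: "'a \<Rightarrow> real"
  assumes "finite A" and inv: "involution_on \<iota> A" and free: "\<And>\<gamma>. \<gamma> \<in> A \<Longrightarrow> \<iota> \<gamma> \<noteq> \<gamma>"
  obtains B where "transversal \<iota> A B" "\<And>\<gamma>. \<gamma> \<in> A \<Longrightarrow> p (\<iota> \<gamma>) < p \<gamma> \<Longrightarrow> \<gamma> \<in> B"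
proof -
  obtain r :: "'a \<Rightarrow> nat" where r: "inj_on r A"
    using finite_imp_inj_to_nat_seg[OF assms(1)] by blast
  let ?B = "{\<gamma>\<in>A. p (\<iota> \<gamma>) < p \<gamma> \<or> p (\<iota> \<gamma>) = p \<gamma> \<and> r (\<iota> \<gamma>) < r \<gamma>}"
  have 1: "transversal \<iota> A ?B"
    unfolding transversal_def
  proof (intro conjI ballI)
    fix \<gamma> assume g: "\<gamma> \<in> A"
    then have "\<iota> \<gamma> \<in> A" "\<iota> (\<iota> \<gamma>) = \<gamma>" using inv by (auto simp: involution_on_def)
    moreover have "r (\<iota> \<gamma>) \<noteq> r \<gamma>" using r free g \<open>\<iota> \<gamma> \<in> A\<close> by (metis inj_onD)
    ultimately show "\<gamma> \<in> ?B \<longleftrightarrow> \<iota> \<gamma> \<notin> ?B" using g by (simp add: not_less order_le_less) (metis less_asym' linorder_neqE less_irrefl)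
  qed auto
  show thesis by (rule that[OF 1]) auto
qed

lemma transversal_sum_unique:
  assumes "involution_on \<iota> A" "transversal \<iota> A B" "transversal \<iota> A B'"
    and "\<And>\<gamma>. \<gamma> \<in> A \<Longrightarrow> F (\<iota> \<gamma>) = F \<gamma>"
  shows "sum F B = sum F B'"
proof (rule sum.reindex_bij_witness[where i = "\<lambda>\<gamma>. if \<gamma> \<in> B then \<gamma> else \<iota> \<gamma>"
        and j = "\<lambda>\<gamma>. if \<gamma> \<in> B' then \<gamma> else \<iota> \<gamma>"])
  have A: "\<iota> \<gamma> \<in> A" "\<iota> (\<iota> \<gamma>) = \<gamma>" "\<gamma> \<in> B \<longleftrightarrow> \<iota> \<gamma> \<notin> B" "\<gamma> \<in> B' \<longleftrightarrow> \<iota> \<gamma> \<notin> B'" if "\<gamma> \<in> A" for \<gamma>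
    using that assms(1-3) unfolding involution_on_def transversal_def by blast+
  have sub: "B \<subseteq> A" "B' \<subseteq> A" using assms(2,3) unfolding transversal_def by blast+
  fix \<gamma>
  { assume g: "\<gamma> \<in> B"
    then have "\<gamma> \<in> A" using sub by blast
    note * = A[OF this] assms(4)[OF this]
    show "(if (if \<gamma> \<in> B' then \<gamma> else \<iota> \<gamma>) \<in> B then if \<gamma> \<in> B' then \<gamma> else \<iota> \<gamma>
           else \<iota> (if \<gamma> \<in> B' then \<gamma> else \<iota> \<gamma>)) = \<gamma>"
      "(if \<gamma> \<in> B' then \<gamma> else \<iota> \<gamma>) \<in> B'" "F (if \<gamma> \<in> B' then \<gamma> else \<iota> \<gamma>) = F \<gamma>"
      using * g by (simp_all split: if_split) }
  { assume g: "\<gamma> \<in> B'"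
    then have "\<gamma> \<in> A" using sub by blast
    note * = A[OF this]
    show "(if (if \<gamma> \<in> B then \<gamma> else \<iota> \<gamma>) \<in> B' then if \<gamma> \<in> B then \<gamma> else \<iota> \<gamma>
           else \<iota> (if \<gamma> \<in> B then \<gamma> else \<iota> \<gamma>)) = \<gamma>"
      "(if \<gamma> \<in> B then \<gamma> else \<iota> \<gamma>) \<in> B"
      using * g by (simp_all split: if_split) }
qed

lemma orbit_sum_eq:
  assumes "involution_on \<iota> A" "transversal \<iota> A B" "\<And>\<gamma>. \<gamma> \<in> A \<Longrightarrow> F (\<iota> \<gamma>) = F \<gamma>"
  shows "orbit_sum \<iota> A F = sum F B"
proof -
  have "transversal \<iota> A (SOME B. transversal \<iota> A B)"
    using assms(2) by (rule someI)
  from transversal_sum_unique[OF assms(1) this assms(2), of F] assms(3) show ?thesis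
    by (simp add: orbit_sum_def)
qed

lemma sum_transversal_double:
  assumes "finite A" "involution_on \<iota> A" "transversal \<iota> A B"
  shows "sum F A = (\<Sum>\<gamma>\<in>B. F \<gamma> + F (\<iota> \<gamma>))"
proof -
  have B: "B \<subseteq> A" using assms(3) by (simp add: transversal_def)
  have "sum F (A - B) = (\<Sum>\<gamma>\<in>B. F (\<iota> \<gamma>))"
    by (rule sum.reindex_bij_witness[where i = \<iota> and j = \<iota>])
      (use assms in \<open>auto simp: involution_on_def transversal_def subset_iff\<close>)
  then show ?thesis
    using sum.subset_diff[OF B assms(1), of F] by (simp add: sum.distrib add.commute)
qed

section \<open>Pairs of roots with a given sum and their signs\<close>

context structure_constants
begin

definition common :: "'a \<Rightarrow> 'a \<Rightarrow> 'a set" where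
  "common \<alpha> \<beta> = {\<gamma>\<in>\<Phi>. \<gamma> \<star> \<alpha> = 1 \<and> \<gamma> \<star> \<beta> = 1}"

definition acute :: "'a \<Rightarrow> 'a set" where
  "acute \<alpha> = {\<gamma>\<in>\<Phi>. \<gamma> \<star> \<alpha> = 1}"

abbreviation pair_transversal :: "'a \<Rightarrow> 'a \<Rightarrow> 'a set \<Rightarrow> bool" where
  "pair_transversal \<alpha> \<beta> \<equiv> transversal ((-) (\<alpha> + \<beta>)) (common \<alpha> \<beta>)"

abbreviation root_transversal :: "'a \<Rightarrow> 'a set \<Rightarrow> bool" where
  "root_transversal \<alpha> \<equiv> transversal ((-) \<alpha>) (acute \<alpha>)"

text \<open>The coefficient of the pair \<open>{\<gamma>, \<alpha> + \<beta> - \<gamma>}\<close> in the equation for \<open>\<alpha>\<close>, \<open>\<beta>\<close>.\<close>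
definition pair_sign :: "'a \<Rightarrow> 'a \<Rightarrow> 'a \<Rightarrow> int" where
  "pair_sign \<alpha> \<beta> \<gamma> = N \<alpha> (- \<gamma>) * N \<beta> (- (\<alpha> + \<beta> - \<gamma>))"

lemma complement_root:
  assumes "\<alpha> \<in> \<Phi>" "\<beta> \<in> \<Phi>" "\<alpha> \<star> \<beta> = 0" "\<gamma> \<in> common \<alpha> \<beta>"
  shows "\<alpha> + \<beta> - \<gamma> \<in> common \<alpha> \<beta>"
proof -
  have g: "\<gamma> \<in> \<Phi>" "\<gamma> \<star> \<alpha> = 1" "\<gamma> \<star> \<beta> = 1" using assms(4) by (auto simp: common_def)
  have "\<alpha> - \<gamma> \<in> \<Phi>" using diff_root[of \<alpha> \<gamma>] assms g by (simp add: pairing_comm)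
  moreover have "(\<alpha> - \<gamma>) \<star> \<beta> = -1" using assms g by simp
  ultimately have "(\<alpha> - \<gamma>) + \<beta> \<in> \<Phi>" using add_root assms by blast
  then have "\<alpha> + \<beta> - \<gamma> \<in> \<Phi>" by (simp add: algebra_simps)
  then show ?thesis using assms g by (simp add: common_def pairing_comm)
qed

lemma involution_common:
  assumes "\<alpha> \<in> \<Phi>" "\<beta> \<in> \<Phi>" "\<alpha> \<star> \<beta> = 0"
  shows "involution_on (\<lambda>\<gamma>. \<alpha> + \<beta> - \<gamma>) (common \<alpha> \<beta>)"
  using complement_root[OF assms] by (simp add: involution_on_def)

lemma acute_diff: "\<alpha> \<in> \<Phi> \<Longrightarrow> \<gamma> \<in> acute \<alpha> \<Longrightarrow> \<alpha> - \<gamma> \<in> acute \<alpha>"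
  using diff_root[of \<alpha> \<gamma>] by (auto simp: acute_def pairing_comm)

lemma involution_acute: "\<alpha> \<in> \<Phi> \<Longrightarrow> involution_on (\<lambda>\<gamma>. \<alpha> - \<gamma>) (acute \<alpha>)"
  using acute_diff by (simp add: involution_on_def)

lemma involution_uminus: "involution_on uminus \<Phi>"
  by (simp add: involution_on_def)

text \<open>Both factors are rewritten in terms of the single root \<open>\<alpha> - \<gamma>\<close> by cyclic symmetry; this is the form
  to which the cocycle rule applies.\<close>
lemma pair_sign_altdef:
  assumes "\<alpha> \<in> \<Phi>" "\<beta> \<in> \<Phi>" "\<alpha> \<star> \<beta> = 0" "\<gamma> \<in> common \<alpha> \<beta>"
  shows "pair_sign \<alpha> \<beta> \<gamma> = N (\<gamma> - \<alpha>) \<alpha> * N (\<alpha> - \<gamma>) \<beta>"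
proof -
  have g: "\<gamma> \<in> \<Phi>" "\<gamma> \<star> \<alpha> = 1" "\<gamma> \<star> \<beta> = 1" using assms(4) by (auto simp: common_def)
  have d: "\<alpha> + \<beta> - \<gamma> \<in> \<Phi>" using complement_root[OF assms] by (simp add: common_def)
  have ag: "\<alpha> - \<gamma> \<in> \<Phi>" using diff_root[of \<alpha> \<gamma>] assms g by (simp add: pairing_comm)
  then have ga: "\<gamma> - \<alpha> \<in> \<Phi>" using minus_root_iff[of "\<alpha> - \<gamma>"] by simp
  have "N \<alpha> (- \<gamma>) = N (\<gamma> - \<alpha>) \<alpha>"
    using N_rotate[of "\<gamma> - \<alpha>" \<alpha> "- \<gamma>"] assms g ga by simp
  moreover have "N \<beta> (- (\<alpha> + \<beta> - \<gamma>)) = N (\<alpha> - \<gamma>) \<beta>"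
    using N_rotate[of "\<alpha> - \<gamma>" \<beta> "- (\<alpha> + \<beta> - \<gamma>)"] assms ag d minus_root_iff[of "\<alpha> + \<beta> - \<gamma>"] by simp
  ultimately show ?thesis by (simp add: pair_sign_def)
qed

lemma pair_sign_square:
  assumes "\<alpha> \<in> \<Phi>" "\<beta> \<in> \<Phi>" "\<alpha> \<star> \<beta> = 0" "\<gamma> \<in> common \<alpha> \<beta>"
  shows "pair_sign \<alpha> \<beta> \<gamma> * pair_sign \<alpha> \<beta> \<gamma> = 1"
proof -
  let ?d = "\<alpha> + \<beta> - \<gamma>"
  have "?d \<in> common \<alpha> \<beta>" using complement_root[OF assms] .
  then have "N \<alpha> (- \<gamma>) * N \<alpha> (- \<gamma>) = 1" "N \<beta> (- ?d) * N \<beta> (- ?d) = 1"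
    using N_square[of \<alpha> "- \<gamma>"] N_square[of \<beta> "- ?d"] minus_root_iff[of ?d] assms
    by (auto simp: common_def pairing_comm)
  then show ?thesis unfolding pair_sign_def by algebra
qed

text \<open>This is the cocycle rule for \<open>\<alpha>\<close>, \<open>-\<gamma>\<close>, \<open>\<beta>\<close>. It makes the coefficient symmetric in the pair and hence the
  sum over unordered pairs meaningful.\<close>
lemma pair_sign_swap:
  assumes "\<alpha> \<in> \<Phi>" "\<beta> \<in> \<Phi>" "\<alpha> \<star> \<beta> = 0" "\<gamma> \<in> common \<alpha> \<beta>"
  shows "pair_sign \<beta> \<alpha> \<gamma> = pair_sign \<alpha> \<beta> \<gamma>"
proof -
  let ?d = "\<alpha> + \<beta> - \<gamma>"
  have g: "\<gamma> \<in> \<Phi>" "\<gamma> \<star> \<alpha> = 1" "\<gamma> \<star> \<beta> = 1" using assms(4) by (auto simp: common_def)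
  have d: "?d \<in> \<Phi>" using complement_root[OF assms] by (simp add: common_def)
  have md: "- ?d \<in> \<Phi>" using d minus_root_iff[of ?d] by blast
  have ag: "\<alpha> - \<gamma> \<in> \<Phi>" using diff_root[of \<alpha> \<gamma>] assms g by (simp add: pairing_comm)
  have bg: "\<beta> - \<gamma> \<in> \<Phi>" using diff_root[of \<beta> \<gamma>] assms g by (simp add: pairing_comm)
  have "N \<alpha> (- \<gamma>) * N (\<alpha> - \<gamma>) \<beta> = N (- \<gamma>) \<beta> * N \<alpha> (\<beta> - \<gamma>)"
    using N_cocycle[of \<alpha> "- \<gamma>" \<beta>] assms g by (simp add: pairing_comm)
  moreover have "N \<beta> (- ?d) = N (\<alpha> - \<gamma>) \<beta>"
    using N_rotate[of "\<alpha> - \<gamma>" \<beta> "- ?d"] assms ag md by simp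
  moreover have "N \<alpha> (\<beta> - \<gamma>) = N (- ?d) \<alpha>"
    using N_rotate[of "- ?d" \<alpha> "\<beta> - \<gamma>"] assms bg md by simp
  moreover have "N (- ?d) \<alpha> = - N \<alpha> (- ?d)"
    using N_anti[of \<alpha> "- ?d"] assms g md by (simp add: pairing_comm)
  moreover have "N (- \<gamma>) \<beta> = - N \<beta> (- \<gamma>)"
    using N_anti[of \<beta> "- \<gamma>"] assms g by (simp add: pairing_comm)
  ultimately show ?thesis
    unfolding pair_sign_def by (simp add: add.commute)
qed

lemma pair_sign_complement:
  assumes "\<alpha> \<in> \<Phi>" "\<beta> \<in> \<Phi>" "\<alpha> \<star> \<beta> = 0" "\<gamma> \<in> common \<alpha> \<beta>"
  shows "pair_sign \<alpha> \<beta> (\<alpha> + \<beta> - \<gamma>) = pair_sign \<alpha> \<beta> \<gamma>"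
  using pair_sign_swap[OF assms] by (simp add: pair_sign_def mult.commute add.commute)

text \<open>Let \<open>\<sigma> = \<alpha> - \<gamma>\<close> and \<open>\<kappa> = \<gamma> - \<epsilon>\<close>. Multiplying the cocycle rules for \<open>\<kappa>, \<sigma>, \<beta>\<close> and for \<open>-\<kappa>, -\<sigma>, \<alpha>\<close> gives
  the identity; the minus sign is \<open>N\<^bsub>\<kappa>,\<sigma>\<^esub> N\<^bsub>-\<kappa>,-\<sigma>\<^esub> = -1\<close>.\<close>
lemma pair_sign_base_change:
  assumes "\<alpha> \<in> \<Phi>" "\<beta> \<in> \<Phi>" "\<alpha> \<star> \<beta> = 0" "\<gamma> \<in> common \<alpha> \<beta>"
    and "\<epsilon> \<in> common \<alpha> \<beta>" "\<epsilon> \<in> common \<gamma> (\<alpha> + \<beta> - \<gamma>)"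
  shows "pair_sign \<alpha> \<beta> \<epsilon> = - pair_sign \<alpha> \<beta> \<gamma> * pair_sign \<gamma> (\<alpha> + \<beta> - \<gamma>) \<epsilon>"
proof -
  let ?d = "\<alpha> + \<beta> - \<gamma>" and ?s = "\<alpha> - \<gamma>" and ?k = "\<gamma> - \<epsilon>"
  have g: "\<gamma> \<in> \<Phi>" "\<gamma> \<star> \<alpha> = 1" "\<gamma> \<star> \<beta> = 1" using assms(4) by (auto simp: common_def)
  have e: "\<epsilon> \<in> \<Phi>" "\<epsilon> \<star> \<alpha> = 1" "\<epsilon> \<star> \<beta> = 1" "\<epsilon> \<star> \<gamma> = 1"
    using assms(5,6) by (auto simp: common_def)
  have d: "?d \<in> \<Phi>" "\<gamma> \<star> ?d = 0"
    using complement_root[OF assms(1-4)] g by (auto simp: common_def)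
  have s: "?s \<in> \<Phi>" using diff_root[of \<alpha> \<gamma>] assms g by (simp add: pairing_comm)
  have s': "- ?s \<in> \<Phi>" using s minus_root_iff[of ?s] by blast
  have k: "?k \<in> \<Phi>" using diff_root[of \<gamma> \<epsilon>] g e by (simp add: pairing_comm)
  have k': "- ?k \<in> \<Phi>" using k minus_root_iff[of ?k] by blast
  have ks: "?k \<star> ?s = -1" using g e assms by (simp add: pairing_comm)
  have "N ?k ?s * N (?k + ?s) \<beta> = N ?s \<beta> * N ?k (?s + \<beta>)"
    by (rule N_cocycle[OF k s assms(2)]) (use g e assms in \<open>simp_all add: pairing_comm\<close>)
  moreover have "N (- ?k) (- ?s) * N (- ?k + - ?s) \<alpha> = N (- ?s) \<alpha> * N (- ?k) (- ?s + \<alpha>)"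
    by (rule N_cocycle[OF k' s' assms(1)]) (use g e assms in \<open>simp_all add: pairing_comm\<close>)
  moreover have "N (- ?k) (- ?s) = - N ?k ?s" by (rule N_minus[OF k s ks])
  moreover have "N ?k ?s * N ?k ?s = 1" by (rule N_square[OF k s ks])
  ultimately have "N (- ?k + - ?s) \<alpha> * N (?k + ?s) \<beta>
      = - (N (- ?s) \<alpha> * N ?s \<beta>) * (N (- ?k) (- ?s + \<alpha>) * N ?k (?s + \<beta>))" by algebra
  then show ?thesis
    using pair_sign_altdef[OF assms(1-4)] pair_sign_altdef[OF assms(1-3,5)]
      pair_sign_altdef[OF g(1) d assms(6)]
    by (simp add: algebra_simps)
qed

text \<open>All rules for the triple \<open>\<rho>\<close>, \<open>\<alpha> - \<rho>\<close>, \<open>-\<alpha>\<close>, whose constant is the coefficient with which \<open>x\<^sub>\<rho>(\<xi>)\<close> adds the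
  coordinate at \<open>\<alpha> - \<rho>\<close> to the coordinate at \<open>\<alpha>\<close>.\<close>
lemma N_opposite_third:
  assumes "\<alpha> \<in> \<Phi>" "\<rho> \<in> \<Phi>" "\<alpha> \<star> \<rho> = 1"
  shows "N \<rho> (\<alpha> - \<rho>) = N (- \<alpha>) \<rho>" "N \<rho> (\<alpha> - \<rho>) = - N \<alpha> (- \<rho>)" "N \<rho> (\<alpha> - \<rho>) = N (- \<rho>) \<alpha>"
    "N \<rho> (\<alpha> - \<rho>) * N \<rho> (\<alpha> - \<rho>) = 1"
proof -
  have d: "\<alpha> - \<rho> \<in> \<Phi>" using diff_root assms by blast
  show 1: "N \<rho> (\<alpha> - \<rho>) = N (- \<alpha>) \<rho>" using N_rotate[of "- \<alpha>" \<rho> "\<alpha> - \<rho>"] assms d by simp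
  show 2: "N \<rho> (\<alpha> - \<rho>) = - N \<alpha> (- \<rho>)"
    using N_minus[of \<alpha> "- \<rho>"] assms 1 by simp
  show "N \<rho> (\<alpha> - \<rho>) = N (- \<rho>) \<alpha>"
    using N_anti[of \<alpha> "- \<rho>"] assms 2 by simp
  show "N \<rho> (\<alpha> - \<rho>) * N \<rho> (\<alpha> - \<rho>) = 1"
    using N_square[of \<rho> "\<alpha> - \<rho>"] assms d by (simp add: pairing_comm)
qed

lemma cartan_int_eqI:
  "\<gamma> \<in> \<Phi> \<Longrightarrow> \<beta> \<in> \<Phi> \<Longrightarrow> \<gamma> \<star> \<beta> = real_of_int z \<Longrightarrow> cartan_int \<gamma> \<beta> = z"
  using cartan_int_root[of \<gamma> \<beta>] by simp

lemma cartan_int_diff: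
  "\<alpha> \<in> \<Phi> \<Longrightarrow> \<gamma> \<in> \<Phi> \<Longrightarrow> \<alpha> - \<gamma> \<in> \<Phi> \<Longrightarrow> \<beta> \<in> \<Phi> \<Longrightarrow>
    cartan_int (\<alpha> - \<gamma>) \<beta> = cartan_int \<alpha> \<beta> - cartan_int \<gamma> \<beta>"
  by (rule cartan_int_eqI) (simp_all add: cartan_int_root)

lemma cartan_int_minus:
  "\<gamma> \<in> \<Phi> \<Longrightarrow> \<beta> \<in> \<Phi> \<Longrightarrow> cartan_int (- \<gamma>) \<beta> = - cartan_int \<gamma> \<beta>"
  by (rule cartan_int_eqI) (simp_all add: cartan_int_root)

lemma cartan_int_commute: "\<alpha> \<in> \<Phi> \<Longrightarrow> \<beta> \<in> \<Phi> \<Longrightarrow> cartan_int \<alpha> \<beta> = cartan_int \<beta> \<alpha>"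
  by (rule cartan_int_eqI) (simp_all add: cartan_int_root pairing_comm)

section \<open>The quadratic forms\<close>

text \<open>The forms called \<open>f\<close>, \<open>g\<close>, \<open>k\<close> above, in coordinates \<open>u\<close> on the roots and \<open>h\<close> on the zero weight space.\<close>
definition half_pi_form :: "('a \<Rightarrow> 'r::comm_ring_1) \<Rightarrow> 'a \<Rightarrow> 'a \<Rightarrow> 'r" where
  "half_pi_form u \<alpha> \<beta> = u \<alpha> * u \<beta> -
     orbit_sum (\<lambda>\<gamma>. \<alpha> + \<beta> - \<gamma>) (common \<alpha> \<beta>)
       (\<lambda>\<gamma>. of_int (pair_sign \<alpha> \<beta> \<gamma>) * (u \<gamma> * u (\<alpha> + \<beta> - \<gamma>)))"

definition two_thirds_form :: "('a \<Rightarrow> 'r::comm_ring_1) \<Rightarrow> ('a \<Rightarrow> 'r) \<Rightarrow> 'a \<Rightarrow> 'a \<Rightarrow> 'r" where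
  "two_thirds_form u h \<alpha> \<beta> = u \<alpha> * h \<beta> +
     orbit_sum (\<lambda>\<gamma>. \<alpha> - \<gamma>) (acute \<alpha>)
       (\<lambda>\<gamma>. of_int (cartan_int \<gamma> \<beta> * N \<gamma> (\<alpha> - \<gamma>)) * (u \<gamma> * u (\<alpha> - \<gamma>)))"

definition pi_form :: "('a \<Rightarrow> 'r::comm_ring_1) \<Rightarrow> ('a \<Rightarrow> 'r) \<Rightarrow> 'a \<Rightarrow> 'a \<Rightarrow> 'r" where
  "pi_form u h \<alpha> \<beta> = h \<alpha> * h \<beta> +
     orbit_sum uminus \<Phi>
       (\<lambda>\<gamma>. of_int (cartan_int \<gamma> \<alpha> * cartan_int \<gamma> \<beta>) * (u \<gamma> * u (- \<gamma>)))"

lemma finite_common: "finite (common \<alpha> \<beta>)" and finite_acute: "finite (acute \<alpha>)"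
  using finite_roots by (simp_all add: common_def acute_def)

lemma acute_transversal:
  fixes p :: "'a \<Rightarrow> real"
  assumes "\<alpha> \<in> \<Phi>"
  obtains B where "root_transversal \<alpha> B"
    "\<And>\<gamma>. \<gamma> \<in> acute \<alpha> \<Longrightarrow> p (\<alpha> - \<gamma>) < p \<gamma> \<Longrightarrow> \<gamma> \<in> B"
proof (rule transversal_exists[where p = p, OF finite_acute involution_acute[OF assms]])
  fix \<gamma> assume "\<gamma> \<in> acute \<alpha>"
  then have "\<gamma> \<in> \<Phi>" "(\<alpha> - \<gamma>) \<star> \<gamma> = -1" by (simp_all add: acute_def pairing_comm)
  then show "\<alpha> - \<gamma> \<noteq> \<gamma>" by (metis self_pairing neg_equal_iff_equal numeral_neq_neg_one)
qed (blast intro: that)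

lemma common_transversal:
  fixes p :: "'a \<Rightarrow> real"
  assumes "\<alpha> \<in> \<Phi>" "\<beta> \<in> \<Phi>" "\<alpha> \<star> \<beta> = 0"
  obtains B where "pair_transversal \<alpha> \<beta> B"
    "\<And>\<gamma>. \<gamma> \<in> common \<alpha> \<beta> \<Longrightarrow> p (\<alpha> + \<beta> - \<gamma>) < p \<gamma> \<Longrightarrow> \<gamma> \<in> B"
proof (rule transversal_exists[where p = p, OF finite_common involution_common[OF assms]])
  fix \<gamma> assume "\<gamma> \<in> common \<alpha> \<beta>"
  then have "\<gamma> \<in> \<Phi>" "(\<alpha> + \<beta> - \<gamma>) \<star> \<gamma> = 0" by (simp_all add: common_def pairing_comm)
  then show "\<alpha> + \<beta> - \<gamma> \<noteq> \<gamma>" by (metis self_pairing zero_neq_numeral)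
qed (blast intro: that)

lemma uminus_transversal:
  fixes p :: "'a \<Rightarrow> real"
  obtains B where "transversal uminus \<Phi> B" "\<And>\<gamma>. \<gamma> \<in> \<Phi> \<Longrightarrow> p (- \<gamma>) < p \<gamma> \<Longrightarrow> \<gamma> \<in> B"
proof (rule transversal_exists[where p = p, OF finite_roots involution_uminus])
  fix \<gamma> assume "\<gamma> \<in> \<Phi>"
  then have "\<gamma> \<in> \<Phi>" "(- \<gamma>) \<star> \<gamma> = -2" by simp_all
  then show "- \<gamma> \<noteq> \<gamma>" by (metis self_pairing neg_equal_zero zero_neq_numeral)
qed (blast intro: that)

lemma half_pi_form_eq:
  assumes "\<alpha> \<in> \<Phi>" "\<beta> \<in> \<Phi>" "\<alpha> \<star> \<beta> = 0" "pair_transversal \<alpha> \<beta> B"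
  shows "half_pi_form u \<alpha> \<beta> = u \<alpha> * u \<beta> -
    (\<Sum>\<gamma>\<in>B. of_int (pair_sign \<alpha> \<beta> \<gamma>) * (u \<gamma> * u (\<alpha> + \<beta> - \<gamma>)))"
proof -
  have "orbit_sum (\<lambda>\<gamma>. \<alpha> + \<beta> - \<gamma>) (common \<alpha> \<beta>)
       (\<lambda>\<gamma>. of_int (pair_sign \<alpha> \<beta> \<gamma>) * (u \<gamma> * u (\<alpha> + \<beta> - \<gamma>)))
     = (\<Sum>\<gamma>\<in>B. of_int (pair_sign \<alpha> \<beta> \<gamma>) * (u \<gamma> * u (\<alpha> + \<beta> - \<gamma>)))"
    by (rule orbit_sum_eq[OF involution_common[OF assms(1-3)] assms(4)])
      (simp add: pair_sign_complement[OF assms(1-3)] mult.commute)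
  then show ?thesis by (simp add: half_pi_form_def)
qed

lemma two_thirds_summand_swap:
  assumes "\<alpha> \<in> \<Phi>" "\<beta> \<in> \<Phi>" "\<alpha> \<star> \<beta> = 0" "\<gamma> \<in> acute \<alpha>"
  shows "cartan_int (\<alpha> - \<gamma>) \<beta> * N (\<alpha> - \<gamma>) \<gamma> = cartan_int \<gamma> \<beta> * N \<gamma> (\<alpha> - \<gamma>)"
proof -
  have g: "\<gamma> \<in> \<Phi>" "\<gamma> \<star> \<alpha> = 1" "\<alpha> - \<gamma> \<in> \<Phi>"
    using acute_diff[OF assms(1,4)] assms(4) by (auto simp: acute_def)
  have "cartan_int \<alpha> \<beta> = 0" using cartan_int_eqI[of \<alpha> \<beta> 0] assms by simp
  moreover have "N (\<alpha> - \<gamma>) \<gamma> = - N \<gamma> (\<alpha> - \<gamma>)"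
    using N_anti[of \<gamma> "\<alpha> - \<gamma>"] g assms by simp
  ultimately show ?thesis using cartan_int_diff[of \<alpha> \<gamma> \<beta>] g assms by simp
qed

lemma two_thirds_form_eq:
  assumes "\<alpha> \<in> \<Phi>" "\<beta> \<in> \<Phi>" "\<alpha> \<star> \<beta> = 0" "root_transversal \<alpha> B"
  shows "two_thirds_form u h \<alpha> \<beta> = u \<alpha> * h \<beta> +
    (\<Sum>\<gamma>\<in>B. of_int (cartan_int \<gamma> \<beta> * N \<gamma> (\<alpha> - \<gamma>)) * (u \<gamma> * u (\<alpha> - \<gamma>)))"
proof -
  have "orbit_sum (\<lambda>\<gamma>. \<alpha> - \<gamma>) (acute \<alpha>)
       (\<lambda>\<gamma>. of_int (cartan_int \<gamma> \<beta> * N \<gamma> (\<alpha> - \<gamma>)) * (u \<gamma> * u (\<alpha> - \<gamma>)))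
     = (\<Sum>\<gamma>\<in>B. of_int (cartan_int \<gamma> \<beta> * N \<gamma> (\<alpha> - \<gamma>)) * (u \<gamma> * u (\<alpha> - \<gamma>)))"
    by (rule orbit_sum_eq[OF involution_acute[OF assms(1)] assms(4)])
      (simp only: diff_diff_eq2 add_diff_cancel_left' two_thirds_summand_swap[OF assms(1-3)] mult.commute)
  then show ?thesis by (simp add: two_thirds_form_def)
qed

lemma pi_form_eq:
  assumes "\<alpha> \<in> \<Phi>" "\<beta> \<in> \<Phi>" "transversal uminus \<Phi> B"
  shows "pi_form u h \<alpha> \<beta> = h \<alpha> * h \<beta> +
    (\<Sum>\<gamma>\<in>B. of_int (cartan_int \<gamma> \<alpha> * cartan_int \<gamma> \<beta>) * (u \<gamma> * u (- \<gamma>)))"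
proof -
  have "orbit_sum uminus \<Phi> (\<lambda>\<gamma>. of_int (cartan_int \<gamma> \<alpha> * cartan_int \<gamma> \<beta>) * (u \<gamma> * u (- \<gamma>)))
     = (\<Sum>\<gamma>\<in>B. of_int (cartan_int \<gamma> \<alpha> * cartan_int \<gamma> \<beta>) * (u \<gamma> * u (- \<gamma>)))"
    by (rule orbit_sum_eq[OF involution_uminus assms(3)])
      (simp add: cartan_int_minus assms(1,2) mult.commute)
  then show ?thesis by (simp add: pi_form_def)
qed

text \<open>Only \<open>\<langle>\<gamma>,\<beta>\<rangle> = \<plusminus>1\<close> contributes, and exactly one member of each contributing pair has the value 1. So the
  sum over pairs becomes the sum over these members, as in the second equation.\<close>
lemma two_thirds_form_common:
  assumes ab: "\<alpha> \<in> \<Phi>" "\<beta> \<in> \<Phi>" "\<alpha> \<star> \<beta> = 0"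
  shows "two_thirds_form u h \<alpha> \<beta> = u \<alpha> * h \<beta> +
    (\<Sum>\<gamma>\<in>common \<alpha> \<beta>. of_int (N \<gamma> (\<alpha> - \<gamma>)) * (u \<gamma> * u (\<alpha> - \<gamma>)))"
proof -
  obtain B where B: "root_transversal \<alpha> B"
    "\<And>\<gamma>. \<gamma> \<in> acute \<alpha> \<Longrightarrow> (\<alpha> - \<gamma>) \<star> \<beta> < \<gamma> \<star> \<beta> \<Longrightarrow> \<gamma> \<in> B"
    using acute_transversal[OF ab(1), of "\<lambda>\<gamma>. \<gamma> \<star> \<beta>"] by blast
  have fin: "finite B" using transversal_finite[OF B(1) finite_acute] .
  have sub: "common \<alpha> \<beta> \<subseteq> B"
    using B(2) ab by (auto simp: common_def acute_def)
  have zero: "cartan_int \<gamma> \<beta> = 0" if "\<gamma> \<in> B - common \<alpha> \<beta>" for \<gamma>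
  proof -
    have g: "\<gamma> \<in> acute \<alpha>" "\<alpha> - \<gamma> \<notin> B" using that B(1) by (auto simp: transversal_def)
    have r: "\<gamma> \<in> \<Phi>" "\<gamma> \<star> \<alpha> = 1" using g by (auto simp: acute_def)
    have "\<alpha> - \<gamma> \<in> acute \<alpha>" using acute_diff g ab by blast
    then have "\<gamma> \<star> \<beta> \<ge> 0" using B(2)[of "\<alpha> - \<gamma>"] g ab by force
    moreover have "\<gamma> \<star> \<beta> \<noteq> 1" using that r by (auto simp: common_def)
    moreover have "\<gamma> \<star> \<beta> \<noteq> 2" using pairing_2_imp_eq[of \<gamma> \<beta>] r ab by (auto simp: pairing_comm)
    ultimately have "\<gamma> \<star> \<beta> = 0" using pairing_cases[of \<gamma> \<beta>] r ab by force
    then show ?thesis using cartan_int_eqI[of \<gamma> \<beta> 0] r ab by simp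
  qed
  have one: "cartan_int \<gamma> \<beta> = 1" if "\<gamma> \<in> common \<alpha> \<beta>" for \<gamma>
    using cartan_int_eqI[of \<gamma> \<beta> 1] that ab by (auto simp: common_def)
  have "(\<Sum>\<gamma>\<in>common \<alpha> \<beta>. of_int (N \<gamma> (\<alpha> - \<gamma>)) * (u \<gamma> * u (\<alpha> - \<gamma>)))
    = (\<Sum>\<gamma>\<in>B. of_int (cartan_int \<gamma> \<beta> * N \<gamma> (\<alpha> - \<gamma>)) * (u \<gamma> * u (\<alpha> - \<gamma>)))"
    by (rule sum.mono_neutral_cong_left[OF fin sub]) (use zero one in auto)
  then show ?thesis using two_thirds_form_eq[OF ab B(1)] by simp
qed

text \<open>Here one member of each contributing pair \<open>{\<gamma>,-\<gamma>}\<close> has \<open>\<langle>\<gamma>,\<alpha>\<rangle> = 1\<close>. The pair \<open>{\<alpha>,-\<alpha>}\<close> drops out because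
  \<open>\<alpha>\<close> is orthogonal to \<open>\<beta>\<close>.\<close>
lemma pi_form_acute:
  assumes ab: "\<alpha> \<in> \<Phi>" "\<beta> \<in> \<Phi>" "\<alpha> \<star> \<beta> = 0"
  shows "pi_form u h \<alpha> \<beta> = h \<alpha> * h \<beta> +
    (\<Sum>\<gamma>\<in>acute \<alpha>. of_int (cartan_int \<gamma> \<beta>) * (u \<gamma> * u (- \<gamma>)))"
proof -
  obtain B where B: "transversal uminus \<Phi> B"
    "\<And>\<gamma>. \<gamma> \<in> \<Phi> \<Longrightarrow> (- \<gamma>) \<star> \<alpha> < \<gamma> \<star> \<alpha> \<Longrightarrow> \<gamma> \<in> B"
    using uminus_transversal[of "\<lambda>\<gamma>. \<gamma> \<star> \<alpha>"] by blast
  have fin: "finite B" using transversal_finite[OF B(1) finite_roots] .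
  have sub: "acute \<alpha> \<subseteq> B"
    using B(2) ab by (auto simp: acute_def)
  have zero: "cartan_int \<gamma> \<alpha> * cartan_int \<gamma> \<beta> = 0" if "\<gamma> \<in> B - acute \<alpha>" for \<gamma>
  proof -
    have g: "\<gamma> \<in> \<Phi>" "- \<gamma> \<notin> B" using that B(1) by (auto simp: transversal_def)
    then have "\<gamma> \<star> \<alpha> \<ge> 0" using B(2)[of "- \<gamma>"] ab by force
    moreover have "\<gamma> \<star> \<alpha> \<noteq> 1" using that g by (auto simp: acute_def)
    ultimately consider "\<gamma> \<star> \<alpha> = 0" | "\<gamma> \<star> \<alpha> = 2" using pairing_cases[of \<gamma> \<alpha>] g ab by force
    then show ?thesis
    proof cases
      case 1
      then show ?thesis using cartan_int_eqI[of \<gamma> \<alpha> 0] g ab by simp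
    next
      case 2
      then have "\<gamma> = \<alpha>" using pairing_2_imp_eq g ab by blast
      then show ?thesis using cartan_int_eqI[of \<gamma> \<beta> 0] g ab by simp
    qed
  qed
  have one: "cartan_int \<gamma> \<alpha> = 1" if "\<gamma> \<in> acute \<alpha>" for \<gamma>
    using cartan_int_eqI[of \<gamma> \<alpha> 1] that ab by (auto simp: acute_def)
  have "(\<Sum>\<gamma>\<in>acute \<alpha>. of_int (cartan_int \<gamma> \<beta>) * (u \<gamma> * u (- \<gamma>)))
    = (\<Sum>\<gamma>\<in>B. of_int (cartan_int \<gamma> \<alpha> * cartan_int \<gamma> \<beta>) * (u \<gamma> * u (- \<gamma>)))"
  proof (rule sum.mono_neutral_cong_left[OF fin sub])
    show "\<forall>i\<in>B - acute \<alpha>. of_int (cartan_int i \<alpha> * cartan_int i \<beta>) * (u i * u (- i)) = 0"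
      using zero by (metis mult_zero_left of_int_0)
  qed (use one in auto)
  then show ?thesis using pi_form_eq[OF ab(1,2) B(1)] by simp
qed

text \<open>Passing from the base pair \<open>\<alpha>, \<beta>\<close> to \<open>\<gamma>, \<delta>\<close> exchanges these two pairs, one of which is distinguished
  and the other a summand; all other pairs with the same sum occur in both forms. Their coefficients
  agree up to the common factor by \<open>pair_sign_base_change\<close>.\<close>

lemma half_pi_form_base_change:
  fixes u :: "'a \<Rightarrow> 'r::comm_ring_1"
  assumes ab: "\<alpha> \<in> \<Phi>" "\<beta> \<in> \<Phi>" "\<alpha> \<star> \<beta> = 0" and g: "\<gamma> \<in> common \<alpha> \<beta>"
  shows "half_pi_form u \<alpha> \<beta> = - of_int (pair_sign \<alpha> \<beta> \<gamma>) * half_pi_form u \<gamma> (\<alpha> + \<beta> - \<gamma>)"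
proof -
  define \<delta> where "\<delta> = \<alpha> + \<beta> - \<gamma>"
  have gd: "\<gamma> \<in> \<Phi>" "\<delta> \<in> \<Phi>" "\<gamma> \<star> \<delta> = 0" "\<gamma> \<star> \<alpha> = 1" "\<gamma> \<star> \<beta> = 1" "\<delta> \<in> common \<alpha> \<beta>"
    "\<delta> \<star> \<alpha> = 1" "\<delta> \<star> \<beta> = 1" "\<gamma> + \<delta> = \<alpha> + \<beta>"
    using g complement_root[OF ab g] by (auto simp: common_def \<delta>_def)
  obtain B where B: "pair_transversal \<alpha> \<beta> B"
    "\<And>\<epsilon>. \<epsilon> \<in> common \<alpha> \<beta> \<Longrightarrow> (\<alpha> + \<beta> - \<epsilon>) \<star> \<gamma> < \<epsilon> \<star> \<gamma> \<Longrightarrow> \<epsilon> \<in> B"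
    using common_transversal[OF ab, of "\<lambda>\<epsilon>. \<epsilon> \<star> \<gamma>"] by blast
  have fin: "finite B" using transversal_finite[OF B(1) finite_common] .
  have gB: "\<gamma> \<in> B" by (rule B(2)[OF g]) (use gd in \<open>simp add: pairing_comm\<close>)
  have "\<delta> \<noteq> \<gamma>" using gd(1,3) by auto
  have dB: "\<delta> \<notin> B" using B(1) g gB by (simp add: transversal_def \<delta>_def)
  \<comment> \<open>\<open>C\<close> consists of the pairs that occur as summands of both forms.\<close>
  define C where "C = common \<alpha> \<beta> - {\<gamma>, \<delta>}"
  have eq2: "\<epsilon> \<star> \<gamma> = 1 \<and> \<epsilon> \<star> \<delta> = 1" if "\<epsilon> \<in> C" for \<epsilon>
  proof -
    have e: "\<epsilon> \<in> \<Phi>" "\<epsilon> \<star> \<alpha> = 1" "\<epsilon> \<star> \<beta> = 1" "\<epsilon> \<noteq> \<gamma>" "\<epsilon> \<noteq> \<delta>" using that by (auto simp: common_def C_def)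
    have "\<epsilon> \<star> \<gamma> + \<epsilon> \<star> \<delta> = \<epsilon> \<star> (\<alpha> + \<beta>)" using gd(9) by (metis pairing_simps(2))
    moreover have "\<epsilon> \<star> \<gamma> \<noteq> 2" "\<epsilon> \<star> \<delta> \<noteq> 2" using pairing_2_imp_eq e gd by blast+
    ultimately show ?thesis using pairing_cases[OF e(1) gd(1)] pairing_cases[OF e(1) gd(2)] e by auto
  qed
  have CC: "\<alpha> + \<beta> - \<epsilon> \<in> C" if "\<epsilon> \<in> C" for \<epsilon>
    using that complement_root[OF ab] gd(9) by (auto simp: C_def \<delta>_def)
  have common: "common \<gamma> \<delta> = C \<union> {\<alpha>, \<beta>}" and abC: "\<alpha> \<notin> C" "\<beta> \<notin> C"
  proof -
    show abC: "\<alpha> \<notin> C" "\<beta> \<notin> C" using ab by (auto simp: C_def common_def)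
    show "common \<gamma> \<delta> = C \<union> {\<alpha>, \<beta>}"
    proof (intro equalityI subsetI)
      fix \<epsilon> assume "\<epsilon> \<in> common \<gamma> \<delta>"
      then have e: "\<epsilon> \<in> \<Phi>" "\<epsilon> \<star> \<gamma> = 1" "\<epsilon> \<star> \<delta> = 1" by (auto simp: common_def)
      have "\<epsilon> \<star> \<alpha> + \<epsilon> \<star> \<beta> = \<epsilon> \<star> (\<gamma> + \<delta>)" using gd(9) by (metis pairing_simps(2))
      then have "\<epsilon> \<star> \<alpha> = 1 \<and> \<epsilon> \<star> \<beta> = 1 \<or> \<epsilon> \<star> \<alpha> = 2 \<or> \<epsilon> \<star> \<beta> = 2"
        using pairing_cases[OF e(1) ab(1)] pairing_cases[OF e(1) ab(2)] e by auto
      then show "\<epsilon> \<in> C \<union> {\<alpha>, \<beta>}"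
        using e pairing_2_imp_eq ab gd by (auto simp: C_def common_def)
    next
      fix \<epsilon> assume "\<epsilon> \<in> C \<union> {\<alpha>, \<beta>}"
      then show "\<epsilon> \<in> common \<gamma> \<delta>"
        using eq2[of \<epsilon>] gd ab by (auto simp: C_def common_def pairing_comm)
    qed
  qed
  have neq: "\<alpha> \<noteq> \<beta>" using ab by auto
  define D where "D = B \<inter> C"
  have Beq: "B = insert \<gamma> D" "\<gamma> \<notin> D"
    using B(1) gB dB unfolding transversal_def D_def C_def by auto
  have tD: "pair_transversal \<gamma> \<delta> (insert \<alpha> D)"
    unfolding transversal_def gd(9)
  proof (intro conjI ballI)
    show "insert \<alpha> D \<subseteq> common \<gamma> \<delta>" using common by (auto simp: D_def)
    fix \<epsilon> assume e: "\<epsilon> \<in> common \<gamma> \<delta>"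
    show "\<epsilon> \<in> insert \<alpha> D \<longleftrightarrow> \<alpha> + \<beta> - \<epsilon> \<notin> insert \<alpha> D"
    proof (cases "\<epsilon> \<in> C")
      case True
      then have "\<epsilon> \<in> B \<longleftrightarrow> \<alpha> + \<beta> - \<epsilon> \<notin> B" using B(1) by (auto simp: transversal_def C_def)
      then show ?thesis using True CC[OF True] abC by (auto simp: D_def)
    next
      case False
      then consider "\<epsilon> = \<alpha>" | "\<epsilon> = \<beta>" using e common by auto
      then show ?thesis using abC neq by cases (auto simp: D_def)
    qed
  qed
  have finD: "finite D" using fin by (simp add: D_def)
  have aD: "\<alpha> \<notin> D" using abC by (simp add: D_def)
  have sg: "pair_sign \<gamma> \<delta> \<alpha> = pair_sign \<alpha> \<beta> \<gamma>"
  proof -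
    have "\<gamma> + \<delta> - \<alpha> = \<beta>" using gd(9) by (simp add: algebra_simps)
    then have "pair_sign \<gamma> \<delta> \<alpha> = N \<gamma> (- \<alpha>) * N \<delta> (- \<beta>)" by (simp add: pair_sign_def)
    also have "N \<gamma> (- \<alpha>) = - N (- \<alpha>) \<gamma>" using N_anti[of "- \<alpha>" \<gamma>] gd ab by (simp add: pairing_comm)
    also have "N (- \<alpha>) \<gamma> = - N \<alpha> (- \<gamma>)" using N_minus[of \<alpha> "- \<gamma>"] gd ab by (simp add: pairing_comm)
    also have "N \<delta> (- \<beta>) = - N (- \<beta>) \<delta>" using N_anti[of "- \<beta>" \<delta>] gd ab by (simp add: pairing_comm)
    also have "N (- \<beta>) \<delta> = - N \<beta> (- \<delta>)" using N_minus[of \<beta> "- \<delta>"] gd ab by (simp add: pairing_comm)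
    finally show ?thesis by (simp add: pair_sign_def \<delta>_def)
  qed
  define s :: 'r where "s = of_int (pair_sign \<alpha> \<beta> \<gamma>)"
  have ss: "s * s = 1"
    unfolding s_def of_int_mult[symmetric] pair_sign_square[OF ab g] by simp
  define S where "S = (\<Sum>\<epsilon>\<in>D. of_int (pair_sign \<gamma> \<delta> \<epsilon>) * (u \<epsilon> * u (\<alpha> + \<beta> - \<epsilon>)))"
  have "half_pi_form u \<gamma> \<delta> = u \<gamma> * u \<delta> - (s * (u \<alpha> * u \<beta>) + S)"
    using half_pi_form_eq[OF gd(1,2,3) tD, of u] finD aD gd(9) sg by (simp add: S_def s_def)
  moreover have "half_pi_form u \<alpha> \<beta> = u \<alpha> * u \<beta> - (s * (u \<gamma> * u \<delta>) - s * S)"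
  proof -
    have "pair_sign \<alpha> \<beta> \<epsilon> = - pair_sign \<alpha> \<beta> \<gamma> * pair_sign \<gamma> \<delta> \<epsilon>" if "\<epsilon> \<in> D" for \<epsilon>
      using pair_sign_base_change[OF ab g, of \<epsilon>] that common by (auto simp: D_def C_def \<delta>_def)
    then have "(\<Sum>\<epsilon>\<in>D. of_int (pair_sign \<alpha> \<beta> \<epsilon>) * (u \<epsilon> * u (\<alpha> + \<beta> - \<epsilon>))) = - s * S"
      by (simp add: S_def s_def sum_distrib_left sum_negf mult.assoc)
    then show ?thesis
      using half_pi_form_eq[OF ab B(1), of u] Beq finD by (simp add: s_def \<delta>_def)
  qed
  ultimately have "half_pi_form u \<alpha> \<beta> = - s * half_pi_form u \<gamma> \<delta>"
    using ss by (simp add: right_diff_distrib distrib_left flip: mult.assoc)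
  then show ?thesis by (simp add: s_def \<delta>_def)
qed

lemma half_pi_form_commute:
  assumes "\<alpha> \<in> \<Phi>" "\<beta> \<in> \<Phi>" "\<alpha> \<star> \<beta> = 0"
  shows "half_pi_form u \<beta> \<alpha> = half_pi_form u \<alpha> \<beta>"
proof -
  obtain B where B: "pair_transversal \<alpha> \<beta> B"
    using common_transversal[OF assms, of "\<lambda>_. 0"] by blast
  have c: "common \<beta> \<alpha> = common \<alpha> \<beta>" by (auto simp: common_def)
  have B': "pair_transversal \<beta> \<alpha> B" using B by (simp add: c add.commute)
  have "B \<subseteq> common \<alpha> \<beta>" using B by (simp add: transversal_def)
  then have "pair_sign \<beta> \<alpha> \<gamma> = pair_sign \<alpha> \<beta> \<gamma>" if "\<gamma> \<in> B" for \<gamma>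
    using that pair_sign_swap[OF assms] by blast
  then show ?thesis
    using half_pi_form_eq[OF assms B, of u] half_pi_form_eq[OF assms(2,1) _ B', of u] assms(3)
    by (simp add: pairing_comm mult.commute add.commute)
qed

end

section \<open>The first family of forms under a root unipotent\<close>

context structure_constants
begin

text \<open>The coordinates of \<open>x\<^sub>\<rho>(\<xi>) v\<close>, expressed by those of \<open>v\<close>.\<close>
definition unipotent_root :: "'a \<Rightarrow> 'r::comm_ring_1 \<Rightarrow> ('a \<Rightarrow> 'r) \<Rightarrow> ('a \<Rightarrow> 'r) \<Rightarrow> 'a \<Rightarrow> 'r" where
  "unipotent_root \<rho> \<xi> u h \<mu> =
     (if \<mu> = \<rho> then u \<rho> - \<xi> * h \<rho> - \<xi>\<^sup>2 * u (- \<rho>)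
      else if \<mu> \<star> \<rho> = 1 then u \<mu> + of_int (N \<rho> (\<mu> - \<rho>)) * \<xi> * u (\<mu> - \<rho>)
      else u \<mu>)"

definition unipotent_zero :: "'a \<Rightarrow> 'r::comm_ring_1 \<Rightarrow> ('a \<Rightarrow> 'r) \<Rightarrow> ('a \<Rightarrow> 'r) \<Rightarrow> 'a \<Rightarrow> 'r" where
  "unipotent_zero \<rho> \<xi> u h \<beta> = h \<beta> + of_int (cartan_int \<beta> \<rho>) * \<xi> * u (- \<rho>)"

definition solves :: "('a \<Rightarrow> 'r::comm_ring_1) \<Rightarrow> ('a \<Rightarrow> 'r) \<Rightarrow> bool" where
  "solves u h \<longleftrightarrow> (\<forall>\<alpha>\<in>\<Phi>. \<forall>\<beta>\<in>\<Phi>. \<alpha> \<star> \<beta> = 0 \<longrightarrow>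
     half_pi_form u \<alpha> \<beta> = 0 \<and> two_thirds_form u h \<alpha> \<beta> = 0 \<and> pi_form u h \<alpha> \<beta> = 0)"

end

text \<open>The function \<open>h\<close> stands for \<open>\<beta> \<mapsto> \<Sum>\<^sub>s \<langle>\<beta>,\<alpha>\<^sub>s\<rangle> v\<^sub>s\<close>; this is linear in \<open>\<beta>\<close>, which on roots
  means additive.\<close>
locale root_unipotent = structure_constants \<Phi> N
  for \<Phi> :: "'a::euclidean_space set" and N :: "'a \<Rightarrow> 'a \<Rightarrow> int" +
  fixes \<rho> :: 'a and \<xi> :: "'r::comm_ring_1" and u h :: "'a \<Rightarrow> 'r"
  assumes rho: "\<rho> \<in> \<Phi>"
    and h_add: "\<alpha> \<in> \<Phi> \<Longrightarrow> \<beta> \<in> \<Phi> \<Longrightarrow> \<alpha> + \<beta> \<in> \<Phi> \<Longrightarrow> h (\<alpha> + \<beta>) = h \<alpha> + h \<beta>"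
    and h_minus: "\<alpha> \<in> \<Phi> \<Longrightarrow> h (- \<alpha>) = - h \<alpha>"
begin

abbreviation "w \<equiv> unipotent_root \<rho> \<xi> u h"
abbreviation "h' \<equiv> unipotent_zero \<rho> \<xi> u h"

lemma w_rho: "w \<rho> = u \<rho> - \<xi> * h \<rho> - \<xi>\<^sup>2 * u (- \<rho>)"
  by (simp add: unipotent_root_def)

lemma w_one: "\<mu> \<star> \<rho> = 1 \<Longrightarrow> w \<mu> = u \<mu> + of_int (N \<rho> (\<mu> - \<rho>)) * \<xi> * u (\<mu> - \<rho>)"
  using rho by (auto simp: unipotent_root_def)

lemma w_low: "\<mu> \<star> \<rho> \<le> 0 \<Longrightarrow> w \<mu> = u \<mu>"
  using rho by (auto simp: unipotent_root_def)

lemma rho_cases: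
  assumes "\<mu> \<in> \<Phi>"
  obtains "\<mu> = - \<rho>" "\<mu> \<star> \<rho> = -2" | "\<mu> \<star> \<rho> = -1" | "\<mu> \<star> \<rho> = 0" | "\<mu> \<star> \<rho> = 1" | "\<mu> = \<rho>" "\<mu> \<star> \<rho> = 2"
  using pairing_cases[OF assms rho] pairing_2_imp_eq[OF _ assms rho] pairing_minus_2_imp_eq[OF _ assms rho] by blast

lemma h_reflection:
  assumes "\<beta> \<in> \<Phi>"
  shows "h (\<beta> - (\<beta> \<star> \<rho>) *\<^sub>R \<rho>) = h \<beta> - of_int (cartan_int \<beta> \<rho>) * h \<rho>"
proof (cases rule: rho_cases[OF assms])
  case 1
  then have "cartan_int \<beta> \<rho> = -2" using cartan_int_eqI[OF assms rho, of "-2"] by simp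
  then show ?thesis using 1 rho h_minus by (simp add: scaleR_2)
next
  case 2
  then have c: "cartan_int \<beta> \<rho> = -1" using cartan_int_eqI[OF assms rho, of "-1"] by simp
  have "\<beta> + \<rho> \<in> \<Phi>" using add_root assms rho 2 by blast
  then show ?thesis using 2 c h_add[OF assms rho] by simp
next
  case 3
  then have "cartan_int \<beta> \<rho> = 0" using cartan_int_eqI[OF assms rho, of 0] by simp
  then show ?thesis using 3 by simp
next
  case 4
  then have c: "cartan_int \<beta> \<rho> = 1" using cartan_int_eqI[OF assms rho, of 1] by simp
  have "\<beta> - \<rho> \<in> \<Phi>" using diff_root assms rho 4 by blast
  then show ?thesis using 4 c h_add[of "\<beta> - \<rho>" \<rho>] assms rho by simp
next
  case 5
  then have "cartan_int \<beta> \<rho> = 2" using cartan_int_eqI[OF assms rho, of 2] by simp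
  then show ?thesis using 5 rho h_minus by (simp add: scaleR_2)
qed

lemma orthogonal_pair_low:
  assumes "\<gamma> \<in> \<Phi>" "\<delta> \<in> \<Phi>" "\<gamma> \<star> \<delta> = 0" "\<gamma> \<star> \<rho> + \<delta> \<star> \<rho> < 0"
  shows "\<gamma> \<star> \<rho> \<le> 0"
  using assms(4)
proof (cases rule: rho_cases[OF assms(1)]; cases rule: rho_cases[OF assms(2)])
qed (use assms rho in auto)

text \<open>A coordinate at \<open>\<gamma>\<close> changes only if \<open>\<langle>\<gamma>,\<rho>\<rangle> > 0\<close>. In a pair of orthogonal roots whose values add up to a
  negative number neither value is positive.\<close>
lemma half_pi_low:
  assumes ab: "\<alpha> \<in> \<Phi>" "\<beta> \<in> \<Phi>" "\<alpha> \<star> \<beta> = 0" and t: "\<alpha> \<star> \<rho> + \<beta> \<star> \<rho> < 0"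
  shows "half_pi_form w \<alpha> \<beta> = half_pi_form u \<alpha> \<beta>"
proof -
  have *: "w \<gamma> * w \<delta> = u \<gamma> * u \<delta>"
    if "\<gamma> \<in> \<Phi>" "\<delta> \<in> \<Phi>" "\<gamma> \<star> \<delta> = 0" "\<gamma> \<star> \<rho> + \<delta> \<star> \<rho> < 0" for \<gamma> \<delta>
    using w_low[of \<gamma>] w_low[of \<delta>] orthogonal_pair_low[of \<gamma> \<delta>] orthogonal_pair_low[of \<delta> \<gamma>] that
    by (simp add: pairing_comm add.commute)
  obtain B where B: "pair_transversal \<alpha> \<beta> B"
    using common_transversal[OF ab, of "\<lambda>_. 0"] by blast
  have "w \<gamma> * w (\<alpha> + \<beta> - \<gamma>) = u \<gamma> * u (\<alpha> + \<beta> - \<gamma>)" if "\<gamma> \<in> B" for \<gamma>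
  proof (rule *)
    have "\<gamma> \<in> common \<alpha> \<beta>" using that B by (auto simp: transversal_def)
    with complement_root[OF ab this] t
    show "\<gamma> \<in> \<Phi>" "\<alpha> + \<beta> - \<gamma> \<in> \<Phi>" "\<gamma> \<star> (\<alpha> + \<beta> - \<gamma>) = 0" "\<gamma> \<star> \<rho> + (\<alpha> + \<beta> - \<gamma>) \<star> \<rho> < 0"
      by (auto simp: common_def)
  qed
  then show ?thesis
    using *[OF ab t] by (simp add: half_pi_form_eq[OF ab B])
qed

text \<open>In each pair exactly one member has value 1 on \<open>\<rho>\<close>, and subtracting \<open>\<rho>\<close> from it gives a pair of the form
  for \<open>\<alpha> - \<rho>\<close>, \<open>\<beta>\<close>. These members, and their shifts, are the transversals used.\<close>
lemma half_pi_one: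
  assumes ab: "\<alpha> \<in> \<Phi>" "\<beta> \<in> \<Phi>" "\<alpha> \<star> \<beta> = 0" and ar: "\<alpha> \<star> \<rho> = 1" and br: "\<beta> \<star> \<rho> = 0"
  shows "half_pi_form w \<alpha> \<beta> =
    half_pi_form u \<alpha> \<beta> + of_int (N \<rho> (\<alpha> - \<rho>)) * \<xi> * half_pi_form u (\<alpha> - \<rho>) \<beta>"
proof -
  let ?c = "\<lambda>\<gamma>. \<alpha> + \<beta> - \<gamma>" and ?c' = "\<lambda>\<gamma>. (\<alpha> - \<rho>) + \<beta> - \<gamma>"
  define B where "B = {\<gamma> \<in> common \<alpha> \<beta>. \<gamma> \<star> \<rho> = 1}"
  have aR: "\<alpha> - \<rho> \<in> \<Phi>" using diff_root ab rho ar by blast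
  have ortho': "(\<alpha> - \<rho>) \<star> \<beta> = 0" using ab br by (simp add: pairing_comm)
  have split: "\<gamma> \<star> \<rho> = 1 \<and> \<delta> \<star> \<rho> = 0 \<or> \<gamma> \<star> \<rho> = 0 \<and> \<delta> \<star> \<rho> = 1"
    if "\<gamma> \<in> \<Phi>" "\<delta> \<in> \<Phi>" "\<gamma> \<star> \<delta> = 0" "\<gamma> \<star> \<rho> + \<delta> \<star> \<rho> = 1" for \<gamma> \<delta>
    using that(4)
  proof (cases rule: rho_cases[OF that(1)]; cases rule: rho_cases[OF that(2)])
  qed (use that(3) in \<open>auto simp: pairing_comm\<close>)
  have c: "\<gamma> \<in> \<Phi>" "?c \<gamma> \<in> \<Phi>" "\<gamma> \<star> ?c \<gamma> = 0" "\<gamma> \<star> \<rho> + ?c \<gamma> \<star> \<rho> = 1" "?c \<gamma> \<in> common \<alpha> \<beta>"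
    if "\<gamma> \<in> common \<alpha> \<beta>" for \<gamma>
    using complement_root[OF ab that] that ar br by (auto simp: common_def)
  have tB: "pair_transversal \<alpha> \<beta> B"
    unfolding transversal_def
  proof (intro conjI ballI)
    fix \<gamma> assume g: "\<gamma> \<in> common \<alpha> \<beta>"
    show "\<gamma> \<in> B \<longleftrightarrow> ?c \<gamma> \<notin> B"
      using split[OF c(1-4)[OF g]] c(5)[OF g] g unfolding B_def by auto
  qed (simp add: B_def)
  have split': "\<gamma> \<star> \<rho> = -1 \<and> \<delta> \<star> \<rho> = 0 \<or> \<gamma> \<star> \<rho> = 0 \<and> \<delta> \<star> \<rho> = -1"
    if "\<gamma> \<in> \<Phi>" "\<delta> \<in> \<Phi>" "\<gamma> \<star> \<delta> = 0" "\<gamma> \<star> \<rho> + \<delta> \<star> \<rho> = -1" for \<gamma> \<delta>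
    using split[of "- \<gamma>" "- \<delta>"] that by auto
  define B' where "B' = {\<gamma> \<in> common (\<alpha> - \<rho>) \<beta>. \<gamma> \<star> \<rho> = -1}"
  have c': "\<gamma> \<in> \<Phi>" "?c' \<gamma> \<in> \<Phi>" "\<gamma> \<star> ?c' \<gamma> = 0" "\<gamma> \<star> \<rho> + ?c' \<gamma> \<star> \<rho> = -1" "?c' \<gamma> \<in> common (\<alpha> - \<rho>) \<beta>"
    if "\<gamma> \<in> common (\<alpha> - \<rho>) \<beta>" for \<gamma>
    using complement_root[OF aR ab(2) ortho' that] that ar br rho by (auto simp: common_def)
  have tB': "pair_transversal (\<alpha> - \<rho>) \<beta> B'"
    unfolding transversal_def
  proof (intro conjI ballI)
    fix \<gamma> assume g: "\<gamma> \<in> common (\<alpha> - \<rho>) \<beta>"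
    show "\<gamma> \<in> B' \<longleftrightarrow> ?c' \<gamma> \<notin> B'"
      using split'[OF c'(1-4)[OF g]] c'(5)[OF g] g unfolding B'_def by auto
  qed (simp add: B'_def)
  have B'_image: "B' = (\<lambda>\<gamma>. \<gamma> - \<rho>) ` B"
  proof (intro equalityI subsetI)
    fix \<eta> assume "\<eta> \<in> B'"
    then have e: "\<eta> \<in> \<Phi>" "\<eta> \<star> (\<alpha> - \<rho>) = 1" "\<eta> \<star> \<beta> = 1" "\<eta> \<star> \<rho> = -1" by (auto simp: B'_def common_def)
    then have "\<eta> + \<rho> \<in> B" using add_root rho ar br by (auto simp: B_def common_def pairing_comm)
    then show "\<eta> \<in> (\<lambda>\<gamma>. \<gamma> - \<rho>) ` B" by (rule rev_image_eqI) simp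
  next
    fix \<eta> assume "\<eta> \<in> (\<lambda>\<gamma>. \<gamma> - \<rho>) ` B"
    then show "\<eta> \<in> B'"
      using diff_root rho ar br by (auto simp: B_def B'_def common_def pairing_comm)
  qed
  have sign: "pair_sign \<alpha> \<beta> \<gamma> * N \<rho> (\<gamma> - \<rho>) = N \<rho> (\<alpha> - \<rho>) * pair_sign (\<alpha> - \<rho>) \<beta> (\<gamma> - \<rho>)"
    if "\<gamma> \<in> B" for \<gamma>
  proof -
    have g: "\<gamma> \<in> \<Phi>" "\<gamma> \<star> \<alpha> = 1" "\<gamma> \<star> \<beta> = 1" "\<gamma> \<star> \<rho> = 1" using that by (auto simp: B_def common_def)
    have "N (\<alpha> - \<rho>) \<rho> * N (\<alpha> - \<rho> + \<rho>) (- \<gamma>) = N \<rho> (- \<gamma>) * N (\<alpha> - \<rho>) (\<rho> + - \<gamma>)"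
      by (rule N_cocycle) (use g ab ar rho aR in \<open>simp_all add: pairing_comm\<close>)
    moreover have "N (\<alpha> - \<rho>) \<rho> = - N \<rho> (\<alpha> - \<rho>)"
      using N_anti[of \<rho> "\<alpha> - \<rho>"] rho aR ar by (simp add: pairing_comm)
    moreover have "N \<rho> (- \<gamma>) = - N \<rho> (\<gamma> - \<rho>)"
      using N_opposite_third(1)[OF g(1) rho g(4)] N_anti[of "- \<gamma>" \<rho>] rho g by simp
    ultimately have 1: "N \<rho> (\<alpha> - \<rho>) * N \<alpha> (- \<gamma>) = N \<rho> (\<gamma> - \<rho>) * N (\<alpha> - \<rho>) (- (\<gamma> - \<rho>))"
      by simp
    have 2: "N \<rho> (\<alpha> - \<rho>) * N \<rho> (\<alpha> - \<rho>) = 1" "N \<rho> (\<gamma> - \<rho>) * N \<rho> (\<gamma> - \<rho>) = 1"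
      using N_opposite_third(4) g ab rho ar by blast+
    from 1 2 have "N \<alpha> (- \<gamma>) * N \<rho> (\<gamma> - \<rho>) = N \<rho> (\<alpha> - \<rho>) * N (\<alpha> - \<rho>) (- (\<gamma> - \<rho>))"
      by algebra
    then show ?thesis by (simp add: pair_sign_def algebra_simps)
  qed
  have summand: "of_int (pair_sign \<alpha> \<beta> \<gamma>) * (w \<gamma> * w (?c \<gamma>)) =
      of_int (pair_sign \<alpha> \<beta> \<gamma>) * (u \<gamma> * u (?c \<gamma>)) +
      of_int (N \<rho> (\<alpha> - \<rho>)) * \<xi> *
        (of_int (pair_sign (\<alpha> - \<rho>) \<beta> (\<gamma> - \<rho>)) * (u (\<gamma> - \<rho>) * u (?c' (\<gamma> - \<rho>))))"
    if "\<gamma> \<in> B" for \<gamma>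
  proof -
    have "\<gamma> \<star> \<rho> = 1" "?c \<gamma> \<star> \<rho> = 0" using that ar br by (auto simp: B_def)
    moreover have exchange: "s * ((a + n * \<xi> * b) * c) = s * (a * c) + m * \<xi> * (t * (b * c))"
      if "s * n = m * t" for s n m t a b c :: 'r
    proof -
      have "s * ((a + n * \<xi> * b) * c) = s * (a * c) + (s * n) * (\<xi> * (b * c))"
        by (simp add: algebra_simps)
      then show ?thesis unfolding that by (simp add: algebra_simps)
    qed
    moreover have "(of_int (pair_sign \<alpha> \<beta> \<gamma>) * of_int (N \<rho> (\<gamma> - \<rho>)) :: 'r)
        = of_int (N \<rho> (\<alpha> - \<rho>)) * of_int (pair_sign (\<alpha> - \<rho>) \<beta> (\<gamma> - \<rho>))"
      using sign[OF that] by (metis of_int_mult)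
    moreover have "?c' (\<gamma> - \<rho>) = ?c \<gamma>" by simp
    ultimately show ?thesis by (simp only: w_one w_low order_refl)
  qed
  have "(\<Sum>\<gamma>\<in>B. of_int (pair_sign \<alpha> \<beta> \<gamma>) * (w \<gamma> * w (?c \<gamma>)))
     = (\<Sum>\<gamma>\<in>B. of_int (pair_sign \<alpha> \<beta> \<gamma>) * (u \<gamma> * u (?c \<gamma>))) +
      of_int (N \<rho> (\<alpha> - \<rho>)) * \<xi> *
        (\<Sum>\<gamma>\<in>B. of_int (pair_sign (\<alpha> - \<rho>) \<beta> (\<gamma> - \<rho>)) * (u (\<gamma> - \<rho>) * u (?c' (\<gamma> - \<rho>))))"
    unfolding sum_distrib_left sum.distrib[symmetric] by (rule sum.cong[OF refl summand])
  also have "(\<Sum>\<gamma>\<in>B. of_int (pair_sign (\<alpha> - \<rho>) \<beta> (\<gamma> - \<rho>)) * (u (\<gamma> - \<rho>) * u (?c' (\<gamma> - \<rho>))))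
    = (\<Sum>\<eta>\<in>B'. of_int (pair_sign (\<alpha> - \<rho>) \<beta> \<eta>) * (u \<eta> * u (?c' \<eta>)))"
    unfolding B'_image by (subst sum.reindex) (auto simp: inj_on_def)
  finally show ?thesis
    unfolding half_pi_form_eq[OF ab tB] half_pi_form_eq[OF aR ab(2) ortho' tB'] w_one[OF ar]
    by (simp add: w_low br algebra_simps)
qed

text \<open>Besides \<open>\<alpha>, \<beta>\<close> exactly one pair is moved, namely \<open>\<beta> + \<rho>, \<alpha> - \<rho>\<close>: a root \<open>\<gamma>\<close> in the sum with \<open>\<langle>\<gamma>,\<rho>\<rangle> = 1\<close> has
  \<open>\<langle>\<gamma>,\<beta>+\<rho>\<rangle> = 2\<close>. The two changes cancel by the cocycle rule.\<close>
lemma half_pi_zero_base: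
  assumes ab: "\<alpha> \<in> \<Phi>" "\<beta> \<in> \<Phi>" "\<alpha> \<star> \<beta> = 0" and ar: "\<alpha> \<star> \<rho> = 1" and br: "\<beta> \<star> \<rho> = -1"
  shows "half_pi_form w \<alpha> \<beta> = half_pi_form u \<alpha> \<beta>"
proof -
  let ?c = "\<lambda>\<gamma>. \<alpha> + \<beta> - \<gamma>"
  have aR: "\<alpha> - \<rho> \<in> \<Phi>" using diff_root ab rho ar by blast
  have bR: "\<beta> + \<rho> \<in> \<Phi>" using add_root ab rho br by blast
  have bR': "\<beta> + \<rho> \<in> common \<alpha> \<beta>" using bR ab ar br by (simp add: common_def pairing_comm)
  have bR1: "(\<beta> + \<rho>) \<star> \<rho> = 1" using br rho by simp
  obtain B where B: "pair_transversal \<alpha> \<beta> B"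
    "\<And>\<gamma>. \<gamma> \<in> common \<alpha> \<beta> \<Longrightarrow> ?c \<gamma> \<star> \<rho> < \<gamma> \<star> \<rho> \<Longrightarrow> \<gamma> \<in> B"
    using common_transversal[OF ab, of "\<lambda>\<gamma>. \<gamma> \<star> \<rho>"] by blast
  have fin: "finite B" using transversal_finite[OF B(1) finite_common] .
  have inB: "\<beta> + \<rho> \<in> B" using B(2)[OF bR'] ar bR1 br by simp
  have rest: "\<gamma> \<star> \<rho> = 0" if "\<gamma> \<in> B - {\<beta> + \<rho>}" for \<gamma>
  proof -
    have gc: "\<gamma> \<in> common \<alpha> \<beta>" and gi: "?c \<gamma> \<notin> B" using that B(1) by (auto simp: transversal_def)
    have g: "\<gamma> \<in> \<Phi>" "\<gamma> \<star> \<alpha> = 1" "\<gamma> \<star> \<beta> = 1" using gc by (auto simp: common_def)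
    show ?thesis
    proof (cases rule: rho_cases[OF g(1)])
      case 4
      have "\<gamma> \<star> (\<beta> + \<rho>) = 2" using 4 g by simp
      then show ?thesis using pairing_2_imp_eq g bR that by blast
    next
      case 2
      then have "?c \<gamma> \<in> B" using B(2)[OF complement_root[OF ab gc]] ar br by simp
      then show ?thesis using gi by blast
    qed (use g ar br ab in \<open>auto simp: pairing_comm\<close>)
  qed
  have sign: "N \<rho> (\<alpha> - \<rho>) = pair_sign \<alpha> \<beta> (\<beta> + \<rho>) * N \<rho> \<beta>"
  proof -
    have "N \<alpha> (- \<rho>) * N (\<alpha> + - \<rho>) (- \<beta>) = N (- \<rho>) (- \<beta>) * N \<alpha> (- \<rho> + - \<beta>)"
      by (rule N_cocycle) (use ab ar br rho in \<open>simp_all add: pairing_comm\<close>)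
    moreover have "N \<rho> (\<alpha> - \<rho>) = - N \<alpha> (- \<rho>)" using N_opposite_third(2) ab rho ar by blast
    moreover have "N (- \<rho>) (- \<beta>) = - N \<rho> \<beta>" using N_minus ab rho br by (simp add: pairing_comm)
    moreover have "N \<beta> (- (\<alpha> - \<rho>)) = N (\<alpha> - \<rho>) (- \<beta>)"
    proof -
      have p: "(\<alpha> - \<rho>) \<star> (- \<beta>) = -1" using ab br by (simp add: pairing_comm)
      have "N \<beta> (- (\<alpha> - \<rho>)) = - N (- \<beta>) (\<alpha> - \<rho>)"
        using N_minus[of "- \<beta>" "\<alpha> - \<rho>"] ab aR p by (simp add: pairing_comm)
      then show ?thesis using N_anti[of "\<alpha> - \<rho>" "- \<beta>"] ab aR p by simp
    qed
    moreover have "N (\<alpha> - \<rho>) (- \<beta>) * N (\<alpha> - \<rho>) (- \<beta>) = 1"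
      using N_square[of "\<alpha> - \<rho>" "- \<beta>"] ab aR br by (simp add: pairing_comm)
    moreover have "pair_sign \<alpha> \<beta> (\<beta> + \<rho>) = N \<alpha> (- \<rho> + - \<beta>) * N \<beta> (- (\<alpha> - \<rho>))"
      by (simp add: pair_sign_def algebra_simps)
    ultimately show ?thesis by (simp only: add_uminus_conv_diff) algebra
  qed
  let ?s = "of_int (pair_sign \<alpha> \<beta> (\<beta> + \<rho>)) :: 'r"
  let ?R = "\<Sum>\<gamma>\<in>B - {\<beta> + \<rho>}. of_int (pair_sign \<alpha> \<beta> \<gamma>) * (u \<gamma> * u (?c \<gamma>))"
  have R: "(\<Sum>\<gamma>\<in>B - {\<beta> + \<rho>}. of_int (pair_sign \<alpha> \<beta> \<gamma>) * (w \<gamma> * w (?c \<gamma>))) = ?R"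
    using rest ar br by (intro sum.cong refl) (simp add: w_low)
  have i: "?c (\<beta> + \<rho>) = \<alpha> - \<rho>" "\<beta> + \<rho> - \<rho> = \<beta>" by simp_all
  have low: "(\<alpha> - \<rho>) \<star> \<rho> \<le> 0" using ar rho by simp
  have "half_pi_form w \<alpha> \<beta> = (u \<alpha> + of_int (N \<rho> (\<alpha> - \<rho>)) * \<xi> * u (\<alpha> - \<rho>)) * u \<beta>
      - (?s * ((u (\<beta> + \<rho>) + of_int (N \<rho> \<beta>) * \<xi> * u \<beta>) * u (\<alpha> - \<rho>)) + ?R)"
    using sum.remove[OF fin inB, of "\<lambda>\<gamma>. of_int (pair_sign \<alpha> \<beta> \<gamma>) * (w \<gamma> * w (?c \<gamma>))"]
    unfolding half_pi_form_eq[OF ab B(1)] R i w_one[OF ar] w_one[OF bR1] w_low[OF low]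
    by (simp add: w_low br)
  also have "\<dots> = u \<alpha> * u \<beta> - (?s * (u (\<beta> + \<rho>) * u (\<alpha> - \<rho>)) + ?R)"
    unfolding sign of_int_mult by (simp add: algebra_simps)
  also have "\<dots> = half_pi_form u \<alpha> \<beta>"
    using sum.remove[OF fin inB, of "\<lambda>\<gamma>. of_int (pair_sign \<alpha> \<beta> \<gamma>) * (u \<gamma> * u (?c \<gamma>))"]
    unfolding half_pi_form_eq[OF ab B(1)] i by simp
  finally show ?thesis .
qed

text \<open>If some pair is moved, it is taken as the base pair; otherwise there is nothing to prove.\<close>
lemma half_pi_zero:
  assumes ab: "\<alpha> \<in> \<Phi>" "\<beta> \<in> \<Phi>" "\<alpha> \<star> \<beta> = 0" and t: "\<alpha> \<star> \<rho> + \<beta> \<star> \<rho> = 0"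
  shows "half_pi_form w \<alpha> \<beta> = half_pi_form u \<alpha> \<beta>"
proof -
  let ?c = "\<lambda>\<gamma>. \<alpha> + \<beta> - \<gamma>"
  have split: "\<gamma> \<star> \<rho> = 1 \<and> \<delta> \<star> \<rho> = -1 \<or> \<gamma> \<star> \<rho> = 0 \<and> \<delta> \<star> \<rho> = 0 \<or> \<gamma> \<star> \<rho> = -1 \<and> \<delta> \<star> \<rho> = 1"
    if "\<gamma> \<in> \<Phi>" "\<delta> \<in> \<Phi>" "\<gamma> \<star> \<delta> = 0" "\<gamma> \<star> \<rho> + \<delta> \<star> \<rho> = 0" for \<gamma> \<delta>
    using that(4)
  proof (cases rule: rho_cases[OF that(1)]; cases rule: rho_cases[OF that(2)])
  qed (use that(3) rho in \<open>auto simp: pairing_comm\<close>)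
  from split[OF ab t] consider (pos) "\<alpha> \<star> \<rho> = 1" "\<beta> \<star> \<rho> = -1" | (neg) "\<beta> \<star> \<rho> = 1" "\<alpha> \<star> \<rho> = -1"
    | (flat) "\<alpha> \<star> \<rho> = 0" "\<beta> \<star> \<rho> = 0" by blast
  then show ?thesis
  proof cases
    case pos
    then show ?thesis using half_pi_zero_base ab by blast
  next
    case neg
    then show ?thesis
      using half_pi_zero_base[of \<beta> \<alpha>] half_pi_form_commute[OF ab, of w]
        half_pi_form_commute[OF ab, of u] ab by (simp add: pairing_comm)
  next
    case flat
    have c: "\<gamma> \<in> \<Phi>" "?c \<gamma> \<in> \<Phi>" "\<gamma> \<star> ?c \<gamma> = 0" "\<gamma> \<star> \<rho> + ?c \<gamma> \<star> \<rho> = 0" "?c \<gamma> \<in> common \<alpha> \<beta>"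
      if "\<gamma> \<in> common \<alpha> \<beta>" for \<gamma>
      using complement_root[OF ab that] that flat by (auto simp: common_def)
    show ?thesis
    proof (cases "\<exists>\<gamma>\<in>common \<alpha> \<beta>. \<gamma> \<star> \<rho> = 1")
      case True
      then obtain \<gamma> where g: "\<gamma> \<in> common \<alpha> \<beta>" "\<gamma> \<star> \<rho> = 1" by blast
      have "?c \<gamma> \<star> \<rho> = -1" using g flat by simp
      then show ?thesis
        using half_pi_zero_base[of \<gamma> "?c \<gamma>"] c[OF g(1)] g(2)
          half_pi_form_base_change[OF ab g(1), of w] half_pi_form_base_change[OF ab g(1), of u] by simp
    next
      case False
      have low: "\<gamma> \<star> \<rho> = 0" if "\<gamma> \<in> common \<alpha> \<beta>" for \<gamma>
        using split[OF c(1-4)[OF that]] False that c(5)[OF that] by blast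
      obtain B where B: "pair_transversal \<alpha> \<beta> B"
        using common_transversal[OF ab, of "\<lambda>_. 0"] by blast
      then have "B \<subseteq> common \<alpha> \<beta>" by (simp add: transversal_def)
      then have "w \<gamma> * w (?c \<gamma>) = u \<gamma> * u (?c \<gamma>)" if "\<gamma> \<in> B" for \<gamma>
        using low[of \<gamma>] low[of "?c \<gamma>"] c(5)[of \<gamma>] that w_low[of \<gamma>] w_low[of "?c \<gamma>"] by auto
      then show ?thesis
        using w_low[of \<alpha>] w_low[of \<beta>] flat by (simp add: half_pi_form_eq[OF ab B])
    qed
  qed
qed

text \<open>Every summand has both members moved. The terms linear in \<open>\<xi>\<close>, two for each unordered pair, form a
  sum over ordered pairs, which is the sum in \<open>g(\<beta>,\<rho>)\<close>. In the quadratic terms both members are shifted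
  by \<open>-\<rho>\<close>.\<close>
lemma half_pi_two_base:
  assumes b: "\<beta> \<in> \<Phi>" "\<beta> \<star> \<rho> = 0"
  shows "half_pi_form w \<rho> \<beta> =
    half_pi_form u \<rho> \<beta> - \<xi> * two_thirds_form u h \<beta> \<rho> - \<xi>\<^sup>2 * half_pi_form u (- \<rho>) \<beta>"
proof -
  let ?c = "\<lambda>\<gamma>. \<rho> + \<beta> - \<gamma>"
  have rb: "\<rho> \<star> \<beta> = 0" "(- \<rho>) \<star> \<beta> = 0" and mr: "- \<rho> \<in> \<Phi>" using b rho by (simp_all add: pairing_comm)
  obtain B where B: "pair_transversal \<rho> \<beta> B"
    using common_transversal[OF rho b(1) rb(1), of "\<lambda>_. 0"] by blast
  have sub: "B \<subseteq> common \<rho> \<beta>" using B by (simp add: transversal_def)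
  define B' where "B' = (\<lambda>\<gamma>. \<gamma> - \<rho>) ` B"
  have shift: "\<gamma> - \<rho> \<in> common (- \<rho>) \<beta>" if "\<gamma> \<in> common \<rho> \<beta>" for \<gamma>
    using that diff_root rho b rb by (auto simp: common_def)
  have unshift: "\<eta> + \<rho> \<in> common \<rho> \<beta>" if "\<eta> \<in> common (- \<rho>) \<beta>" for \<eta>
    using that add_root[of \<eta> \<rho>] rho b rb by (auto simp: common_def)
  have memB': "\<eta> \<in> B' \<longleftrightarrow> \<eta> + \<rho> \<in> B" for \<eta>
    unfolding B'_def by (auto intro: rev_image_eqI)
  have tB': "pair_transversal (- \<rho>) \<beta> B'"
    unfolding transversal_def
  proof (intro conjI ballI)
    show "B' \<subseteq> common (- \<rho>) \<beta>" using shift sub by (auto simp: B'_def)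
    fix \<eta> assume "\<eta> \<in> common (- \<rho>) \<beta>"
    then have "\<eta> + \<rho> \<in> B \<longleftrightarrow> ?c (\<eta> + \<rho>) \<notin> B"
      using B unshift unfolding transversal_def by blast
    moreover have "?c (\<eta> + \<rho>) = (- \<rho> + \<beta> - \<eta>) + \<rho>" by simp
    ultimately show "\<eta> \<in> B' \<longleftrightarrow> - \<rho> + \<beta> - \<eta> \<notin> B'" by (simp only: memB')
  qed
  have pt: "\<gamma> \<in> \<Phi>" "\<gamma> \<star> \<rho> = 1" "\<gamma> \<star> \<beta> = 1" "?c \<gamma> \<in> common \<rho> \<beta>" if "\<gamma> \<in> common \<rho> \<beta>" for \<gamma>
    using that complement_root[OF rho b(1) rb(1) that] by (auto simp: common_def)
  have sign1: "pair_sign \<rho> \<beta> \<gamma> * N \<rho> (?c \<gamma> - \<rho>) = N \<gamma> (\<beta> - \<gamma>)" if gc: "\<gamma> \<in> common \<rho> \<beta>" for \<gamma>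
  proof -
    note g = pt[OF gc]
    have d: "\<beta> - \<gamma> \<in> \<Phi>" "\<rho> - \<gamma> \<in> \<Phi>" using diff_root g b rho by (simp_all add: pairing_comm)
    have i: "?c \<gamma> - \<rho> = \<beta> - \<gamma>" by simp
    have "N \<rho> (- \<gamma>) * N (\<rho> - \<gamma>) \<beta> = N (- \<gamma>) \<beta> * N \<rho> (\<beta> - \<gamma>)"
      using N_cocycle[of \<rho> "- \<gamma>" \<beta>] g rho b rb by (simp add: pairing_comm)
    moreover have "pair_sign \<rho> \<beta> \<gamma> = N (\<gamma> - \<rho>) \<rho> * N (\<rho> - \<gamma>) \<beta>"
      by (rule pair_sign_altdef[OF rho b(1) rb(1) gc])
    moreover have "N (\<gamma> - \<rho>) \<rho> = N \<rho> (- \<gamma>)"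
      using N_rotate[of "\<gamma> - \<rho>" \<rho> "- \<gamma>"] diff_root g rho by simp
    moreover have "N \<rho> (\<beta> - \<gamma>) * N \<rho> (\<beta> - \<gamma>) = 1"
      using N_square[of \<rho> "\<beta> - \<gamma>"] rho d rb g by (simp add: pairing_comm)
    moreover have "N \<gamma> (\<beta> - \<gamma>) = N (- \<gamma>) \<beta>"
      using N_opposite_third(3)[of \<beta> \<gamma>] g b by (simp add: pairing_comm)
    ultimately show ?thesis unfolding i by algebra
  qed
  have shift_root: "\<gamma> - \<rho> \<in> \<Phi>" if "\<gamma> \<in> common \<rho> \<beta>" for \<gamma>
    using shift[OF that] by (simp add: common_def)
  have sign2: "pair_sign \<rho> \<beta> \<gamma> * N \<rho> (\<gamma> - \<rho>) * N \<rho> (?c \<gamma> - \<rho>) = - pair_sign (- \<rho>) \<beta> (\<gamma> - \<rho>)"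
    if gc: "\<gamma> \<in> common \<rho> \<beta>" for \<gamma>
  proof -
    note g = pt[OF gc]
    have d: "\<beta> - \<gamma> \<in> \<Phi>" using diff_root g b by (simp add: pairing_comm)
    have "pair_sign (- \<rho>) \<beta> (\<gamma> - \<rho>) = N (- \<rho>) (- (\<gamma> - \<rho>)) * N \<beta> (- (\<beta> - \<gamma>))"
      by (simp add: pair_sign_def)
    moreover have "N (- \<rho>) (- (\<gamma> - \<rho>)) = - N \<rho> (\<gamma> - \<rho>)"
      by (rule N_minus) (use g rho shift_root[OF gc] in \<open>simp_all add: pairing_comm\<close>)
    moreover have "N \<beta> (- (\<beta> - \<gamma>)) = N (- \<gamma>) \<beta>"
      using N_rotate[of "- \<gamma>" \<beta> "- (\<beta> - \<gamma>)"] g b d minus_root_iff[of "\<beta> - \<gamma>"] by simp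
    moreover have "N \<gamma> (\<beta> - \<gamma>) = N (- \<gamma>) \<beta>"
      using N_opposite_third(3)[of \<beta> \<gamma>] g b by (simp add: pairing_comm)
    ultimately show ?thesis using sign1[OF gc] by algebra
  qed
  define S where "S = (\<lambda>\<gamma>. of_int (pair_sign \<rho> \<beta> \<gamma>) * (u \<gamma> * u (?c \<gamma>)))"
  define T where "T = (\<lambda>\<gamma>. of_int (N \<gamma> (\<beta> - \<gamma>)) * (u \<gamma> * u (\<beta> - \<gamma>)))"
  define Q where "Q = (\<lambda>\<gamma>. of_int (pair_sign (- \<rho>) \<beta> \<gamma>) * (u \<gamma> * u (- \<rho> + \<beta> - \<gamma>)))"
  have summand: "of_int (pair_sign \<rho> \<beta> \<gamma>) * (w \<gamma> * w (?c \<gamma>))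
     = S \<gamma> + \<xi> * (T \<gamma> + T (?c \<gamma>)) - \<xi>\<^sup>2 * Q (\<gamma> - \<rho>)" if gc: "\<gamma> \<in> common \<rho> \<beta>" for \<gamma>
  proof -
    have 1: "?c \<gamma> - \<rho> = \<beta> - \<gamma>" "?c (?c \<gamma>) = \<gamma>" "\<beta> - ?c \<gamma> = \<gamma> - \<rho>" "- \<rho> + \<beta> - (\<gamma> - \<rho>) = \<beta> - \<gamma>"
      by simp_all
    have expand: "s * ((a + n * \<xi> * a') * (d + m * \<xi> * d')) =
        s * (a * d) + \<xi> * ((s * m) * (a * d') + (s * n) * (d * a')) + \<xi>\<^sup>2 * ((s * n * m) * (a' * d'))"
      for s a n a' d m d' :: 'r
      by (simp add: algebra_simps power2_eq_square)
    have e: "of_int (pair_sign \<rho> \<beta> \<gamma>) * of_int (N \<rho> (\<beta> - \<gamma>)) = (of_int (N \<gamma> (\<beta> - \<gamma>)) :: 'r)"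
      "of_int (pair_sign \<rho> \<beta> \<gamma>) * of_int (N \<rho> (\<gamma> - \<rho>)) = (of_int (N (?c \<gamma>) (\<gamma> - \<rho>)) :: 'r)"
      "of_int (pair_sign \<rho> \<beta> \<gamma>) * of_int (N \<rho> (\<gamma> - \<rho>)) * of_int (N \<rho> (\<beta> - \<gamma>))
        = (- of_int (pair_sign (- \<rho>) \<beta> (\<gamma> - \<rho>)) :: 'r)"
      using sign1[OF gc] sign1[OF pt(4)[OF gc]] sign2[OF gc]
      unfolding 1 pair_sign_complement[OF rho b(1) rb(1) gc]
      by (simp_all flip: of_int_mult of_int_minus)
    have i: "?c \<gamma> \<star> \<rho> = 1" using pt[OF pt(4)[OF gc]] by simp
    show ?thesis
      unfolding w_one[OF pt(2)[OF gc]] w_one[OF i] 1 expand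
      unfolding e(3) unfolding e(1,2) S_def T_def Q_def 1 by simp
  qed
  have "(\<Sum>\<gamma>\<in>B. of_int (pair_sign \<rho> \<beta> \<gamma>) * (w \<gamma> * w (?c \<gamma>)))
     = (\<Sum>\<gamma>\<in>B. S \<gamma> + \<xi> * (T \<gamma> + T (?c \<gamma>)) - \<xi>\<^sup>2 * Q (\<gamma> - \<rho>))"
    by (rule sum.cong[OF refl summand]) (use sub in blast)
  also have "\<dots> = sum S B + \<xi> * (\<Sum>\<gamma>\<in>B. T \<gamma> + T (?c \<gamma>)) - \<xi>\<^sup>2 * (\<Sum>\<gamma>\<in>B. Q (\<gamma> - \<rho>))"
    by (simp only: sum_subtractf sum.distrib[of S] sum_distrib_left)
  also have "(\<Sum>\<gamma>\<in>B. T \<gamma> + T (?c \<gamma>)) = sum T (common \<rho> \<beta>)"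
    using sum_transversal_double[OF finite_common involution_common[OF rho b(1) rb(1)] B, of T] by simp
  also have "common \<rho> \<beta> = common \<beta> \<rho>" by (auto simp: common_def)
  also have "(\<Sum>\<gamma>\<in>B. Q (\<gamma> - \<rho>)) = sum Q B'"
    unfolding B'_def by (subst sum.reindex) (auto simp: inj_on_def)
  finally show ?thesis
    unfolding half_pi_form_eq[OF rho b(1) rb(1) B] half_pi_form_eq[OF mr b(1) rb(2) tB']
      two_thirds_form_common[OF b(1) rho b(2)] w_rho
    using w_low[of \<beta>] b(2) by (simp add: S_def T_def Q_def algebra_simps)
qed

text \<open>For \<open>\<langle>\<alpha>,\<rho>\<rangle> = \<langle>\<beta>,\<rho>\<rangle> = 1\<close> the root \<open>\<rho>\<close> itself belongs to one of the pairs and can be taken into the base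
  pair.\<close>
lemma half_pi_solved:
  assumes "solves u h" and ab: "\<alpha> \<in> \<Phi>" "\<beta> \<in> \<Phi>" "\<alpha> \<star> \<beta> = 0"
  shows "half_pi_form w \<alpha> \<beta> = 0"
proof -
  have f: "half_pi_form u \<gamma> \<delta> = 0" and g: "two_thirds_form u h \<gamma> \<delta> = 0"
    if "\<gamma> \<in> \<Phi>" "\<delta> \<in> \<Phi>" "\<gamma> \<star> \<delta> = 0" for \<gamma> \<delta>
    using assms(1) that by (auto simp: solves_def)
  have f_two: "half_pi_form w \<rho> \<delta> = 0" if "\<delta> \<in> \<Phi>" "\<rho> \<star> \<delta> = 0" for \<delta>
    using half_pi_two_base[of \<delta>] f[of \<rho> \<delta>] f[of "- \<rho>" \<delta>] g[of \<delta> \<rho>] that rho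
    by (simp add: pairing_comm)
  have f_one: "half_pi_form w \<gamma> \<delta> = 0"
    if "\<gamma> \<in> \<Phi>" "\<delta> \<in> \<Phi>" "\<gamma> \<star> \<delta> = 0" "\<gamma> \<star> \<rho> = 1" "\<delta> \<star> \<rho> = 0" for \<gamma> \<delta>
    using half_pi_one[OF that] f[of \<gamma> \<delta>] f[of "\<gamma> - \<rho>" \<delta>] that rho diff_root
    by (simp add: pairing_comm)
  have swap: "half_pi_form w \<beta> \<alpha> = half_pi_form w \<alpha> \<beta>" by (rule half_pi_form_commute[OF ab])
  consider (low) "\<alpha> \<star> \<rho> + \<beta> \<star> \<rho> < 0" | (zero) "\<alpha> \<star> \<rho> + \<beta> \<star> \<rho> = 0"
    | (one) "\<alpha> \<star> \<rho> = 1" "\<beta> \<star> \<rho> = 0" | (one') "\<beta> \<star> \<rho> = 1" "\<alpha> \<star> \<rho> = 0"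
    | (two) "\<alpha> = \<rho>" | (two') "\<beta> = \<rho>" | (both) "\<alpha> \<star> \<rho> = 1" "\<beta> \<star> \<rho> = 1"
  proof (cases rule: rho_cases[OF ab(1)]; cases rule: rho_cases[OF ab(2)])
  qed (use that ab rho in auto)
  then show ?thesis
  proof cases
    case low
    then show ?thesis using half_pi_low f ab by simp
  next
    case zero
    then show ?thesis using half_pi_zero f ab by simp
  next
    case one
    then show ?thesis using f_one ab by blast
  next
    case one'
    then show ?thesis using f_one[of \<beta> \<alpha>] swap ab by (simp add: pairing_comm)
  next
    case two
    then show ?thesis using f_two ab by blast
  next
    case two'
    then show ?thesis using f_two[of \<alpha>] swap ab by (simp add: pairing_comm)
  next
    case both
    have rc: "\<rho> \<in> common \<alpha> \<beta>" using both rho by (simp add: common_def pairing_comm)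
    have "\<alpha> + \<beta> - \<rho> \<in> \<Phi>" using complement_root[OF ab rc] by (simp add: common_def)
    then have "half_pi_form w \<rho> (\<alpha> + \<beta> - \<rho>) = 0"
      using f_two both rho by (simp add: pairing_comm)
    then show ?thesis using half_pi_form_base_change[OF ab rc, of w] by simp
  qed
qed

section \<open>The second family of forms under a root unipotent\<close>

lemma acute_facts:
  assumes "\<alpha> \<in> \<Phi>" "\<gamma> \<in> acute \<alpha>"
  shows "\<gamma> \<in> \<Phi>" "\<gamma> \<star> \<alpha> = 1" "\<alpha> \<star> \<gamma> = 1" "\<alpha> - \<gamma> \<in> \<Phi>" "\<alpha> - \<gamma> \<in> acute \<alpha>" "(\<alpha> - \<gamma>) \<star> \<alpha> = 1"
    "(\<alpha> - \<gamma>) \<star> \<gamma> = -1" "\<gamma> \<star> \<rho> + (\<alpha> - \<gamma>) \<star> \<rho> = \<alpha> \<star> \<rho>"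
  using assms acute_diff[OF assms] by (auto simp: acute_def pairing_comm)

lemma two_thirds_minus_two:
  assumes b: "\<beta> \<in> \<Phi>" "\<beta> \<star> \<rho> = 0"
  shows "two_thirds_form w h' (- \<rho>) \<beta> = two_thirds_form u h (- \<rho>) \<beta>"
proof -
  have mr: "- \<rho> \<in> \<Phi>" "(- \<rho>) \<star> \<beta> = 0" using rho b by (simp_all add: pairing_comm)
  obtain B where B: "root_transversal (- \<rho>) B"
    using acute_transversal[OF mr(1), of "\<lambda>_. 0"] by blast
  then have sub: "B \<subseteq> acute (- \<rho>)" by (simp add: transversal_def)
  have "w \<gamma> * w (- \<rho> - \<gamma>) = u \<gamma> * u (- \<rho> - \<gamma>)" if "\<gamma> \<in> B" for \<gamma>
    using acute_facts[OF mr(1), of \<gamma>] sub that w_low[of \<gamma>] w_low[of "- \<rho> - \<gamma>"] rho by auto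
  moreover have "cartan_int \<beta> \<rho> = 0" using cartan_int_eqI[OF b(1) rho, of 0] b by simp
  ultimately show ?thesis
    using w_low[of "- \<rho>"] rho
    by (simp add: two_thirds_form_eq[OF mr(1) b(1) mr(2) B] unipotent_zero_def)
qed

text \<open>The change of \<open>h \<beta>\<close> is cancelled by the only summand that moves, the pair \<open>\<alpha> + \<rho>\<close>, \<open>-\<rho>\<close>.\<close>
lemma two_thirds_minus_one:
  assumes ab: "\<alpha> \<in> \<Phi>" "\<beta> \<in> \<Phi>" "\<alpha> \<star> \<beta> = 0" and ar: "\<alpha> \<star> \<rho> = -1"
  shows "two_thirds_form w h' \<alpha> \<beta> = two_thirds_form u h \<alpha> \<beta>"
proof -
  define B where "B = {\<gamma> \<in> acute \<alpha>. \<gamma> \<star> \<rho> \<ge> 0}"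
  have split: "\<gamma> \<star> \<rho> = -1 \<and> \<delta> \<star> \<rho> = 0 \<or> \<gamma> \<star> \<rho> = 0 \<and> \<delta> \<star> \<rho> = -1
      \<or> \<gamma> \<star> \<rho> = 1 \<and> \<delta> \<star> \<rho> = -2 \<and> \<delta> = - \<rho> \<or> \<gamma> \<star> \<rho> = -2 \<and> \<delta> \<star> \<rho> = 1"
    if "\<gamma> \<in> \<Phi>" "\<delta> \<in> \<Phi>" "\<gamma> \<star> \<rho> + \<delta> \<star> \<rho> = -1" for \<gamma> \<delta>
    using that(3)
  proof (cases rule: rho_cases[OF that(1)]; cases rule: rho_cases[OF that(2)])
  qed auto
  note nf = acute_facts[OF ab(1)]
  have sp: "\<gamma> \<star> \<rho> = -1 \<and> (\<alpha> - \<gamma>) \<star> \<rho> = 0 \<or> \<gamma> \<star> \<rho> = 0 \<and> (\<alpha> - \<gamma>) \<star> \<rho> = -1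
      \<or> \<gamma> \<star> \<rho> = 1 \<and> (\<alpha> - \<gamma>) \<star> \<rho> = -2 \<and> \<alpha> - \<gamma> = - \<rho> \<or> \<gamma> \<star> \<rho> = -2 \<and> (\<alpha> - \<gamma>) \<star> \<rho> = 1"
    if "\<gamma> \<in> acute \<alpha>" for \<gamma>
    by (rule split) (use nf(1,4,8)[OF that] ar in auto)
  have tB: "root_transversal \<alpha> B"
    unfolding transversal_def
  proof (intro conjI ballI)
    fix \<gamma> assume g: "\<gamma> \<in> acute \<alpha>"
    show "\<gamma> \<in> B \<longleftrightarrow> \<alpha> - \<gamma> \<notin> B" using sp[OF g] nf(5)[OF g] g unfolding B_def by force
  qed (simp add: B_def)
  have fin: "finite B" by (simp add: B_def finite_acute)
  have aR: "\<alpha> + \<rho> \<in> \<Phi>" using add_root ab rho ar by blast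
  have aB: "\<alpha> + \<rho> \<in> B" using aR ar ab rho by (simp add: B_def acute_def pairing_comm)
  have rest: "w \<gamma> * w (\<alpha> - \<gamma>) = u \<gamma> * u (\<alpha> - \<gamma>)" if "\<gamma> \<in> B - {\<alpha> + \<rho>}" for \<gamma>
  proof -
    have g: "\<gamma> \<in> acute \<alpha>" "\<gamma> \<star> \<rho> \<ge> 0" "\<gamma> \<noteq> \<alpha> + \<rho>" using that by (auto simp: B_def)
    then have "\<alpha> - \<gamma> \<noteq> - \<rho>" by (auto simp: algebra_simps)
    then show ?thesis using sp[OF g(1)] g w_low[of \<gamma>] w_low[of "\<alpha> - \<gamma>"] by force
  qed
  define n where "n = cartan_int \<beta> \<rho>"
  define F where "F = (\<lambda>v \<gamma>. of_int (cartan_int \<gamma> \<beta> * N \<gamma> (\<alpha> - \<gamma>)) * (v \<gamma> * v (\<alpha> - \<gamma>)) :: 'r)"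
  have "sum (F w) B = F w (\<alpha> + \<rho>) + sum (F w) (B - {\<alpha> + \<rho>})" by (rule sum.remove[OF fin aB])
  also have "sum (F w) (B - {\<alpha> + \<rho>}) = sum (F u) (B - {\<alpha> + \<rho>})"
    by (rule sum.cong) (simp_all only: F_def rest)
  also have "F w (\<alpha> + \<rho>) = F u (\<alpha> + \<rho>) - of_int n * \<xi> * (u \<alpha> * u (- \<rho>))"
  proof -
    have "cartan_int (\<alpha> + \<rho>) \<beta> = n"
      by (rule cartan_int_eqI)
        (use aR ab rho cartan_int_root[OF ab(2) rho] in \<open>simp_all add: n_def pairing_comm\<close>)
    moreover have "N (\<alpha> + \<rho>) (- \<rho>) = - N \<rho> \<alpha>"
      using N_rotate[of "- \<alpha>" "\<alpha> + \<rho>" "- \<rho>"] N_rotate[of "\<alpha> + \<rho>" "- \<rho>" "- \<alpha>"]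
        N_minus[of \<rho> \<alpha>] aR ab rho ar by (simp add: pairing_comm)
    moreover have "N \<rho> \<alpha> * N \<rho> \<alpha> = 1" using N_square ab rho ar by (simp add: pairing_comm)
    then have "(of_int (N \<rho> \<alpha>) * of_int (N \<rho> \<alpha>) :: 'r) = 1" by (metis of_int_mult of_int_1)
    then have "of_int (N \<rho> \<alpha>) * (of_int (N \<rho> \<alpha>) * y) = y" for y :: 'r
      by (simp flip: mult.assoc)
    moreover have "w (\<alpha> + \<rho>) = u (\<alpha> + \<rho>) + of_int (N \<rho> \<alpha>) * \<xi> * u \<alpha>"
      using w_one[of "\<alpha> + \<rho>"] ar rho by simp
    moreover have "w (- \<rho>) = u (- \<rho>)" using w_low[of "- \<rho>"] rho by simp
    ultimately show ?thesis by (simp add: F_def algebra_simps)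
  qed
  also have "F u (\<alpha> + \<rho>) - of_int n * \<xi> * (u \<alpha> * u (- \<rho>)) + sum (F u) (B - {\<alpha> + \<rho>})
     = sum (F u) B - of_int n * \<xi> * (u \<alpha> * u (- \<rho>))"
    using sum.remove[OF fin aB, of "F u"] by simp
  finally show ?thesis
    using w_low[of \<alpha>] ar unfolding two_thirds_form_eq[OF ab tB] unipotent_zero_def
    by (simp add: F_def n_def algebra_simps)
qed

text \<open>The moved summands run over the roots \<open>\<eta> = \<alpha> - \<gamma>\<close> with \<open>\<langle>\<eta>,\<alpha>\<rangle> = 1\<close>, \<open>\<langle>\<eta>,\<rho>\<rangle> = -1\<close>, weighted by \<open>\<langle>\<eta>,\<beta>\<rangle>\<close>. The
  involution \<open>\<eta> \<mapsto> \<zeta> = \<alpha> - \<rho> - \<eta>\<close> preserves the rest of the summand and \<open>\<langle>\<eta>,\<beta>\<rangle> + \<langle>\<zeta>,\<beta>\<rangle> = -n\<close>, so collecting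
  pairs produces \<open>n\<close> times the sum in \<open>f(\<alpha>,-\<rho>)\<close>.\<close>
lemma two_thirds_zero:
  assumes ab: "\<alpha> \<in> \<Phi>" "\<beta> \<in> \<Phi>" "\<alpha> \<star> \<beta> = 0" and ar: "\<alpha> \<star> \<rho> = 0"
  shows "two_thirds_form w h' \<alpha> \<beta> = two_thirds_form u h \<alpha> \<beta>
    + of_int (cartan_int \<beta> \<rho>) * \<xi> * half_pi_form u \<alpha> (- \<rho>)"
proof -
  note nf = acute_facts[OF ab(1)]
  have mr: "- \<rho> \<in> \<Phi>" "\<alpha> \<star> (- \<rho>) = 0" using rho ar by simp_all
  obtain C where C: "pair_transversal \<alpha> (- \<rho>) C"
    using common_transversal[OF ab(1) mr, of "\<lambda>_. 0"] by blast
  obtain B where B: "root_transversal \<alpha> B"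
    "\<And>\<gamma>. \<gamma> \<in> acute \<alpha> \<Longrightarrow> (\<alpha> - \<gamma>) \<star> \<rho> < \<gamma> \<star> \<rho> \<Longrightarrow> \<gamma> \<in> B"
    using acute_transversal[OF ab(1), of "\<lambda>\<gamma>. \<gamma> \<star> \<rho>"] by blast
  have fin: "finite B" using transversal_finite[OF B(1) finite_acute] .
  define B1 where "B1 = common \<alpha> \<rho>"
  have B1: "B1 \<subseteq> B" using B(2) ar by (auto simp: B1_def common_def acute_def)
  have cases: "\<gamma> \<star> \<rho> = 0 \<or> \<gamma> \<in> B1" if "\<gamma> \<in> B" for \<gamma>
  proof -
    have g: "\<gamma> \<in> acute \<alpha>" "\<alpha> - \<gamma> \<notin> B" using that B(1) by (auto simp: transversal_def)
    show ?thesis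
    proof (cases rule: rho_cases[OF nf(1)[OF g(1)]])
      case 2
      then have "\<alpha> - \<gamma> \<in> B" using B(2)[OF nf(5)[OF g(1)]] ar by simp
      then show ?thesis using g by blast
    next
      case 4
      then show ?thesis using nf[OF g(1)] by (simp add: B1_def common_def)
    qed (use nf[OF g(1)] ar rho in \<open>auto simp: pairing_comm\<close>)
  qed
  define F where "F = (\<lambda>v \<gamma>. of_int (cartan_int \<gamma> \<beta> * N \<gamma> (\<alpha> - \<gamma>)) * (v \<gamma> * v (\<alpha> - \<gamma>)) :: 'r)"
  define K where "K = (\<lambda>\<gamma>. of_int (cartan_int \<gamma> \<beta> * N \<gamma> (\<alpha> - \<gamma>) * N \<rho> (\<gamma> - \<rho>)) *
      (u (\<gamma> - \<rho>) * u (\<alpha> - \<gamma>)) :: 'r)"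
  define P where "P = (\<lambda>\<eta>. of_int (pair_sign \<alpha> (- \<rho>) \<eta>) * (u \<eta> * u (\<alpha> + - \<rho> - \<eta>)) :: 'r)"
  define n where "n = cartan_int \<beta> \<rho>"
  have "F w \<gamma> = F u \<gamma> + (if \<gamma> \<in> B1 then \<xi> * K \<gamma> else 0)" if "\<gamma> \<in> B" for \<gamma>
  proof (cases "\<gamma> \<in> B1")
    case True
    then have g: "\<gamma> \<star> \<rho> = 1" by (simp add: B1_def common_def)
    moreover have "(\<alpha> - \<gamma>) \<star> \<rho> \<le> 0" using g ar by simp
    ultimately have "w \<gamma> = u \<gamma> + of_int (N \<rho> (\<gamma> - \<rho>)) * \<xi> * u (\<gamma> - \<rho>)" "w (\<alpha> - \<gamma>) = u (\<alpha> - \<gamma>)"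
      using w_one w_low by blast+
    then show ?thesis using True by (simp add: F_def K_def algebra_simps)
  next
    case False
    then have "\<gamma> \<star> \<rho> = 0" using cases that by blast
    then have "w \<gamma> = u \<gamma>" "w (\<alpha> - \<gamma>) = u (\<alpha> - \<gamma>)" using w_low ar by simp_all
    then show ?thesis using False by (simp add: F_def)
  qed
  then have "sum (F w) B = (\<Sum>\<gamma>\<in>B. F u \<gamma> + (if \<gamma> \<in> B1 then \<xi> * K \<gamma> else 0))"
    by (rule sum.cong[OF refl])
  also have "\<dots> = sum (F u) B + (\<Sum>\<gamma>\<in>B. if \<gamma> \<in> B1 then \<xi> * K \<gamma> else 0)"
    by (rule sum.distrib)
  also have "(\<Sum>\<gamma>\<in>B. if \<gamma> \<in> B1 then \<xi> * K \<gamma> else 0) = (\<Sum>\<gamma>\<in>B1. \<xi> * K \<gamma>)"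
    using B1 by (simp add: sum.inter_restrict[OF fin, symmetric] Int_absorb1)
  also have "\<dots> = \<xi> * sum K B1" by (simp add: sum_distrib_left)
  also have "sum K B1 = (\<Sum>\<eta>\<in>common \<alpha> (- \<rho>). of_int (cartan_int \<eta> \<beta>) * P \<eta>)"
  proof (rule sum.reindex_bij_witness[where i = "\<lambda>\<eta>. \<alpha> - \<eta>" and j = "\<lambda>\<gamma>. \<alpha> - \<gamma>"])
    fix \<gamma> assume "\<gamma> \<in> B1"
    then have gn: "\<gamma> \<in> acute \<alpha>" and g: "\<gamma> \<star> \<rho> = 1" by (auto simp: B1_def common_def acute_def)
    show ac: "\<alpha> - \<gamma> \<in> common \<alpha> (- \<rho>)" using nf[OF gn] g ar by (simp add: common_def)
    have gR: "\<gamma> - \<rho> \<in> \<Phi>" using diff_root nf(1)[OF gn] rho g by blast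
    have "cartan_int \<alpha> \<beta> = 0" using cartan_int_eqI[OF ab(1,2), of 0] ab by simp
    then have c: "cartan_int (\<alpha> - \<gamma>) \<beta> = - cartan_int \<gamma> \<beta>"
      using cartan_int_diff[of \<alpha> \<gamma> \<beta>] nf[OF gn] ab by simp
    have i: "\<alpha> + - \<rho> - (\<alpha> - \<gamma>) = \<gamma> - \<rho>" by simp
    have "N \<alpha> (- (\<alpha> - \<gamma>)) = - N (\<alpha> - \<gamma>) \<gamma>"
      using N_opposite_third(2)[of \<alpha> "\<alpha> - \<gamma>"] nf[OF gn] ab by (simp add: pairing_comm)
    moreover have "N (\<alpha> - \<gamma>) \<gamma> = - N \<gamma> (\<alpha> - \<gamma>)"
      using N_anti[of \<gamma> "\<alpha> - \<gamma>"] nf[OF gn] ab by simp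
    moreover have "N (- \<rho>) (- (\<gamma> - \<rho>)) = - N \<rho> (\<gamma> - \<rho>)"
      by (rule N_minus) (use rho gR g in \<open>simp_all add: pairing_comm\<close>)
    ultimately have "pair_sign \<alpha> (- \<rho>) (\<alpha> - \<gamma>) = - (N \<gamma> (\<alpha> - \<gamma>) * N \<rho> (\<gamma> - \<rho>))"
      unfolding pair_sign_def i by simp
    then show "of_int (cartan_int (\<alpha> - \<gamma>) \<beta>) * P (\<alpha> - \<gamma>) = K \<gamma>"
      unfolding P_def K_def i c by (simp add: algebra_simps)
  next
    fix \<eta> assume "\<eta> \<in> common \<alpha> (- \<rho>)"
    then have en: "\<eta> \<in> acute \<alpha>" and e: "\<eta> \<star> \<rho> = -1" by (auto simp: common_def acute_def)
    show "\<alpha> - \<eta> \<in> B1" using nf[OF en] e ar by (simp add: B1_def common_def)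
  qed simp_all
  also have "(\<Sum>\<eta>\<in>common \<alpha> (- \<rho>). of_int (cartan_int \<eta> \<beta>) * P \<eta>)
     = (\<Sum>\<eta>\<in>C. of_int (cartan_int \<eta> \<beta>) * P \<eta>
         + of_int (cartan_int (\<alpha> + - \<rho> - \<eta>) \<beta>) * P (\<alpha> + - \<rho> - \<eta>))"
    by (rule sum_transversal_double[OF finite_common involution_common[OF ab(1) mr] C])
  also have "\<dots> = (\<Sum>\<eta>\<in>C. - of_int n * P \<eta>)"
  proof (rule sum.cong[OF refl])
    fix \<eta> assume "\<eta> \<in> C"
    then have e: "\<eta> \<in> common \<alpha> (- \<rho>)" using C by (auto simp: transversal_def)
    have r: "\<eta> \<in> \<Phi>" "\<alpha> + - \<rho> - \<eta> \<in> \<Phi>"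
      using e complement_root[OF ab(1) mr e] by (auto simp: common_def)
    have "cartan_int (\<alpha> + - \<rho> - \<eta>) \<beta> = - n - cartan_int \<eta> \<beta>"
      by (rule cartan_int_eqI[OF r(2) ab(2)])
        (use r ab rho in \<open>simp add: n_def cartan_int_root pairing_comm\<close>)
    moreover have "P (\<alpha> + - \<rho> - \<eta>) = P \<eta>"
      unfolding P_def pair_sign_complement[OF ab(1) mr e] by (simp add: mult.commute)
    ultimately show "of_int (cartan_int \<eta> \<beta>) * P \<eta>
         + of_int (cartan_int (\<alpha> + - \<rho> - \<eta>) \<beta>) * P (\<alpha> + - \<rho> - \<eta>) = - of_int n * P \<eta>"
      by (simp only: of_int_diff of_int_minus) (simp add: left_diff_distrib)
  qed
  also have "\<dots> = - of_int n * sum P C" by (simp only: sum_distrib_left)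
  finally have "sum (F w) B = sum (F u) B + \<xi> * (- of_int n * sum P C)" .
  then show ?thesis
    unfolding two_thirds_form_eq[OF ab B(1)] half_pi_form_eq[OF ab(1) mr C] unipotent_zero_def
    using w_low[of \<alpha>] ar by (simp add: F_def P_def n_def algebra_simps)
qed

text \<open>The reflected root \<open>\<beta>' = \<beta> - n\<rho>\<close> satisfies \<open>\<langle>\<gamma>-\<rho>,\<beta>'\<rangle> = \<langle>\<gamma>,\<beta>\<rangle>\<close> when \<open>\<langle>\<gamma>,\<rho>\<rangle> = 1\<close>, so moved summands match with
  the same coefficient. The pair \<open>\<rho>, \<alpha> - \<rho>\<close> supplies the term \<open>-n h \<rho>\<close> that turns \<open>h \<beta>\<close> into \<open>h \<beta>'\<close>, and its
  contribution of degree 2 in \<open>\<xi>\<close> cancels against that of \<open>u \<alpha> h \<beta>\<close>. The pair \<open>-\<rho>, \<alpha>\<close> of the new form comes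
  from the change of \<open>h \<beta>\<close>.\<close>
lemma two_thirds_one:
  assumes ab: "\<alpha> \<in> \<Phi>" "\<beta> \<in> \<Phi>" "\<alpha> \<star> \<beta> = 0" and ar: "\<alpha> \<star> \<rho> = 1"
  defines "\<beta>' \<equiv> \<beta> - (\<beta> \<star> \<rho>) *\<^sub>R \<rho>"
  shows "two_thirds_form w h' \<alpha> \<beta> = two_thirds_form u h \<alpha> \<beta>
    + of_int (N \<rho> (\<alpha> - \<rho>)) * \<xi> * two_thirds_form u h (\<alpha> - \<rho>) \<beta>'"
proof -
  have aR: "\<alpha> - \<rho> \<in> \<Phi>" using diff_root ab rho ar by blast
  have b': "\<beta>' \<in> \<Phi>" unfolding \<beta>'_def by (rule reflection[OF rho ab(2)])
  have ortho': "(\<alpha> - \<rho>) \<star> \<beta>' = 0" using ab ar rho by (simp add: \<beta>'_def pairing_comm)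
  note nf = acute_facts[OF ab(1)] and nf' = acute_facts[OF aR]
  define B1 where "B1 = {\<gamma> \<in> acute \<alpha>. \<gamma> \<star> \<rho> = 1}"
  define B1' where "B1' = (\<lambda>\<gamma>. \<gamma> - \<rho>) ` B1"
  have split: "\<gamma> \<star> \<rho> = 1 \<and> \<delta> \<star> \<rho> = 0 \<or> \<gamma> \<star> \<rho> = 0 \<and> \<delta> \<star> \<rho> = 1
      \<or> \<gamma> = \<rho> \<and> \<delta> \<star> \<rho> = -1 \<and> \<delta> \<noteq> \<rho> \<or> \<gamma> \<star> \<rho> = -1 \<and> \<delta> = \<rho> \<and> \<gamma> \<noteq> \<rho>"
    if "\<gamma> \<in> \<Phi>" "\<delta> \<in> \<Phi>" "\<gamma> \<star> \<rho> + \<delta> \<star> \<rho> = 1" for \<gamma> \<delta>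
    using that(3)
  proof (cases rule: rho_cases[OF that(1)]; cases rule: rho_cases[OF that(2)])
  qed auto
  have rr: "\<rho> \<star> \<rho> = 2" using rho by simp
  have tB: "root_transversal \<alpha> (insert \<rho> B1)"
    unfolding transversal_def
  proof (intro conjI ballI)
    show "insert \<rho> B1 \<subseteq> acute \<alpha>" using rho ar by (auto simp: B1_def acute_def pairing_comm)
    fix \<gamma> assume g: "\<gamma> \<in> acute \<alpha>"
    have "\<gamma> \<star> \<rho> + (\<alpha> - \<gamma>) \<star> \<rho> = 1" using ar by simp
    from split[OF nf(1,4)[OF g] this]
    show "\<gamma> \<in> insert \<rho> B1 \<longleftrightarrow> \<alpha> - \<gamma> \<notin> insert \<rho> B1"
      using g nf(5)[OF g] rr unfolding B1_def by force
  qed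
  have memB1': "\<eta> \<in> B1' \<longleftrightarrow> \<eta> \<in> acute (\<alpha> - \<rho>) \<and> \<eta> \<star> \<rho> = -1" for \<eta>
  proof
    assume "\<eta> \<in> B1'"
    then obtain \<gamma> where g: "\<gamma> \<in> acute \<alpha>" "\<gamma> \<star> \<rho> = 1" "\<eta> = \<gamma> - \<rho>" by (auto simp: B1_def B1'_def)
    then show "\<eta> \<in> acute (\<alpha> - \<rho>) \<and> \<eta> \<star> \<rho> = -1"
      using nf[OF g(1)] ar rho diff_root by (simp add: acute_def pairing_comm)
  next
    assume e: "\<eta> \<in> acute (\<alpha> - \<rho>) \<and> \<eta> \<star> \<rho> = -1"
    then have "\<eta> + \<rho> \<in> B1"
      using add_root[of \<eta> \<rho>] rho ar by (simp add: B1_def acute_def pairing_comm)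
    then show "\<eta> \<in> B1'" unfolding B1'_def by (rule rev_image_eqI) simp
  qed
  have tB': "root_transversal (\<alpha> - \<rho>) (insert (- \<rho>) B1')"
    unfolding transversal_def
  proof (intro conjI ballI)
    show "insert (- \<rho>) B1' \<subseteq> acute (\<alpha> - \<rho>)"
      using memB1' rho ar by (auto simp: acute_def pairing_comm)
    fix \<eta> assume e: "\<eta> \<in> acute (\<alpha> - \<rho>)"
    \<comment> \<open>Negating both members reduces the possible values on \<open>\<rho>\<close> to those listed in \<open>split\<close>.\<close>
    have m: "- \<eta> \<in> \<Phi>" "- (\<alpha> - \<rho> - \<eta>) \<in> \<Phi>" using nf'(1,4)[OF e] by (simp_all only: minus_root_iff)
    have "(- \<eta>) \<star> \<rho> + (- (\<alpha> - \<rho> - \<eta>)) \<star> \<rho> = 1" using ar rho by simp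
    from split[OF m this]
    show "\<eta> \<in> insert (- \<rho>) B1' \<longleftrightarrow> \<alpha> - \<rho> - \<eta> \<notin> insert (- \<rho>) B1'"
      using nf'(5)[OF e] e rr memB1'[of \<eta>] memB1'[of "\<alpha> - \<rho> - \<eta>"]
        minus_equation_iff[of \<eta> \<rho>] minus_equation_iff[of "\<alpha> - \<rho> - \<eta>" \<rho>]
        pairing_simps(5)[of \<eta> \<rho>] pairing_simps(5)[of "\<alpha> - \<rho> - \<eta>" \<rho>]
      by (smt (verit) insert_iff)
  qed
  have fin: "finite B1" "finite B1'" by (simp_all add: B1_def B1'_def finite_acute)
  have notin: "\<rho> \<notin> B1" "- \<rho> \<notin> B1'" using memB1' rr by (auto simp: B1_def)
  define n where "n = cartan_int \<beta> \<rho>"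
  define N0 where "N0 = (of_int (N \<rho> (\<alpha> - \<rho>)) :: 'r)"
  have N0_square: "N0 * N0 = 1"
    unfolding N0_def of_int_mult[symmetric] N_opposite_third(4)[OF ab(1) rho ar] by simp
  have N0_opp: "of_int (N (- \<rho>) \<alpha>) = N0"
    using N_opposite_third(3)[OF ab(1) rho ar] by (simp add: N0_def)
  define F where "F = (\<lambda>v \<gamma>. of_int (cartan_int \<gamma> \<beta> * N \<gamma> (\<alpha> - \<gamma>)) * (v \<gamma> * v (\<alpha> - \<gamma>)) :: 'r)"
  define F' where "F' = (\<lambda>\<eta>. of_int (cartan_int \<eta> \<beta>' * N \<eta> (\<alpha> - \<rho> - \<eta>)) * (u \<eta> * u (\<alpha> - \<rho> - \<eta>)) :: 'r)"
  have summand: "F w \<gamma> = F u \<gamma> + N0 * \<xi> * F' (\<gamma> - \<rho>)" if "\<gamma> \<in> B1" for \<gamma>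
  proof -
    have gn: "\<gamma> \<in> acute \<alpha>" and gr: "\<gamma> \<star> \<rho> = 1" using that by (auto simp: B1_def)
    note g = nf[OF gn]
    have gR: "\<gamma> - \<rho> \<in> \<Phi>" using diff_root g rho gr by blast
    have low: "(\<alpha> - \<gamma>) \<star> \<rho> \<le> 0" using gr ar by simp
    have i: "\<alpha> - \<rho> - (\<gamma> - \<rho>) = \<alpha> - \<gamma>" by simp
    have c: "cartan_int (\<gamma> - \<rho>) \<beta>' = cartan_int \<gamma> \<beta>"
      by (rule cartan_int_eqI[OF gR b'])
        (use g gr rho ab in \<open>simp add: cartan_int_root \<beta>'_def algebra_simps pairing_comm\<close>)
    have "N \<rho> (\<gamma> - \<rho>) * N (\<rho> + (\<gamma> - \<rho>)) (\<alpha> - \<gamma>) = N (\<gamma> - \<rho>) (\<alpha> - \<gamma>) * N \<rho> (\<gamma> - \<rho> + (\<alpha> - \<gamma>))"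
      by (rule N_cocycle[OF rho gR g(4)]) (use g gr ar rho in \<open>simp_all add: pairing_comm\<close>)
    then have "N \<gamma> (\<alpha> - \<gamma>) * N \<rho> (\<gamma> - \<rho>) = N \<rho> (\<alpha> - \<rho>) * N (\<gamma> - \<rho>) (\<alpha> - \<gamma>)"
      by (simp add: mult.commute)
    then have "(of_int (N \<gamma> (\<alpha> - \<gamma>)) * of_int (N \<rho> (\<gamma> - \<rho>)) :: 'r) = N0 * of_int (N (\<gamma> - \<rho>) (\<alpha> - \<gamma>))"
      unfolding N0_def by (metis of_int_mult)
    moreover have "c * p * ((a + q * \<xi> * b) * d) = c * p * (a * d) + m * \<xi> * (c * t * (b * d))"
      if "p * q = m * t" for c p a q b d m t :: 'r
    proof -
      have "c * p * ((a + q * \<xi> * b) * d) = c * p * (a * d) + (p * q) * (c * \<xi> * (b * d))"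
        by (simp add: algebra_simps)
      then show ?thesis unfolding that by (simp add: algebra_simps)
    qed
    ultimately show ?thesis
      unfolding F_def F'_def i c w_one[OF gr] w_low[OF low] of_int_mult by blast
  qed
  have "sum (F w) (insert \<rho> B1) = F w \<rho> + (\<Sum>\<gamma>\<in>B1. F u \<gamma> + N0 * \<xi> * F' (\<gamma> - \<rho>))"
    using fin notin by (simp add: summand)
  also have "\<dots> = F w \<rho> + sum (F u) B1 + N0 * \<xi> * (\<Sum>\<gamma>\<in>B1. F' (\<gamma> - \<rho>))"
    by (simp only: sum.distrib sum_distrib_left add.assoc)
  also have "(\<Sum>\<gamma>\<in>B1. F' (\<gamma> - \<rho>)) = sum F' B1'"
    unfolding B1'_def by (subst sum.reindex) (auto simp: inj_on_def)
  finally have 1: "sum (F w) (insert \<rho> B1) = F w \<rho> + sum (F u) B1 + N0 * \<xi> * sum F' B1'" .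
  have 2: "sum (F u) (insert \<rho> B1) = F u \<rho> + sum (F u) B1"
    using fin notin by simp
  have 3: "sum F' (insert (- \<rho>) B1') = F' (- \<rho>) + sum F' B1'"
    using fin notin by simp
  have low: "(\<alpha> - \<rho>) \<star> \<rho> \<le> 0" using ar rho by simp
  have cr: "cartan_int \<rho> \<beta> = n" using cartan_int_commute[OF rho ab(2)] by (simp add: n_def)
  have Fr: "F v \<rho> = of_int n * N0 * (v \<rho> * v (\<alpha> - \<rho>))" for v
    by (simp add: F_def N0_def cr)
  have "cartan_int (- \<rho>) \<beta>' = n"
    by (rule cartan_int_eqI) (use rho b' ab in \<open>simp_all add: \<beta>'_def n_def cartan_int_root pairing_comm\<close>)
  then have F'r: "F' (- \<rho>) = of_int n * N0 * (u (- \<rho>) * u \<alpha>)"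
    by (simp add: F'_def N0_opp)
  have hb: "h \<beta>' = h \<beta> - of_int n * h \<rho>"
    unfolding \<beta>'_def n_def by (rule h_reflection[OF ab(2)])
  have L: "two_thirds_form w h' \<alpha> \<beta> = (u \<alpha> + N0 * \<xi> * u (\<alpha> - \<rho>)) * (h \<beta> + of_int n * \<xi> * u (- \<rho>))
      + (of_int n * N0 * ((u \<rho> - \<xi> * h \<rho> - \<xi>\<^sup>2 * u (- \<rho>)) * u (\<alpha> - \<rho>)) + sum (F u) B1 + N0 * \<xi> * sum F' B1')"
    using two_thirds_form_eq[OF ab tB, of w h'] 1
    unfolding Fr w_one[OF ar] w_rho w_low[OF low] unipotent_zero_def F_def N0_def n_def
    by (simp add: cartan_int_commute[OF rho ab(2)])
  have R: "two_thirds_form u h \<alpha> \<beta> = u \<alpha> * h \<beta> + (of_int n * N0 * (u \<rho> * u (\<alpha> - \<rho>)) + sum (F u) B1)"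
    using two_thirds_form_eq[OF ab tB, of u h] 2 unfolding Fr unfolding F_def by simp
  have R': "two_thirds_form u h (\<alpha> - \<rho>) \<beta>' = u (\<alpha> - \<rho>) * (h \<beta> - of_int n * h \<rho>)
      + (of_int n * N0 * (u (- \<rho>) * u \<alpha>) + sum F' B1')"
    using two_thirds_form_eq[OF aR b' ortho' tB', of u h] 3 unfolding F'r hb unfolding F'_def by simp
  have N0_cancel: "N0 * (N0 * y) = y" for y using N0_square by (simp flip: mult.assoc)
  show ?thesis
    unfolding N0_def[symmetric] L R R'
    by (simp add: algebra_simps power2_eq_square N0_cancel)
qed

text \<open>Here the linear terms of each pair are \<open>u \<gamma> u (-\<gamma>)\<close> for its two members, with coefficients \<open>-\<langle>\<gamma>,\<beta>\<rangle>\<close>: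
  together they are the sum over all roots with \<open>\<langle>\<gamma>,\<rho>\<rangle> = 1\<close> in \<open>k(\<rho>,\<beta>)\<close>.\<close>
lemma two_thirds_two:
  assumes b: "\<beta> \<in> \<Phi>" "\<rho> \<star> \<beta> = 0"
  shows "two_thirds_form w h' \<rho> \<beta> =
    two_thirds_form u h \<rho> \<beta> - \<xi> * pi_form u h \<rho> \<beta> - \<xi>\<^sup>2 * two_thirds_form u h (- \<rho>) \<beta>"
proof -
  note nf = acute_facts[OF rho]
  have mr: "- \<rho> \<in> \<Phi>" "(- \<rho>) \<star> \<beta> = 0" using rho b by simp_all
  obtain B where B: "root_transversal \<rho> B"
    using acute_transversal[OF rho, of "\<lambda>_. 0"] by blast
  have sub: "B \<subseteq> acute \<rho>" using B by (simp add: transversal_def)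
  define B' where "B' = (\<lambda>\<gamma>. \<gamma> - \<rho>) ` B"
  have memB': "\<eta> \<in> B' \<longleftrightarrow> \<eta> + \<rho> \<in> B" for \<eta>
    unfolding B'_def by (auto intro: rev_image_eqI)
  have shift: "\<gamma> - \<rho> \<in> acute (- \<rho>)" if "\<gamma> \<in> acute \<rho>" for \<gamma>
    using that diff_root rho by (auto simp: acute_def)
  have unshift: "\<eta> + \<rho> \<in> acute \<rho>" if "\<eta> \<in> acute (- \<rho>)" for \<eta>
    using that add_root[of \<eta> \<rho>] rho by (auto simp: acute_def)
  have tB': "root_transversal (- \<rho>) B'"
    unfolding transversal_def
  proof (intro conjI ballI)
    show "B' \<subseteq> acute (- \<rho>)" using shift sub by (auto simp: B'_def)
    fix \<eta> assume "\<eta> \<in> acute (- \<rho>)"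
    then have "\<eta> + \<rho> \<in> B \<longleftrightarrow> \<rho> - (\<eta> + \<rho>) \<notin> B"
      using B unshift unfolding transversal_def by blast
    moreover have "\<rho> - (\<eta> + \<rho>) = (- \<rho> - \<eta>) + \<rho>" by simp
    ultimately show "\<eta> \<in> B' \<longleftrightarrow> - \<rho> - \<eta> \<notin> B'" by (simp only: memB')
  qed
  have cb: "cartan_int \<beta> \<rho> = 0" using cartan_int_eqI[OF b(1) rho, of 0] b by (simp add: pairing_comm)
  have cr: "cartan_int \<rho> \<beta> = 0" using cartan_int_eqI[OF rho b(1), of 0] b by simp
  define F where "F = (\<lambda>v \<gamma>. of_int (cartan_int \<gamma> \<beta> * N \<gamma> (\<rho> - \<gamma>)) * (v \<gamma> * v (\<rho> - \<gamma>)) :: 'r)"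
  define F' where "F' = (\<lambda>\<eta>. of_int (cartan_int \<eta> \<beta> * N \<eta> (- \<rho> - \<eta>)) * (u \<eta> * u (- \<rho> - \<eta>)) :: 'r)"
  define K where "K = (\<lambda>\<gamma>. of_int (cartan_int \<gamma> \<beta>) * (u \<gamma> * u (- \<gamma>)) :: 'r)"
  have summand: "F w \<gamma> = F u \<gamma> - \<xi> * (K \<gamma> + K (\<rho> - \<gamma>)) - \<xi>\<^sup>2 * F' (\<gamma> - \<rho>)" if "\<gamma> \<in> acute \<rho>" for \<gamma>
  proof -
    note g = nf[OF that]
    define \<epsilon> where "\<epsilon> = N \<gamma> (\<rho> - \<gamma>)"
    have i: "(\<rho> - \<gamma>) \<star> \<rho> = 1" "\<rho> - \<gamma> - \<rho> = - \<gamma>" "- (\<rho> - \<gamma>) = \<gamma> - \<rho>" "- \<rho> - (\<gamma> - \<rho>) = - \<gamma>"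
      using g rho by simp_all
    have gR: "\<gamma> - \<rho> \<in> \<Phi>" using diff_root g(1,2) rho by blast
    have 1: "N \<rho> (- \<gamma>) = - \<epsilon>"
      using N_opposite_third(2)[OF rho g(1,3)] by (simp add: \<epsilon>_def)
    have 2: "N \<rho> (\<gamma> - \<rho>) = \<epsilon>"
      using N_opposite_third(2)[of \<rho> "\<rho> - \<gamma>"] N_anti[of \<gamma> "\<rho> - \<gamma>"] g rho
      by (simp add: \<epsilon>_def pairing_comm)
    have 3: "N (\<gamma> - \<rho>) (- \<gamma>) = \<epsilon>"
      using N_minus[of "\<rho> - \<gamma>" \<gamma>] N_anti[of \<gamma> "\<rho> - \<gamma>"] g by (simp add: \<epsilon>_def pairing_comm)
    have "\<epsilon> * \<epsilon> = 1" using N_square[of \<gamma> "\<rho> - \<gamma>"] g by (simp add: \<epsilon>_def pairing_comm)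
    then have "(of_int \<epsilon> * of_int \<epsilon> :: 'r) = 1" by (metis of_int_mult of_int_1)
    then have cancel: "of_int \<epsilon> * (of_int \<epsilon> * y) = y" for y :: 'r by (simp flip: mult.assoc)
    have c: "cartan_int (\<rho> - \<gamma>) \<beta> = - cartan_int \<gamma> \<beta>" "cartan_int (\<gamma> - \<rho>) \<beta> = cartan_int \<gamma> \<beta>"
      using cartan_int_diff[of \<rho> \<gamma> \<beta>] cartan_int_diff[of \<gamma> \<rho> \<beta>] g gR rho b cr by simp_all
    show ?thesis
      unfolding F_def K_def F'_def w_one[OF g(2)] w_one[OF i(1)] i(2,3,4) 1 2 3 c \<epsilon>_def[symmetric]
      by (simp add: algebra_simps cancel power2_eq_square)
  qed
  have "sum (F w) B = (\<Sum>\<gamma>\<in>B. F u \<gamma> - \<xi> * (K \<gamma> + K (\<rho> - \<gamma>)) - \<xi>\<^sup>2 * F' (\<gamma> - \<rho>))"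
    by (rule sum.cong[OF refl summand]) (use sub in blast)
  also have "\<dots> = sum (F u) B - \<xi> * (\<Sum>\<gamma>\<in>B. K \<gamma> + K (\<rho> - \<gamma>)) - \<xi>\<^sup>2 * (\<Sum>\<gamma>\<in>B. F' (\<gamma> - \<rho>))"
    by (simp only: sum_subtractf sum_distrib_left)
  also have "(\<Sum>\<gamma>\<in>B. K \<gamma> + K (\<rho> - \<gamma>)) = sum K (acute \<rho>)"
    using sum_transversal_double[OF finite_acute involution_acute[OF rho] B, of K] by simp
  also have "(\<Sum>\<gamma>\<in>B. F' (\<gamma> - \<rho>)) = sum F' B'"
    unfolding B'_def by (subst sum.reindex) (auto simp: inj_on_def)
  finally have "sum (F w) B = sum (F u) B - \<xi> * sum K (acute \<rho>) - \<xi>\<^sup>2 * sum F' B'" .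
  then show ?thesis
    unfolding two_thirds_form_eq[OF rho b B] two_thirds_form_eq[OF mr(1) b(1) mr(2) tB']
      pi_form_acute[OF rho b] w_rho unipotent_zero_def cb
    by (simp add: F_def F'_def K_def algebra_simps)
qed

lemma two_thirds_solved:
  assumes "solves u h" and ab: "\<alpha> \<in> \<Phi>" "\<beta> \<in> \<Phi>" "\<alpha> \<star> \<beta> = 0"
  shows "two_thirds_form w h' \<alpha> \<beta> = 0"
proof -
  have f: "half_pi_form u \<gamma> \<delta> = 0" and g: "two_thirds_form u h \<gamma> \<delta> = 0" and k: "pi_form u h \<gamma> \<delta> = 0"
    if "\<gamma> \<in> \<Phi>" "\<delta> \<in> \<Phi>" "\<gamma> \<star> \<delta> = 0" for \<gamma> \<delta>
    using assms(1) that by (auto simp: solves_def)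
  show ?thesis
  proof (cases rule: rho_cases[OF ab(1)])
    case 1
    then show ?thesis using two_thirds_minus_two[of \<beta>] g ab rho by (simp add: pairing_comm)
  next
    case 2
    then show ?thesis using two_thirds_minus_one g ab by simp
  next
    case 3
    then show ?thesis using two_thirds_zero[OF ab] g[OF ab] f[of \<alpha> "- \<rho>"] ab rho by simp
  next
    case 4
    define \<beta>' where "\<beta>' = \<beta> - (\<beta> \<star> \<rho>) *\<^sub>R \<rho>"
    have "two_thirds_form u h (\<alpha> - \<rho>) \<beta>' = 0"
    proof (rule g)
      show "\<beta>' \<in> \<Phi>" unfolding \<beta>'_def by (rule reflection[OF rho ab(2)])
      show "\<alpha> - \<rho> \<in> \<Phi>" using diff_root ab rho 4 by blast
      show "(\<alpha> - \<rho>) \<star> \<beta>' = 0" using ab 4 rho by (simp add: \<beta>'_def pairing_comm)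
    qed
    then show ?thesis using two_thirds_one[OF ab 4] g[OF ab] by (simp add: \<beta>'_def)
  next
    case 5
    then show ?thesis using two_thirds_two[of \<beta>] g[of \<rho> \<beta>] g[of "- \<rho>" \<beta>] k[of \<rho> \<beta>] ab rho by simp
  qed
qed

section \<open>The third family of forms under a root unipotent\<close>

text \<open>The added terms are those of \<open>g(-\<rho>, m\<beta> + n\<alpha> - mn\<rho>)\<close>, written out by linearity because the second argument
  is a root or a multiple of one only after a case distinction. The pair \<open>\<rho>, -\<rho>\<close> contributes the \<open>h \<rho>\<close> term
  and cancels the part of degree 2 in \<open>\<xi>\<close>. For a pair \<open>\<eta> + \<zeta> = -\<rho>\<close> the coefficient is
  \<open>\<langle>\<zeta>,\<alpha>\<rangle>\<langle>\<zeta>,\<beta>\<rangle> - \<langle>\<eta>,\<alpha>\<rangle>\<langle>\<eta>,\<beta>\<rangle> = m\<langle>\<eta>,\<beta>\<rangle> + n\<langle>\<eta>,\<alpha>\<rangle> + mn\<close>.\<close>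
lemma pi_transform:
  assumes ab: "\<alpha> \<in> \<Phi>" "\<beta> \<in> \<Phi>" "\<alpha> \<star> \<beta> = 0"
    and C: "root_transversal (- \<rho>) C"
  defines "m \<equiv> cartan_int \<alpha> \<rho>" and "n \<equiv> cartan_int \<beta> \<rho>"
  shows "pi_form w h' \<alpha> \<beta> = pi_form u h \<alpha> \<beta> + \<xi> *
    (u (- \<rho>) * (of_int m * h \<beta> + of_int n * h \<alpha> - of_int (m * n) * h \<rho>) +
     (\<Sum>\<eta>\<in>C. of_int ((m * cartan_int \<eta> \<beta> + n * cartan_int \<eta> \<alpha> + m * n) * N \<eta> (- \<rho> - \<eta>)) *
        (u \<eta> * u (- \<rho> - \<eta>))))"
proof -
  have mr: "- \<rho> \<in> \<Phi>" using rho by simp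
  note nf = acute_facts[OF mr]
  \<comment> \<open>Of each pair \<open>{\<gamma>, -\<gamma>}\<close> that is moved, the member on the side of \<open>\<rho>\<close> is chosen.\<close>
  obtain B where B: "transversal uminus \<Phi> B" "\<And>\<gamma>. \<gamma> \<in> \<Phi> \<Longrightarrow> (- \<gamma>) \<star> \<rho> < \<gamma> \<star> \<rho> \<Longrightarrow> \<gamma> \<in> B"
    using uminus_transversal[of "\<lambda>\<gamma>. \<gamma> \<star> \<rho>"] by blast
  have fin: "finite B" using transversal_finite[OF B(1) finite_roots] .
  have rB: "\<rho> \<in> B" using B(2)[OF rho] rho by simp
  have nB: "acute \<rho> \<subseteq> B - {\<rho>}" using B(2) rho by (auto simp: acute_def)
  have cases: "\<gamma> \<star> \<rho> = 0 \<or> \<gamma> \<in> acute \<rho>" if "\<gamma> \<in> B - {\<rho>}" for \<gamma>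
  proof -
    have g: "\<gamma> \<in> \<Phi>" "- \<gamma> \<notin> B" "\<gamma> \<noteq> \<rho>" using that B(1) by (auto simp: transversal_def)
    then have "\<gamma> \<star> \<rho> \<ge> 0" using B(2)[of "- \<gamma>"] by force
    then show ?thesis using g by (cases rule: rho_cases[OF g(1)]) (auto simp: acute_def)
  qed
  define F where "F = (\<lambda>v \<gamma>. of_int (cartan_int \<gamma> \<alpha> * cartan_int \<gamma> \<beta>) * (v \<gamma> * v (- \<gamma>)) :: 'r)"
  define K where "K = (\<lambda>\<gamma>. of_int (cartan_int \<gamma> \<alpha> * cartan_int \<gamma> \<beta> * N \<rho> (\<gamma> - \<rho>)) *
      (u (\<gamma> - \<rho>) * u (- \<gamma>)) :: 'r)"
  define Q where "Q = (\<lambda>\<eta>. of_int (cartan_int \<eta> \<alpha> * cartan_int \<eta> \<beta> * N \<rho> (- \<rho> - \<eta>)) *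
      (u \<eta> * u (- \<rho> - \<eta>)) :: 'r)"
  have F_rho: "F w \<rho> = F u \<rho> - of_int (m * n) * (\<xi> * h \<rho> + \<xi>\<^sup>2 * u (- \<rho>)) * u (- \<rho>)"
    using w_low[of "- \<rho>"] rho cartan_int_commute[OF rho ab(1)] cartan_int_commute[OF rho ab(2)]
    by (simp add: F_def w_rho m_def n_def algebra_simps)
  have "F w \<gamma> = F u \<gamma> + (if \<gamma> \<in> acute \<rho> then \<xi> * K \<gamma> else 0)" if "\<gamma> \<in> B - {\<rho>}" for \<gamma>
  proof (cases "\<gamma> \<in> acute \<rho>")
    case True
    then have "\<gamma> \<star> \<rho> = 1" "(- \<gamma>) \<star> \<rho> \<le> 0" by (simp_all add: acute_def)
    then have "w \<gamma> = u \<gamma> + of_int (N \<rho> (\<gamma> - \<rho>)) * \<xi> * u (\<gamma> - \<rho>)" "w (- \<gamma>) = u (- \<gamma>)"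
      using w_one w_low by blast+
    then show ?thesis using True by (simp add: F_def K_def algebra_simps)
  next
    case False
    then have "\<gamma> \<star> \<rho> = 0" using cases that by blast
    then have "w \<gamma> = u \<gamma>" "w (- \<gamma>) = u (- \<gamma>)" using w_low by simp_all
    then show ?thesis using False by (simp add: F_def)
  qed
  then have "sum (F w) (B - {\<rho>}) = (\<Sum>\<gamma>\<in>B - {\<rho>}. F u \<gamma> + (if \<gamma> \<in> acute \<rho> then \<xi> * K \<gamma> else 0))"
    by (rule sum.cong[OF refl])
  also have "\<dots> = sum (F u) (B - {\<rho>}) + (\<Sum>\<gamma>\<in>B - {\<rho>}. if \<gamma> \<in> acute \<rho> then \<xi> * K \<gamma> else 0)"
    by (rule sum.distrib)
  also have "(\<Sum>\<gamma>\<in>B - {\<rho>}. if \<gamma> \<in> acute \<rho> then \<xi> * K \<gamma> else 0) = (\<Sum>\<gamma>\<in>acute \<rho>. \<xi> * K \<gamma>)"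
    using nB fin by (simp add: sum.inter_restrict[symmetric] Int_absorb1)
  also have "\<dots> = \<xi> * sum K (acute \<rho>)" by (simp add: sum_distrib_left)
  also have "sum K (acute \<rho>) = sum Q (acute (- \<rho>))"
  proof (rule sum.reindex_bij_witness[where i = uminus and j = uminus])
    fix \<gamma> assume g: "\<gamma> \<in> acute \<rho>"
    then show "- \<gamma> \<in> acute (- \<rho>)" by (simp add: acute_def)
    have r: "\<gamma> \<in> \<Phi>" using g by (simp add: acute_def)
    have i: "- \<rho> - - \<gamma> = \<gamma> - \<rho>" by simp
    show "Q (- \<gamma>) = K \<gamma>"
      unfolding Q_def K_def i using cartan_int_minus[OF r ab(1)] cartan_int_minus[OF r ab(2)]
      by (simp add: mult.commute)
  qed (auto simp: acute_def)
  also have "sum Q (acute (- \<rho>)) = (\<Sum>\<eta>\<in>C. Q \<eta> + Q (- \<rho> - \<eta>))"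
    by (rule sum_transversal_double[OF finite_acute involution_acute[OF mr] C])
  also have "\<dots> = (\<Sum>\<eta>\<in>C. of_int ((m * cartan_int \<eta> \<beta> + n * cartan_int \<eta> \<alpha> + m * n) * N \<eta> (- \<rho> - \<eta>)) *
        (u \<eta> * u (- \<rho> - \<eta>)))" (is "_ = ?T")
  proof (rule sum.cong[OF refl])
    fix \<eta> assume "\<eta> \<in> C"
    then have e: "\<eta> \<in> acute (- \<rho>)" using C by (auto simp: transversal_def)
    note f = nf[OF e]
    define \<zeta> where "\<zeta> = - \<rho> - \<eta>"
    have z: "\<zeta> \<in> \<Phi>" "\<eta> \<star> \<zeta> = -1" "- \<rho> - \<zeta> = \<eta>"
      using f by (simp_all add: \<zeta>_def pairing_comm)
    have z0: "\<rho> + \<zeta> + \<eta> = 0" "\<rho> + \<eta> + \<zeta> = 0" by (simp_all add: \<zeta>_def)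
    have "N \<rho> \<zeta> = N \<zeta> \<eta>" using N_rotate[OF rho z(1) f(1) z0(1)] by simp
    moreover have "N \<zeta> \<eta> = - N \<eta> \<zeta>" by (rule N_anti[OF f(1) z(1,2)])
    moreover have "N \<rho> \<eta> = N \<eta> \<zeta>" using N_rotate[OF rho f(1) z(1) z0(2)] by simp
    moreover have "cartan_int \<zeta> \<alpha> = - m - cartan_int \<eta> \<alpha>"
      by (rule cartan_int_eqI[OF z(1) ab(1)])
        (use f ab rho in \<open>simp add: \<zeta>_def m_def cartan_int_root pairing_comm\<close>)
    moreover have "cartan_int \<zeta> \<beta> = - n - cartan_int \<eta> \<beta>"
      by (rule cartan_int_eqI[OF z(1) ab(2)])
        (use f ab rho in \<open>simp add: \<zeta>_def n_def cartan_int_root pairing_comm\<close>)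
    ultimately show "Q \<eta> + Q (- \<rho> - \<eta>) =
        of_int ((m * cartan_int \<eta> \<beta> + n * cartan_int \<eta> \<alpha> + m * n) * N \<eta> (- \<rho> - \<eta>)) * (u \<eta> * u (- \<rho> - \<eta>))"
      unfolding Q_def \<zeta>_def[symmetric] z(3)
      by (simp only: of_int_mult of_int_add of_int_diff of_int_minus) (simp add: algebra_simps)
  qed
  finally have S: "sum (F w) (B - {\<rho>}) = sum (F u) (B - {\<rho>}) + \<xi> * ?T" .
  have "sum (F w) B = F w \<rho> + sum (F w) (B - {\<rho>})" "sum (F u) B = F u \<rho> + sum (F u) (B - {\<rho>})"
    using sum.remove[OF fin rB] by blast+
  then have "sum (F w) B = sum (F u) B - of_int (m * n) * (\<xi> * h \<rho> + \<xi>\<^sup>2 * u (- \<rho>)) * u (- \<rho>) + \<xi> * ?T"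
    unfolding F_rho S by (simp add: algebra_simps)
  then have "pi_form w h' \<alpha> \<beta> = h' \<alpha> * h' \<beta> +
      (sum (F u) B - of_int (m * n) * (\<xi> * h \<rho> + \<xi>\<^sup>2 * u (- \<rho>)) * u (- \<rho>) + \<xi> * ?T)"
    unfolding pi_form_eq[OF ab(1,2) B(1)] F_def by simp
  moreover have "pi_form u h \<alpha> \<beta> = h \<alpha> * h \<beta> + sum (F u) B"
    unfolding pi_form_eq[OF ab(1,2) B(1)] F_def by simp
  ultimately show ?thesis
    unfolding unipotent_zero_def m_def[symmetric] n_def[symmetric] of_int_mult[of m n]
    by (simp add: algebra_simps power2_eq_square)
qed

text \<open>For \<open>m = 0\<close> or \<open>n = 0\<close> the argument \<open>m\<beta> + n\<alpha> - mn\<rho>\<close> is a multiple of \<open>\<alpha>\<close> or \<open>\<beta>\<close>. Otherwise \<open>m, n = \<plusminus>1\<close> and it is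
  the root \<open>m s\<^sub>\<rho>(\<beta>) + n \<alpha>\<close>, orthogonal to \<open>\<rho>\<close>.\<close>
lemma pi_solved:
  assumes "solves u h" and ab: "\<alpha> \<in> \<Phi>" "\<beta> \<in> \<Phi>" "\<alpha> \<star> \<beta> = 0"
  shows "pi_form w h' \<alpha> \<beta> = 0"
proof -
  have mr: "- \<rho> \<in> \<Phi>" using rho by simp
  note nf = acute_facts[OF mr]
  obtain C where C: "root_transversal (- \<rho>) C"
    using acute_transversal[OF mr, of "\<lambda>_. 0"] by blast
  define m where "m = cartan_int \<alpha> \<rho>"
  define n where "n = cartan_int \<beta> \<rho>"
  \<comment> \<open>\<open>g(-\<rho>, \<delta>)\<close> depends on \<open>\<delta>\<close> only through \<open>h \<delta>\<close> and \<open>\<eta> \<mapsto> \<langle>\<eta>,\<delta>\<rangle>\<close>, and linearly.\<close>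
  define T where "T = (\<lambda>f. u (- \<rho>) * (fst f) + (\<Sum>\<eta>\<in>C. of_int (snd f \<eta> * N \<eta> (- \<rho> - \<eta>)) * (u \<eta> * u (- \<rho> - \<eta>))) :: 'r)"
  have T0: "T (h \<delta>, \<lambda>\<eta>. cartan_int \<eta> \<delta>) = 0" if "\<delta> \<in> \<Phi>" "\<delta> \<star> \<rho> = 0" for \<delta>
  proof -
    have "(- \<rho>) \<star> \<delta> = 0" using that by (simp add: pairing_comm)
    then show ?thesis
      using two_thirds_form_eq[OF mr that(1) _ C, of u h] assms(1) mr that by (simp add: T_def solves_def)
  qed
  have Tscale: "T (of_int k * y, \<lambda>\<eta>. k * f \<eta>) = of_int k * T (y, f)" for k y f
    by (simp add: T_def sum_distrib_left algebra_simps)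
  have inC: "\<eta> \<in> \<Phi>" "\<eta> \<star> \<rho> = -1" if "\<eta> \<in> C" for \<eta>
    using that C nf[of \<eta>] by (auto simp: transversal_def)
  have "T (of_int m * h \<beta> + of_int n * h \<alpha> - of_int (m * n) * h \<rho>,
      \<lambda>\<eta>. m * cartan_int \<eta> \<beta> + n * cartan_int \<eta> \<alpha> + m * n) = 0"
  proof (cases "m = 0 \<or> n = 0")
    case True
    then show ?thesis
    proof
      assume "m = 0"
      then have "\<alpha> \<star> \<rho> = 0" using cartan_int_root[OF ab(1) rho] by (simp add: m_def)
      then show ?thesis using Tscale[of n "h \<alpha>" "\<lambda>\<eta>. cartan_int \<eta> \<alpha>"] T0[OF ab(1)] \<open>m = 0\<close> by simp
    next
      assume "n = 0"
      then have "\<beta> \<star> \<rho> = 0" using cartan_int_root[OF ab(2) rho] by (simp add: n_def)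
      then show ?thesis using Tscale[of m "h \<beta>" "\<lambda>\<eta>. cartan_int \<eta> \<beta>"] T0[OF ab(2)] \<open>n = 0\<close> by simp
    qed
  next
    case False
    have mn: "\<alpha> \<star> \<rho> = real_of_int m" "\<beta> \<star> \<rho> = real_of_int n"
      using cartan_int_root ab rho by (simp_all add: m_def n_def)
    have "m \<in> {-1, 1}"
      using False mn ab rho by (cases rule: rho_cases[OF ab(1)]) (auto simp: pairing_comm)
    moreover have "n \<in> {-1, 1}"
      using False mn ab rho by (cases rule: rho_cases[OF ab(2)]) (auto simp: pairing_comm)
    ultimately have cases: "m = 1 \<or> m = -1" "n = 1 \<or> n = -1" by auto
    define \<sigma> where "\<sigma> = \<beta> - (\<beta> \<star> \<rho>) *\<^sub>R \<rho>"
    have s: "\<sigma> \<in> \<Phi>" "h \<sigma> = h \<beta> - of_int n * h \<rho>"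
      unfolding \<sigma>_def n_def using reflection[OF rho ab(2)] h_reflection[OF ab(2)] by blast+
    define \<delta> where "\<delta> = real_of_int m *\<^sub>R \<sigma> + real_of_int n *\<^sub>R \<alpha>"
    have sign: "real_of_int k *\<^sub>R \<gamma> \<in> \<Phi>" "h (real_of_int k *\<^sub>R \<gamma>) = of_int k * h \<gamma>"
      if "k = 1 \<or> k = -1" "\<gamma> \<in> \<Phi>" for k \<gamma>
      using that h_minus by auto
    have p: "(real_of_int m *\<^sub>R \<sigma>) \<star> (real_of_int n *\<^sub>R \<alpha>) = -1"
      using ab mn cases by (auto simp: \<sigma>_def pairing_comm)
    have d: "\<delta> \<in> \<Phi>" unfolding \<delta>_def by (rule add_root[OF sign(1) sign(1) p]) (use cases s ab in auto)
    have hd: "h \<delta> = of_int m * h \<beta> + of_int n * h \<alpha> - of_int (m * n) * h \<rho>"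
      using h_add[of "real_of_int m *\<^sub>R \<sigma>" "real_of_int n *\<^sub>R \<alpha>"] sign cases s ab d
      by (simp add: \<delta>_def algebra_simps)
    have dr: "\<delta> \<star> \<rho> = 0" using mn rho by (simp add: \<delta>_def \<sigma>_def)
    have cd: "cartan_int \<eta> \<delta> = m * cartan_int \<eta> \<beta> + n * cartan_int \<eta> \<alpha> + m * n" if "\<eta> \<in> C" for \<eta>
      by (rule cartan_int_eqI)
        (use inC[OF that] d ab mn in \<open>simp_all add: \<delta>_def \<sigma>_def cartan_int_root algebra_simps\<close>)
    have "T (h \<delta>, \<lambda>\<eta>. cartan_int \<eta> \<delta>) =
      T (h \<delta>, \<lambda>\<eta>. m * cartan_int \<eta> \<beta> + n * cartan_int \<eta> \<alpha> + m * n)"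
      using cd by (simp add: T_def)
    then show ?thesis using T0[OF d dr] hd by simp
  qed
  moreover have "pi_form u h \<alpha> \<beta> = 0" using assms(1) ab by (auto simp: solves_def)
  ultimately show ?thesis
    using pi_transform[OF ab C] by (simp add: T_def m_def n_def)
qed

lemma solves_unipotent: "solves u h \<Longrightarrow> solves w h'"
  using half_pi_solved two_thirds_solved pi_solved by (simp add: solves_def[of w])

end

section \<open>The forms and the equations\<close>

text \<open>Whichever ordering \<open>SOME\<close> selects for a pair, it is one of the two orderings and the symmetric summand
  takes the same value on both.\<close>
lemma sum_unordered_transversal:
  assumes inv: "involution_on \<iota> A" and B: "transversal \<iota> A B"
    and S: "S = (\<lambda>\<gamma>. {\<gamma>, \<iota> \<gamma>}) ` A"
    and sym: "\<And>\<gamma>. \<gamma> \<in> A \<Longrightarrow> f (\<iota> \<gamma>) \<gamma> = f \<gamma> (\<iota> \<gamma>)"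
  shows "sum_unordered f S = (\<Sum>\<gamma>\<in>B. f \<gamma> (\<iota> \<gamma>))"
proof -
  have i: "\<iota> \<gamma> \<in> A" "\<iota> (\<iota> \<gamma>) = \<gamma>" if "\<gamma> \<in> A" for \<gamma> using inv that by (auto simp: involution_on_def)
  have B': "B \<subseteq> A" "\<And>\<gamma>. \<gamma> \<in> A \<Longrightarrow> \<gamma> \<in> B \<longleftrightarrow> \<iota> \<gamma> \<notin> B" using B by (auto simp: transversal_def)
  have "bij_betw (\<lambda>\<gamma>. {\<gamma>, \<iota> \<gamma>}) B S"
    unfolding bij_betw_def
  proof
    show "inj_on (\<lambda>\<gamma>. {\<gamma>, \<iota> \<gamma>}) B"
    proof (rule inj_onI)
      fix \<gamma> \<delta> assume *: "\<gamma> \<in> B" "\<delta> \<in> B" "{\<gamma>, \<iota> \<gamma>} = {\<delta>, \<iota> \<delta>}"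
      then have "\<iota> \<delta> \<notin> B" using B' by blast
      then show "\<gamma> = \<delta>" using * by (metis doubleton_eq_iff)
    qed
    show "(\<lambda>\<gamma>. {\<gamma>, \<iota> \<gamma>}) ` B = S"
    proof (intro equalityI subsetI)
      fix P assume "P \<in> S"
      then obtain \<gamma> where g: "\<gamma> \<in> A" "P = {\<gamma>, \<iota> \<gamma>}" using S by blast
      show "P \<in> (\<lambda>\<gamma>. {\<gamma>, \<iota> \<gamma>}) ` B"
      proof (cases "\<gamma> \<in> B")
        case False
        then have "\<iota> \<gamma> \<in> B" using B' g by blast
        then show ?thesis by (rule rev_image_eqI) (use i g in auto)
      qed (use g in blast)
    qed (use S B' in blast)
  qed
  moreover have "(case SOME p. {\<gamma>, \<iota> \<gamma>} = {fst p, snd p} of (\<gamma>, \<delta>) \<Rightarrow> f \<gamma> \<delta>) = f \<gamma> (\<iota> \<gamma>)"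
    if "\<gamma> \<in> B" for \<gamma>
  proof -
    define p where "p = (SOME p. {\<gamma>, \<iota> \<gamma>} = {fst p, snd p})"
    have "{\<gamma>, \<iota> \<gamma>} = {fst p, snd p}"
      unfolding p_def by (rule someI[of _ "(\<gamma>, \<iota> \<gamma>)"]) simp
    then have "p = (\<gamma>, \<iota> \<gamma>) \<or> p = (\<iota> \<gamma>, \<gamma>)" by (auto simp: doubleton_eq_iff prod_eq_iff)
    then show ?thesis using sym[of \<gamma>] that B' by (auto simp: p_def[symmetric])
  qed
  ultimately show ?thesis
    unfolding sum_unordered_def by (simp add: sum.reindex_bij_betw[symmetric])
qed

context structure_constants
begin

lemma norm_root: "\<alpha> \<in> \<Phi> \<Longrightarrow> norm \<alpha> = 1"
  using self_pairing[of \<alpha>] by (simp add: pairing_def norm_eq_1)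

lemma angle_iff:
  assumes "\<gamma> \<in> \<Phi>" "\<beta> \<in> \<Phi>"
  shows "angle \<gamma> \<beta> = pi / 3 \<longleftrightarrow> \<gamma> \<star> \<beta> = 1" "angle \<gamma> \<beta> = 2 * pi / 3 \<longleftrightarrow> \<gamma> \<star> \<beta> = -1"
proof -
  have a: "angle \<gamma> \<beta> = arccos (\<gamma> \<star> \<beta> / 2)"
    using assms by (simp add: angle_def norm_root pairing_def)
  have bound: "\<bar>\<gamma> \<star> \<beta> / 2\<bar> \<le> 1" using pairing_cases[OF assms] by auto
  have "arccos (1/2) = pi / 3" using arccos_cos[of "pi/3"] by (simp add: cos_60)
  then show "angle \<gamma> \<beta> = pi / 3 \<longleftrightarrow> \<gamma> \<star> \<beta> = 1"
    using arccos_eq_iff[of "\<gamma> \<star> \<beta> / 2" "1/2"] bound by (simp add: a)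
  have "arccos (-1/2) = 2 * pi / 3" using arccos_cos[of "2*pi/3"] by (simp add: cos_120)
  then show "angle \<gamma> \<beta> = 2 * pi / 3 \<longleftrightarrow> \<gamma> \<star> \<beta> = -1"
    using arccos_eq_iff[of "\<gamma> \<star> \<beta> / 2" "-1/2"] bound by (simp add: a)
qed

lemma equation_half_pi_iff:
  assumes ab: "\<alpha> \<in> \<Phi>" "\<beta> \<in> \<Phi>" "\<alpha> \<star> \<beta> = 0"
  shows "equation_half_pi \<Phi> N v \<alpha> \<beta> \<longleftrightarrow> half_pi_form (\<lambda>\<gamma>. v (Root \<gamma>)) \<alpha> \<beta> = 0"
proof -
  obtain B where B: "pair_transversal \<alpha> \<beta> B"
    using common_transversal[OF ab, of "\<lambda>_. 0"] by blast
  have S: "S_half_pi \<Phi> \<alpha> \<beta> = (\<lambda>\<gamma>. {\<gamma>, \<alpha> + \<beta> - \<gamma>}) ` common \<alpha> \<beta>"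
  proof (intro equalityI subsetI)
    fix P assume "P \<in> S_half_pi \<Phi> \<alpha> \<beta>"
    then obtain \<gamma> \<delta> where P: "P = {\<gamma>, \<delta>}" "\<gamma> \<in> \<Phi>" "\<delta> \<in> \<Phi>" "\<gamma> + \<delta> = \<alpha> + \<beta>" "{\<gamma>, \<delta>} \<noteq> {\<alpha>, \<beta>}"
      unfolding S_half_pi_def by blast
    have d: "\<delta> = \<alpha> + \<beta> - \<gamma>" using P(4) by (simp add: algebra_simps)
    have "\<delta> \<star> \<delta> = 2" using P by simp
    then have "\<gamma> \<star> \<alpha> + \<gamma> \<star> \<beta> = 2" using ab P(2) unfolding d by (simp add: pairing_comm)
    moreover have "\<gamma> \<noteq> \<alpha>" "\<gamma> \<noteq> \<beta>" using P(5) d by auto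
    then have "\<gamma> \<star> \<alpha> \<noteq> 2" "\<gamma> \<star> \<beta> \<noteq> 2" using pairing_2_imp_eq P(2) ab by blast+
    ultimately have "\<gamma> \<in> common \<alpha> \<beta>"
      using pairing_cases[OF P(2) ab(1)] pairing_cases[OF P(2) ab(2)] P(2) by (auto simp: common_def)
    then show "P \<in> (\<lambda>\<gamma>. {\<gamma>, \<alpha> + \<beta> - \<gamma>}) ` common \<alpha> \<beta>" using P(1) d by blast
  next
    fix P assume "P \<in> (\<lambda>\<gamma>. {\<gamma>, \<alpha> + \<beta> - \<gamma>}) ` common \<alpha> \<beta>"
    then obtain \<gamma> where g: "\<gamma> \<in> common \<alpha> \<beta>" "P = {\<gamma>, \<alpha> + \<beta> - \<gamma>}" by blast
    have "\<gamma> \<noteq> \<alpha>" "\<gamma> \<noteq> \<beta>" using g(1) ab by (auto simp: common_def)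
    then have "{\<gamma>, \<alpha> + \<beta> - \<gamma>} \<noteq> {\<alpha>, \<beta>}" by (simp add: doubleton_eq_iff)
    moreover have "\<gamma> \<in> \<Phi>" "\<alpha> + \<beta> - \<gamma> \<in> \<Phi>"
      using g(1) complement_root[OF ab g(1)] by (simp_all add: common_def)
    moreover have "\<gamma> + (\<alpha> + \<beta> - \<gamma>) = \<alpha> + \<beta>" by simp
    ultimately show "P \<in> S_half_pi \<Phi> \<alpha> \<beta>" unfolding S_half_pi_def g(2) by blast
  qed
  let ?f = "\<lambda>\<gamma> \<delta>. of_int (N \<alpha> (- \<gamma>) * N \<beta> (- \<delta>)) * v (Root \<gamma>) * v (Root \<delta>)"
  have "sum_unordered ?f (S_half_pi \<Phi> \<alpha> \<beta>) = (\<Sum>\<gamma>\<in>B. ?f \<gamma> (\<alpha> + \<beta> - \<gamma>))"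
  proof (rule sum_unordered_transversal[OF involution_common[OF ab] B S])
    fix \<gamma> assume "\<gamma> \<in> common \<alpha> \<beta>"
    from pair_sign_complement[OF ab this]
    have "N \<alpha> (- (\<alpha> + \<beta> - \<gamma>)) * N \<beta> (- \<gamma>) = N \<alpha> (- \<gamma>) * N \<beta> (- (\<alpha> + \<beta> - \<gamma>))"
      by (simp add: pair_sign_def)
    then show "?f (\<alpha> + \<beta> - \<gamma>) \<gamma> = ?f \<gamma> (\<alpha> + \<beta> - \<gamma>)"
      by (simp only: mult.assoc mult.commute[of "v (Root (\<alpha> + \<beta> - \<gamma>))"])
  qed
  then show ?thesis
    by (simp add: equation_half_pi_def half_pi_form_eq[OF ab B] pair_sign_def mult.assoc)
qed

lemma equation_two_thirds_pi_iff:
  assumes ab: "\<alpha> \<in> \<Phi>" "\<beta> \<in> \<Phi>" "\<alpha> \<star> \<beta> = 0"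
  shows "equation_two_thirds_pi \<Phi> a l N v \<alpha> \<beta> \<longleftrightarrow>
    two_thirds_form (\<lambda>\<gamma>. v (Root \<gamma>)) (\<lambda>\<beta>. \<Sum>s=1..l. of_int (cartan_int \<beta> (a s)) * v (Zero s)) \<alpha> \<beta> = 0"
proof -
  have S: "{(\<gamma>, \<delta>). {\<gamma>, \<delta>} \<in> S_two_thirds_pi \<Phi> \<alpha> \<beta> \<and> angle \<gamma> \<beta> = pi / 3}
     = (\<lambda>\<gamma>. (\<gamma>, \<alpha> - \<gamma>)) ` common \<alpha> \<beta>"
  proof (intro equalityI subsetI; clarify)
    fix \<gamma> \<delta> assume *: "{\<gamma>, \<delta>} \<in> S_two_thirds_pi \<Phi> \<alpha> \<beta>" "angle \<gamma> \<beta> = pi / 3"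
    then have g: "\<gamma> \<in> \<Phi>" "\<delta> \<in> \<Phi>" "\<gamma> + \<delta> = \<alpha>"
      unfolding S_two_thirds_pi_def by (auto simp: doubleton_eq_iff add.commute)
    then have d: "\<delta> = \<alpha> - \<gamma>" by auto
    then have "\<gamma> \<star> \<alpha> = 1" using pairing_of_root_diff[of \<alpha> \<gamma>] g ab by (simp add: pairing_comm)
    then show "(\<gamma>, \<delta>) \<in> (\<lambda>\<gamma>. (\<gamma>, \<alpha> - \<gamma>)) ` common \<alpha> \<beta>"
      using g d *(2) angle_iff(1) ab by (auto simp: common_def)
  next
    fix \<gamma> assume "\<gamma> \<in> common \<alpha> \<beta>"
    then have g: "\<gamma> \<in> \<Phi>" "\<gamma> \<star> \<alpha> = 1" "\<gamma> \<star> \<beta> = 1" by (auto simp: common_def)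
    have "\<alpha> - \<gamma> \<in> \<Phi>" using diff_root ab g by (simp add: pairing_comm)
    moreover have "\<gamma> \<bullet> \<beta> \<noteq> 0" using g by (auto simp: pairing_def)
    ultimately show "{\<gamma>, \<alpha> - \<gamma>} \<in> S_two_thirds_pi \<Phi> \<alpha> \<beta> \<and> angle \<gamma> \<beta> = pi / 3"
      using g angle_iff(1) ab unfolding S_two_thirds_pi_def by fastforce
  qed
  have "(\<Sum>(\<gamma>, \<delta>)\<in>(\<lambda>\<gamma>. (\<gamma>, \<alpha> - \<gamma>)) ` common \<alpha> \<beta>. of_int (N \<gamma> \<delta>) * v (Root \<gamma>) * v (Root \<delta>))
     = (\<Sum>\<gamma>\<in>common \<alpha> \<beta>. of_int (N \<gamma> (\<alpha> - \<gamma>)) * (v (Root \<gamma>) * v (Root (\<alpha> - \<gamma>))))"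
    by (subst sum.reindex) (auto simp: inj_on_def mult.assoc)
  then show ?thesis
    unfolding equation_two_thirds_pi_def S two_thirds_form_common[OF ab]
    by (simp add: eq_neg_iff_add_eq_0)
qed

lemma equation_pi_iff:
  assumes ab: "\<alpha> \<in> \<Phi>" "\<beta> \<in> \<Phi>" "\<alpha> \<star> \<beta> = 0"
  shows "equation_pi \<Phi> a l v \<alpha> \<beta> \<longleftrightarrow>
    pi_form (\<lambda>\<gamma>. v (Root \<gamma>)) (\<lambda>\<beta>. \<Sum>s=1..l. of_int (cartan_int \<beta> (a s)) * v (Zero s)) \<alpha> \<beta> = 0"
proof -
  let ?P = "\<lambda>\<gamma>. v (Root \<gamma>) * v (Root (- \<gamma>))"
  have S': "S_pi' \<Phi> \<alpha> \<beta> = (\<lambda>\<gamma>. (- \<gamma>, \<gamma>)) ` {\<gamma> \<in> acute \<alpha>. \<gamma> \<star> \<beta> = -1}"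
  proof (intro equalityI subsetI; clarify)
    fix \<gamma> \<delta> assume "(\<gamma>, \<delta>) \<in> S_pi' \<Phi> \<alpha> \<beta>"
    then have g: "\<gamma> \<in> \<Phi>" "\<delta> \<in> \<Phi>" "\<gamma> = - \<delta>" "\<gamma> \<star> \<alpha> = -1" "\<delta> \<star> \<beta> = -1"
      using ab angle_iff(2) by (auto simp: S_pi'_def eq_neg_iff_add_eq_0)
    then show "(\<gamma>, \<delta>) \<in> (\<lambda>\<gamma>. (- \<gamma>, \<gamma>)) ` {\<gamma> \<in> acute \<alpha>. \<gamma> \<star> \<beta> = -1}"
      by (auto simp: acute_def)
  next
    fix \<gamma> assume "\<gamma> \<in> acute \<alpha>" "\<gamma> \<star> \<beta> = -1"
    then show "(- \<gamma>, \<gamma>) \<in> S_pi' \<Phi> \<alpha> \<beta>"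
      using ab angle_iff(2)[of "- \<gamma>" \<alpha>] angle_iff(2)[of \<gamma> \<beta>] by (auto simp: S_pi'_def acute_def)
  qed
  have S: "S_pi \<Phi> \<alpha> \<beta> = (\<lambda>\<gamma>. (- \<gamma>, \<gamma>)) ` {\<gamma> \<in> acute \<alpha>. \<gamma> \<star> \<beta> = 1}"
  proof (intro equalityI subsetI; clarify)
    fix \<gamma> \<delta> assume "(\<gamma>, \<delta>) \<in> S_pi \<Phi> \<alpha> \<beta>"
    then have g: "\<gamma> \<in> \<Phi>" "\<delta> \<in> \<Phi>" "\<gamma> = - \<delta>" "\<gamma> \<star> \<alpha> = -1" "\<gamma> \<star> \<beta> = -1"
      using ab angle_iff(2) by (auto simp: S_pi_def eq_neg_iff_add_eq_0)
    then show "(\<gamma>, \<delta>) \<in> (\<lambda>\<gamma>. (- \<gamma>, \<gamma>)) ` {\<gamma> \<in> acute \<alpha>. \<gamma> \<star> \<beta> = 1}"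
      by (auto simp: acute_def)
  next
    fix \<gamma> assume "\<gamma> \<in> acute \<alpha>" "\<gamma> \<star> \<beta> = 1"
    then show "(- \<gamma>, \<gamma>) \<in> S_pi \<Phi> \<alpha> \<beta>"
      using ab angle_iff(2)[of "- \<gamma>" \<alpha>] angle_iff(2)[of "- \<gamma>" \<beta>] by (auto simp: S_pi_def acute_def)
  qed
  have sums: "(\<Sum>(\<gamma>, \<delta>)\<in>(\<lambda>\<gamma>. (- \<gamma>, \<gamma>)) ` A. v (Root \<gamma>) * v (Root \<delta>)) = sum ?P A" for A
    by (subst sum.reindex) (auto simp: inj_on_def mult.commute)
  have "(\<Sum>\<gamma>\<in>acute \<alpha>. of_int (cartan_int \<gamma> \<beta>) * ?P \<gamma>)
    = (\<Sum>\<gamma>\<in>acute \<alpha>. (if \<gamma> \<star> \<beta> = 1 then ?P \<gamma> else 0) - (if \<gamma> \<star> \<beta> = -1 then ?P \<gamma> else 0))"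
  proof (rule sum.cong[OF refl])
    fix \<gamma> assume "\<gamma> \<in> acute \<alpha>"
    then have g: "\<gamma> \<in> \<Phi>" "\<gamma> \<star> \<alpha> = 1" by (auto simp: acute_def)
    have "\<gamma> \<star> \<beta> \<noteq> 2" using pairing_2_imp_eq[of \<gamma> \<beta>] g ab by (auto simp: pairing_comm)
    moreover have "\<gamma> \<star> \<beta> \<noteq> -2" using pairing_2_imp_eq[of "- \<gamma>" \<beta>] g ab by (auto simp: pairing_comm)
    ultimately consider "\<gamma> \<star> \<beta> = 1" | "\<gamma> \<star> \<beta> = 0" | "\<gamma> \<star> \<beta> = -1"
      using pairing_cases[OF g(1) ab(2)] by blast
    then show "of_int (cartan_int \<gamma> \<beta>) * ?P \<gamma> =
        (if \<gamma> \<star> \<beta> = 1 then ?P \<gamma> else 0) - (if \<gamma> \<star> \<beta> = -1 then ?P \<gamma> else 0)"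
    proof cases
      case 1
      then show ?thesis using cartan_int_eqI[OF g(1) ab(2), of 1] by simp
    next
      case 2
      then show ?thesis using cartan_int_eqI[OF g(1) ab(2), of 0] by simp
    next
      case 3
      then show ?thesis using cartan_int_eqI[OF g(1) ab(2), of "-1"] by simp
    qed
  qed
  also have "\<dots> = sum ?P {\<gamma> \<in> acute \<alpha>. \<gamma> \<star> \<beta> = 1} - sum ?P {\<gamma> \<in> acute \<alpha>. \<gamma> \<star> \<beta> = -1}"
    by (simp add: sum_subtractf sum.inter_filter finite_acute)
  finally have split: "(\<Sum>\<gamma>\<in>acute \<alpha>. of_int (cartan_int \<gamma> \<beta>) * ?P \<gamma>)
    = sum ?P {\<gamma> \<in> acute \<alpha>. \<gamma> \<star> \<beta> = 1} - sum ?P {\<gamma> \<in> acute \<alpha>. \<gamma> \<star> \<beta> = -1}" .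
  show ?thesis
    unfolding equation_pi_def S S' sums pi_form_acute[OF ab] split
    by (simp only: eq_neg_iff_add_eq_0[symmetric] minus_diff_eq)
qed

end

section \<open>Coordinates of the root unipotents\<close>

context structure_constants
begin

text \<open>The coefficients of a root in the fundamental roots are integers, so rounding them loses nothing.\<close>
lemma root_expansion:
  assumes fs: "fundamental_system \<Phi> a l" and r: "\<rho> \<in> \<Phi>"
  shows "\<rho> = (\<Sum>s=1..l. real_of_int (root_coeff a l s \<rho>) *\<^sub>R a s)"
proof -
  let ?B = "a ` {1..l}"
  have inj: "inj_on a {1..l}" and ind: "independent ?B" using fs by (auto simp: fundamental_system_def)
  obtain c :: "nat \<Rightarrow> nat" where c: "\<rho> = (\<Sum>s=1..l. real (c s) *\<^sub>R a s) \<or> \<rho> = - (\<Sum>s=1..l. real (c s) *\<^sub>R a s)"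
    using fs r unfolding fundamental_system_def by blast
  define k where "k = (\<lambda>s. if \<rho> = (\<Sum>s=1..l. real (c s) *\<^sub>R a s) then int (c s) else - int (c s))"
  have k: "\<rho> = (\<Sum>s=1..l. real_of_int (k s) *\<^sub>R a s)"
  proof (cases "\<rho> = (\<Sum>s=1..l. real (c s) *\<^sub>R a s)")
    case True
    have "k = (\<lambda>s. int (c s))" using True by (simp add: k_def)
    then show ?thesis using True by simp
  next
    case False
    have "k = (\<lambda>s. - int (c s))" using False by (simp add: k_def)
    then show ?thesis using False c by (simp add: sum_negf)
  qed
  have rep: "representation ?B \<rho> (a s) = real_of_int (k s)" if "s \<in> {1..l}" for s
  proof -
    have "representation ?B \<rho> = (\<lambda>b. \<Sum>t=1..l. representation ?B (real_of_int (k t) *\<^sub>R a t) b)"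
      by (subst k, rule representation_sum[OF ind]) (intro span_scale span_base imageI)
    also have "\<dots> = (\<lambda>b. \<Sum>t=1..l. real_of_int (k t) * (if b = a t then 1 else 0))"
    proof (rule ext, rule sum.cong[OF refl])
      fix b t assume t: "t \<in> {1..l}"
      then have "representation ?B (real_of_int (k t) *\<^sub>R a t) = (\<lambda>b. real_of_int (k t) * representation ?B (a t) b)"
        by (intro representation_scale[OF ind] span_base imageI)
      then show "representation ?B (real_of_int (k t) *\<^sub>R a t) b = real_of_int (k t) * (if b = a t then 1 else 0)"
        using representation_basis[OF ind, of "a t"] t by simp
    qed
    finally have "representation ?B \<rho> (a s) = (\<Sum>t=1..l. real_of_int (k t) * (if a s = a t then 1 else 0))"
      by (rule fun_cong)
    also have "\<dots> = (\<Sum>t=1..l. if t = s then real_of_int (k t) else 0)"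
      by (rule sum.cong[OF refl]) (use inj that in \<open>auto dest: inj_onD\<close>)
    finally show ?thesis using that by simp
  qed
  have "root_coeff a l s \<rho> = k s" if "s \<in> {1..l}" for s
    using rep[OF that] by (simp add: root_coeff_def)
  then show ?thesis by (subst k) (rule sum.cong, auto)
qed

text \<open>This is what turns the change of the zero weight coordinates into the change of \<open>h \<beta>\<close> by
  \<open>\<langle>\<beta>,\<rho>\<rangle> \<xi> u (-\<rho>)\<close>.\<close>
lemma cartan_int_expansion:
  assumes fs: "fundamental_system \<Phi> a l" and "\<rho> \<in> \<Phi>" "\<beta> \<in> \<Phi>"
  shows "(\<Sum>s=1..l. cartan_int \<beta> (a s) * root_coeff a l s \<rho>) = cartan_int \<beta> \<rho>"
proof -
  have a: "a s \<in> \<Phi>" if "s \<in> {1..l}" for s using fs that by (auto simp: fundamental_system_def)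
  have "real_of_int (\<Sum>s=1..l. cartan_int \<beta> (a s) * root_coeff a l s \<rho>)
     = (\<Sum>s=1..l. real_of_int (root_coeff a l s \<rho>) * (\<beta> \<star> a s))"
    using a assms(3) by (simp add: cartan_int_root mult.commute)
  also have "\<dots> = \<beta> \<star> (\<Sum>s=1..l. real_of_int (root_coeff a l s \<rho>) *\<^sub>R a s)"
    by (simp add: pairing_def inner_sum_right sum_distrib_left mult_ac)
  also have "\<dots> = real_of_int (cartan_int \<beta> \<rho>)"
    using root_expansion[OF fs assms(2)] cartan_int_root[OF assms(3,2)] by simp
  finally show ?thesis by (simp only: of_int_eq_iff)
qed

end

definition cartan_value :: "(nat \<Rightarrow> 'a::real_inner) \<Rightarrow> nat \<Rightarrow> ('a weight_index \<Rightarrow> 'r::comm_ring_1) \<Rightarrow> 'a \<Rightarrow> 'r" where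
  "cartan_value a l v \<beta> = (\<Sum>s=1..l. of_int (cartan_int \<beta> (a s)) * v (Zero s))"

definition root_part :: "('a weight_index \<Rightarrow> 'r) \<Rightarrow> 'a \<Rightarrow> 'r" where
  "root_part v \<gamma> = v (Root \<gamma>)"

context adjoint_module
begin

lemma adjoint_space_sum:
  "(\<And>j. j \<in> J \<Longrightarrow> b j \<in> adjoint_space \<Phi> l) \<Longrightarrow>
    (\<lambda>i. \<Sum>j\<in>J. c j * (b j :: 'a weight_index \<Rightarrow> 'r) i) \<in> adjoint_space \<Phi> l"
  by (simp add: adjoint_space_def)

lemma action_sum:
  assumes g: "g \<in> carrier G" and "finite J" "\<And>j. j \<in> J \<Longrightarrow> b j \<in> adjoint_space \<Phi> l"
  shows "\<phi> g (\<lambda>i. \<Sum>j\<in>J. c j * b j i) = (\<lambda>i. \<Sum>j\<in>J. c j * \<phi> g (b j) i)"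
  using assms(2,3)
proof (induction J rule: finite_induct)
  case empty
  have "\<phi> g (\<lambda>i. 0 * (0::'r)) = (\<lambda>i. 0 * \<phi> g (\<lambda>i. 0) i)"
    by (rule action_scale[OF g]) (simp add: adjoint_space_def)
  then show ?case by simp
next
  case (insert j J)
  have "\<phi> g (\<lambda>i. c j * b j i + (\<Sum>j\<in>J. c j * b j i))
      = (\<lambda>i. \<phi> g (\<lambda>i. c j * b j i) i + \<phi> g (\<lambda>i. \<Sum>j\<in>J. c j * b j i) i)"
    by (rule action_add[OF g])
      (use insert.prems adjoint_space_sum[of J b] in \<open>auto simp: adjoint_space_def\<close>)
  then show ?case using insert action_scale[OF g, of "b j" "c j"] by simp
qed

lemma action_coordinates:
  assumes fin: "finite \<Phi>" and g: "g \<in> carrier G" and v: "v \<in> adjoint_space \<Phi> l"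
  shows "\<phi> g v i = (\<Sum>\<mu>\<in>\<Phi>. v (Root \<mu>) * \<phi> g (basis_vec (Root \<mu>)) i)
    + (\<Sum>s=1..l. v (Zero s) * \<phi> g (basis_vec (Zero s)) i)"
proof -
  let ?J = "Root ` \<Phi> \<union> Zero ` {1..l}"
  have J: "finite ?J" "Root ` \<Phi> \<inter> Zero ` {1..l} = {}" using fin by auto
  have split: "sum F ?J = (\<Sum>\<mu>\<in>\<Phi>. F (Root \<mu>)) + (\<Sum>s=1..l. F (Zero s))" for F :: "_ \<Rightarrow> 'r"
    using J by (simp add: sum.union_disjoint sum.reindex inj_on_def)
  have "v = (\<lambda>i. \<Sum>j\<in>?J. v j * basis_vec j i)"
  proof
    fix i
    have "(\<Sum>j\<in>?J. v j * basis_vec j i) = (\<Sum>j\<in>?J. if j = i then v j else 0)"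
      by (rule sum.cong) (auto simp: basis_vec_def)
    also have "\<dots> = v i" using J(1) v by (auto simp: adjoint_space_def)
    finally show "v i = (\<Sum>j\<in>?J. v j * basis_vec j i)" by simp
  qed
  moreover have "\<phi> g (\<lambda>i. \<Sum>j\<in>?J. v j * basis_vec j i) = (\<lambda>i. \<Sum>j\<in>?J. v j * \<phi> g (basis_vec j) i)"
    by (rule action_sum[OF g J(1)]) (auto simp: adjoint_space_def basis_vec_def)
  ultimately have "\<phi> g v i = (\<Sum>j\<in>?J. v j * \<phi> g (basis_vec j) i)" by metis
  then show ?thesis by (simp only: split)
qed

lemma action_zero_coordinate:
  assumes sc: "structure_constants \<Phi> N" and v: "v \<in> adjoint_space \<Phi> l" and r: "\<rho> \<in> \<Phi>"
    and s: "s \<in> {1..l}"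
  shows "\<phi> (x \<rho> \<xi>) v (Zero s) = v (Zero s) + of_int (root_coeff a l s \<rho>) * \<xi> * v (Root (- \<rho>))"
proof -
  interpret structure_constants \<Phi> N by (rule sc)
  have "\<phi> (x \<rho> \<xi>) (basis_vec (Root \<mu>)) (Zero s) =
      (if \<mu> = - \<rho> then of_int (root_coeff a l s \<rho>) * \<xi> else 0)" if m: "\<mu> \<in> \<Phi>" for \<mu>
  proof -
    consider "\<mu> = - \<rho>" | "\<mu> + \<rho> \<in> \<Phi>" "\<mu> \<noteq> - \<rho>" | "\<mu> + \<rho> \<notin> \<Phi> \<union> {0}" "\<mu> \<noteq> - \<rho>"
      by (auto simp: eq_neg_iff_add_eq_0)
    then show ?thesis
    proof cases
      case 1
      have "(\<Sum>t=1..l. of_int (root_coeff a l t \<rho>) * \<xi> * basis_vec (Zero t) (Zero s))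
        = (\<Sum>t=1..l. if t = s then of_int (root_coeff a l t \<rho>) * \<xi> else 0)"
        by (rule sum.cong) (auto simp: basis_vec_def)
      then show ?thesis using 1 x_opposite[OF r, of \<xi>] s by (simp add: basis_vec_def)
    next
      case 2
      then show ?thesis using x_shift[OF r m, of \<xi>] by (simp add: basis_vec_def)
    next
      case 3
      then show ?thesis using x_fixed[OF r m, of \<xi>] by (simp add: basis_vec_def)
    qed
  qed
  then have "(\<Sum>\<mu>\<in>\<Phi>. v (Root \<mu>) * \<phi> (x \<rho> \<xi>) (basis_vec (Root \<mu>)) (Zero s))
      = (\<Sum>\<mu>\<in>\<Phi>. if \<mu> = - \<rho> then of_int (root_coeff a l s \<rho>) * \<xi> * v (Root \<mu>) else 0)"
    by (intro sum.cong) (simp_all add: mult.commute)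
  also have "\<dots> = of_int (root_coeff a l s \<rho>) * \<xi> * v (Root (- \<rho>))"
    using finite_roots r by simp
  finally have 1: "(\<Sum>\<mu>\<in>\<Phi>. v (Root \<mu>) * \<phi> (x \<rho> \<xi>) (basis_vec (Root \<mu>)) (Zero s))
      = of_int (root_coeff a l s \<rho>) * \<xi> * v (Root (- \<rho>))" .
  have "(\<Sum>t=1..l. v (Zero t) * \<phi> (x \<rho> \<xi>) (basis_vec (Zero t)) (Zero s))
      = (\<Sum>t=1..l. if t = s then v (Zero t) else 0)"
    by (rule sum.cong[OF refl]) (use x_zero[OF r] in \<open>auto simp: basis_vec_def\<close>)
  also have "\<dots> = v (Zero s)" using s by simp
  finally show ?thesis
    using action_coordinates[OF finite_roots x_closed[OF r] v, of \<xi> "Zero s"] 1 by simp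
qed

text \<open>The coordinate at \<open>\<nu>\<close> collects contributions from the basis vectors of weights \<open>\<nu>\<close> and \<open>\<nu> - \<rho>\<close>, and for
  \<open>\<nu> = \<rho>\<close> also from those of weights \<open>-\<rho>\<close> and 0. The identity holds at all \<open>\<nu>\<close>,
  including those that are not roots, where both sides vanish.\<close>
lemma action_root_coordinate:
  assumes sc: "structure_constants \<Phi> N" and v: "v \<in> adjoint_space \<Phi> l" and r: "\<rho> \<in> \<Phi>"
  shows "root_part (\<phi> (x \<rho> \<xi>) v) =
    structure_constants.unipotent_root N \<rho> \<xi> (root_part v) (cartan_value a l v)"
proof
  fix \<nu>
  interpret structure_constants \<Phi> N by (rule sc)
  have zero: "v (Root \<gamma>) = 0" if "\<gamma> \<notin> \<Phi>" for \<gamma> using v that by (auto simp: adjoint_space_def)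
  show "root_part (\<phi> (x \<rho> \<xi>) v) \<nu> = unipotent_root \<rho> \<xi> (root_part v) (cartan_value a l v) \<nu>"
  proof (cases "\<nu> \<in> \<Phi>")
    case False
    have "\<phi> (x \<rho> \<xi>) v \<in> adjoint_space \<Phi> l" using element_image[OF x_closed[OF r] v] by blast
    then have "\<phi> (x \<rho> \<xi>) v (Root \<nu>) = 0" using False by (auto simp: adjoint_space_def)
    moreover have "\<nu> - \<rho> \<notin> \<Phi>" if "\<nu> \<star> \<rho> = 1"
      using add_root[of "\<nu> - \<rho>" \<rho>] that r False by auto
    ultimately show ?thesis using False r zero by (auto simp: unipotent_root_def root_part_def)
  next
    case n: True
    have e: "\<phi> (x \<rho> \<xi>) (basis_vec (Root \<mu>)) (Root \<nu>) = (if \<mu> = \<nu> then 1 else 0)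
        + (if \<mu> = \<nu> - \<rho> then of_int (N \<rho> (\<nu> - \<rho>)) * \<xi> else 0)
        - (if \<mu> = - \<rho> then (if \<nu> = \<rho> then \<xi>\<^sup>2 else 0) else 0)" if m: "\<mu> \<in> \<Phi>" for \<mu>
    proof -
      consider "\<mu> = - \<rho>" | "\<mu> + \<rho> \<in> \<Phi>" "\<mu> \<noteq> - \<rho>" | "\<mu> + \<rho> \<notin> \<Phi> \<union> {0}" "\<mu> \<noteq> - \<rho>"
        by (auto simp: eq_neg_iff_add_eq_0)
      then show ?thesis
      proof cases
        case 1
        have "\<nu> \<noteq> 0" using n root_nonzero by blast
        then show ?thesis using 1 x_opposite[OF r, of \<xi>] by (auto simp: basis_vec_def)
      next
        case 2
        then show ?thesis using x_shift[OF r m, of \<xi>] by (auto simp: basis_vec_def algebra_simps)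
      next
        case 3
        then have "\<mu> \<noteq> \<nu> - \<rho>" using n by auto
        then show ?thesis using 3 x_fixed[OF r m, of \<xi>] by (auto simp: basis_vec_def)
      qed
    qed
    have d: "(\<Sum>\<mu>\<in>\<Phi>. v (Root \<mu>) * (if \<mu> = \<kappa> then c else 0)) = c * v (Root \<kappa>)" for \<kappa> c
    proof -
      have "(\<Sum>\<mu>\<in>\<Phi>. v (Root \<mu>) * (if \<mu> = \<kappa> then c else 0)) = (\<Sum>\<mu>\<in>\<Phi>. if \<mu> = \<kappa> then c * v (Root \<mu>) else 0)"
        by (rule sum.cong) (auto simp: mult.commute)
      then show ?thesis using zero finite_roots by simp
    qed
    have "(\<Sum>\<mu>\<in>\<Phi>. v (Root \<mu>) * \<phi> (x \<rho> \<xi>) (basis_vec (Root \<mu>)) (Root \<nu>))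
      = (\<Sum>\<mu>\<in>\<Phi>. v (Root \<mu>) * (if \<mu> = \<nu> then 1 else 0)
          + v (Root \<mu>) * (if \<mu> = \<nu> - \<rho> then of_int (N \<rho> (\<nu> - \<rho>)) * \<xi> else 0)
          - v (Root \<mu>) * (if \<mu> = - \<rho> then (if \<nu> = \<rho> then \<xi>\<^sup>2 else 0) else 0))"
      by (rule sum.cong[OF refl]) (simp only: e right_diff_distrib distrib_left)
    also have "\<dots> = v (Root \<nu>) + of_int (N \<rho> (\<nu> - \<rho>)) * \<xi> * v (Root (\<nu> - \<rho>))
        - (if \<nu> = \<rho> then \<xi>\<^sup>2 else 0) * v (Root (- \<rho>))"
      unfolding sum_subtractf sum.distrib d by simp
    finally have 1: "(\<Sum>\<mu>\<in>\<Phi>. v (Root \<mu>) * \<phi> (x \<rho> \<xi>) (basis_vec (Root \<mu>)) (Root \<nu>))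
      = v (Root \<nu>) + of_int (N \<rho> (\<nu> - \<rho>)) * \<xi> * v (Root (\<nu> - \<rho>))
        - (if \<nu> = \<rho> then \<xi>\<^sup>2 else 0) * v (Root (- \<rho>))" .
    have "(\<Sum>s=1..l. v (Zero s) * \<phi> (x \<rho> \<xi>) (basis_vec (Zero s)) (Root \<nu>))
      = (\<Sum>s=1..l. - ((if \<nu> = \<rho> then \<xi> else 0) * (of_int (cartan_int \<rho> (a s)) * v (Zero s))))"
      by (rule sum.cong[OF refl]) (use x_zero[OF r] in \<open>auto simp: basis_vec_def algebra_simps\<close>)
    also have "\<dots> = - (if \<nu> = \<rho> then \<xi> else 0) * cartan_value a l v \<rho>"
      by (simp only: sum_negf cartan_value_def sum_distrib_left mult_minus_left)
    finally have "\<phi> (x \<rho> \<xi>) v (Root \<nu>) = v (Root \<nu>) + of_int (N \<rho> (\<nu> - \<rho>)) * \<xi> * v (Root (\<nu> - \<rho>))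
        - (if \<nu> = \<rho> then \<xi>\<^sup>2 else 0) * v (Root (- \<rho>)) - (if \<nu> = \<rho> then \<xi> else 0) * cartan_value a l v \<rho>"
      using action_coordinates[OF finite_roots x_closed[OF r] v, of \<xi> "Root \<nu>"] 1 by simp
    moreover have "v (Root (\<nu> - \<rho>)) = 0" if "\<nu> \<star> \<rho> \<noteq> 1"
      using zero pairing_of_root_diff n r that by blast
    moreover have "v (Root 0) = 0" using zero root_nonzero by blast
    ultimately show ?thesis by (auto simp: unipotent_root_def root_part_def)
  qed
qed

lemma action_cartan_value:
  assumes sc: "structure_constants \<Phi> N" and fs: "fundamental_system \<Phi> a l"
    and v: "v \<in> adjoint_space \<Phi> l" and r: "\<rho> \<in> \<Phi>" and b: "\<beta> \<in> \<Phi>"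
  shows "cartan_value a l (\<phi> (x \<rho> \<xi>) v) \<beta> =
    structure_constants.unipotent_zero \<rho> \<xi> (root_part v) (cartan_value a l v) \<beta>"
proof -
  interpret structure_constants \<Phi> N by (rule sc)
  have "cartan_value a l (\<phi> (x \<rho> \<xi>) v) \<beta> = (\<Sum>s=1..l. of_int (cartan_int \<beta> (a s)) * v (Zero s)
      + of_int (cartan_int \<beta> (a s) * root_coeff a l s \<rho>) * (\<xi> * v (Root (- \<rho>))))"
    unfolding cartan_value_def
    by (rule sum.cong[OF refl]) (simp add: action_zero_coordinate[OF sc v r] algebra_simps)
  also have "\<dots> = cartan_value a l v \<beta> + of_int (\<Sum>s=1..l. cartan_int \<beta> (a s) * root_coeff a l s \<rho>) * (\<xi> * v (Root (- \<rho>)))"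
    by (simp only: sum.distrib cartan_value_def sum_distrib_right of_int_sum)
  finally show ?thesis
    unfolding cartan_int_expansion[OF fs r b]
    by (simp add: unipotent_zero_def root_part_def mult.assoc)
qed

lemma unipotent_inverse:
  assumes sc: "structure_constants \<Phi> N" and fs: "fundamental_system \<Phi> a l"
    and v: "v \<in> adjoint_space \<Phi> l" and r: "\<rho> \<in> \<Phi>"
  shows "\<phi> (x \<rho> (- \<xi>)) (\<phi> (x \<rho> \<xi>) v) = v"
proof
  fix i
  interpret structure_constants \<Phi> N by (rule sc)
  let ?w = "\<phi> (x \<rho> \<xi>) v"
  have w: "?w \<in> adjoint_space \<Phi> l" using element_image[OF x_closed[OF r] v] by blast
  have w2: "\<phi> (x \<rho> (- \<xi>)) ?w \<in> adjoint_space \<Phi> l" using element_image[OF x_closed[OF r] w] by blast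
  have opp: "?w (Root (- \<rho>)) = v (Root (- \<rho>))"
  proof -
    have "(- \<rho>) \<star> \<rho> = -2" using r by simp
    then have "- \<rho> \<noteq> \<rho>" using self_pairing[OF r] by (metis neg_equal_zero zero_neq_numeral)
    then show ?thesis using fun_cong[OF action_root_coordinate[OF sc v r, of \<xi>], of "- \<rho>"] r
      by (simp add: root_part_def unipotent_root_def)
  qed
  have "cartan_int \<rho> \<rho> = 2" using cartan_int_eqI[of \<rho> \<rho> 2] r by simp
  then have cv: "cartan_value a l ?w \<rho> = cartan_value a l v \<rho> + 2 * \<xi> * v (Root (- \<rho>))"
    using action_cartan_value[OF sc fs v r r, of \<xi>] by (simp add: unipotent_zero_def root_part_def)
  consider (root) \<nu> where "i = Root \<nu>" | (zero) s where "i = Zero s" "s \<in> {1..l}"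
    | (out) "i \<notin> Root ` \<Phi> \<union> Zero ` {1..l}" by blast
  then show "\<phi> (x \<rho> (- \<xi>)) ?w i = v i"
  proof cases
    case root
    have "?w (Root (\<nu> - \<rho>)) = v (Root (\<nu> - \<rho>))" if "\<nu> \<star> \<rho> = 1"
    proof -
      have p: "(\<nu> - \<rho>) \<star> \<rho> = -1" using that r by simp
      have "\<nu> - \<rho> \<noteq> \<rho>"
      proof
        assume "\<nu> - \<rho> = \<rho>"
        then have "\<rho> \<star> \<rho> = -1" using p by (simp only:)
        then show False using r by simp
      qed
      then show ?thesis
        using fun_cong[OF action_root_coordinate[OF sc v r, of \<xi>], of "\<nu> - \<rho>"] p
        by (simp add: root_part_def unipotent_root_def)
    qed
    then show ?thesis
      using fun_cong[OF action_root_coordinate[OF sc w r, of "- \<xi>"], of \<nu>]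
        fun_cong[OF action_root_coordinate[OF sc v r, of \<xi>], of \<nu>] root opp cv
      by (auto simp: root_part_def unipotent_root_def power2_eq_square algebra_simps)
  next
    case zero
    then show ?thesis
      using action_zero_coordinate[OF sc w r, of s "- \<xi>"] action_zero_coordinate[OF sc v r, of s \<xi>] opp by simp
  next
    case out
    then show ?thesis using v w2 by (auto simp: adjoint_space_def)
  qed
qed

section \<open>Invariance of the solution set\<close>

lemma solution_set_iff:
  assumes "structure_constants \<Phi> N"
  shows "v \<in> solution_set \<Phi> a l N \<longleftrightarrow> v \<in> adjoint_space \<Phi> l \<and>
    structure_constants.solves \<Phi> N (root_part v) (cartan_value a l v)"
proof -
  interpret structure_constants \<Phi> N by (rule assms)
  have orth: "orthogonal \<alpha> \<beta> \<longleftrightarrow> \<alpha> \<star> \<beta> = 0" for \<alpha> \<beta> :: 'a by (simp add: orthogonal_def pairing_def)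
  have v: "root_part v = (\<lambda>\<gamma>. v (Root \<gamma>))"
    "cartan_value a l v = (\<lambda>\<beta>. \<Sum>s=1..l. of_int (cartan_int \<beta> (a s)) * v (Zero s))"
    by (simp_all add: fun_eq_iff root_part_def cartan_value_def)
  have "equation_half_pi \<Phi> N v \<alpha> \<beta> \<and> equation_two_thirds_pi \<Phi> a l N v \<alpha> \<beta> \<and> equation_pi \<Phi> a l v \<alpha> \<beta> \<longleftrightarrow>
      half_pi_form (root_part v) \<alpha> \<beta> = 0 \<and> two_thirds_form (root_part v) (cartan_value a l v) \<alpha> \<beta> = 0
      \<and> pi_form (root_part v) (cartan_value a l v) \<alpha> \<beta> = 0"
    if "\<alpha> \<in> \<Phi>" "\<beta> \<in> \<Phi>" "\<alpha> \<star> \<beta> = 0" for \<alpha> \<beta>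
    unfolding v equation_half_pi_iff[OF that] equation_two_thirds_pi_iff[OF that] equation_pi_iff[OF that] ..
  then show ?thesis
    unfolding solution_set_def solves_def orth by blast
qed

lemma unipotent_solution_set:
  assumes sc: "structure_constants \<Phi> N" and fs: "fundamental_system \<Phi> a l" and r: "\<rho> \<in> \<Phi>"
    and v: "v \<in> solution_set \<Phi> a l N"
  shows "\<phi> (x \<rho> \<xi>) v \<in> solution_set \<Phi> a l N"
proof -
  interpret structure_constants \<Phi> N by (rule sc)
  have vV: "v \<in> adjoint_space \<Phi> l" and s: "solves (root_part v) (cartan_value a l v)"
    using v solution_set_iff[OF sc] by blast+
  have a: "a s \<in> \<Phi>" if "s \<in> {1..l}" for s using fs that by (auto simp: fundamental_system_def)
  interpret root_unipotent \<Phi> N \<rho> \<xi> "root_part v" "cartan_value a l v"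
  proof
    fix \<alpha> \<beta> assume "\<alpha> \<in> \<Phi>" "\<beta> \<in> \<Phi>" "\<alpha> + \<beta> \<in> \<Phi>"
    then have "cartan_int (\<alpha> + \<beta>) (a s) = cartan_int \<alpha> (a s) + cartan_int \<beta> (a s)" if "s \<in> {1..l}" for s
      by (intro cartan_int_eqI) (use a[OF that] in \<open>simp_all add: cartan_int_root\<close>)
    then show "cartan_value a l v (\<alpha> + \<beta>) = cartan_value a l v \<alpha> + cartan_value a l v \<beta>"
      by (simp add: cartan_value_def distrib_right flip: sum.distrib)
  next
    fix \<alpha> assume "\<alpha> \<in> \<Phi>"
    then show "cartan_value a l v (- \<alpha>) = - cartan_value a l v \<alpha>"
      using cartan_int_minus a by (simp add: cartan_value_def flip: sum_negf)
  qed (rule r)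
  have "solves (root_part (\<phi> (x \<rho> \<xi>) v)) (cartan_value a l (\<phi> (x \<rho> \<xi>) v))"
    using solves_unipotent[OF s] action_cartan_value[OF sc fs vV r]
    unfolding action_root_coordinate[OF sc vV r] solves_def two_thirds_form_def pi_form_def by simp
  then show ?thesis
    using element_image[OF x_closed[OF r] vV] solution_set_iff[OF sc] by blast
qed

end

theorem theorem1:
  fixes \<Phi> :: "'a::euclidean_space set" and a :: "nat \<Rightarrow> 'a" and l :: nat
    and scale :: "complex \<Rightarrow> 'g::ab_group_add \<Rightarrow> 'g" and bracket :: "'g \<Rightarrow> 'g \<Rightarrow> 'g"
    and e h :: "'a \<Rightarrow> 'g" and N :: "'a \<Rightarrow> 'a \<Rightarrow> int"
    and G :: "('G, 'm) monoid_scheme"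
    and \<phi> :: "'G \<Rightarrow> ('a weight_index \<Rightarrow> 'r::comm_ring_1) \<Rightarrow> ('a weight_index \<Rightarrow> 'r)"
    and x :: "'a \<Rightarrow> 'r \<Rightarrow> 'G"
  assumes "root_system \<Phi>"
    and "\<forall>\<alpha>\<in>\<Phi>. norm \<alpha> = 1"
    and "fundamental_system \<Phi> a l"
    and "(l \<ge> 5 \<and> simply_laced_diagram a l (D_edges l)) \<or>
         (l \<in> {6, 7, 8} \<and> simply_laced_diagram a l (E_edges l))"
    and "chevalley_basis scale bracket \<Phi> a l e h N"
    and "adjoint_module G \<Phi> l \<phi> a N x"
    and "g \<in> elementary_subgroup G \<Phi> x"
  shows "\<phi> g ` solution_set \<Phi> a l N = solution_set \<Phi> a l N"
proof -
  interpret adjoint_module G \<Phi> l \<phi> a N x by (rule assms(6))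
  have sc: "structure_constants \<Phi> N"
    by (rule chevalley_basis.unit_structure_constants[OF assms(5,1,2)])
  let ?S = "solution_set \<Phi> a l N :: ('a weight_index \<Rightarrow> 'r) set" and ?V = "adjoint_space \<Phi> l :: ('a weight_index \<Rightarrow> 'r) set"
  have SV: "?S \<subseteq> ?V" by (auto simp: solution_set_def)
  have gen: "\<phi> (x \<rho> \<xi>) ` ?S = ?S" if r: "\<rho> \<in> \<Phi>" for \<rho> \<xi>
  proof (intro equalityI subsetI)
    show "v \<in> ?S" if "v \<in> \<phi> (x \<rho> \<xi>) ` ?S" for v
      using that unipotent_solution_set[OF sc assms(3) r] by blast
    fix v assume v: "v \<in> ?S"
    have "\<phi> (x \<rho> (- \<xi>)) v \<in> ?S" by (rule unipotent_solution_set[OF sc assms(3) r v])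
    moreover have "\<phi> (x \<rho> \<xi>) (\<phi> (x \<rho> (- \<xi>)) v) = v"
      using unipotent_inverse[OF sc assms(3) _ r, of v "- \<xi>"] v SV by auto
    ultimately show "v \<in> \<phi> (x \<rho> \<xi>) ` ?S" by (metis imageI)
  qed
  have carrier: "{x \<rho> \<xi> |\<rho> \<xi>. \<rho> \<in> \<Phi>} \<subseteq> carrier G" using x_closed by blast
  have "g \<in> generate G {x \<rho> \<xi> |\<rho> \<xi>. \<rho> \<in> \<Phi>}" using assms(7) by (simp add: elementary_subgroup_def)
  then show ?thesis
  proof (induction rule: generate.induct)
    case one
    have "\<phi> \<one>\<^bsub>G\<^esub> v = v" if "v \<in> ?S" for v
      using id_eq_one SV that by (metis restrict_apply' subsetD)
    then show ?case by force
  next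
    case (incl g)
    then show ?case using gen by blast
  next
    case (inv g)
    then have g: "g \<in> carrier G" "\<phi> g ` ?S = ?S" using gen carrier by blast+
    have "\<phi> (inv\<^bsub>G\<^esub> g) (\<phi> g v) = v" if "v \<in> ?S" for v
      using orbit_sym_aux[OF g(1)] SV that by blast
    then have "\<phi> (inv\<^bsub>G\<^esub> g) ` (\<phi> g ` ?S) = ?S" by (simp add: image_image)
    then show ?case by (simp only: g(2))
  next
    case (eng g1 g2)
    then have c: "g1 \<in> carrier G" "g2 \<in> carrier G"
      using group.generate_in_carrier[OF group_hom.axioms(1)[OF group_hom] carrier] by blast+
    have "\<phi> (g1 \<otimes>\<^bsub>G\<^esub> g2) v = \<phi> g1 (\<phi> g2 v)" if "v \<in> ?S" for v
      using composition_rule[OF _ c] SV that by blast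
    then have "\<phi> (g1 \<otimes>\<^bsub>G\<^esub> g2) ` ?S = \<phi> g1 ` (\<phi> g2 ` ?S)" by (simp add: image_image)
    then show ?case using eng.IH by simp
  qed
qed

end
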